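(* Assume (A1) and (A2) (see context). Then there exists some finite constant $c(\rho)<\infty$ such that for any bounded measurable $f:S_n\to\mathbb{R}^+$, any $z\in S_n$ and any $N\ge c(\rho)\,n$, $$\left(1-c(\rho)\,\frac nN\right)\mathbb{F}_n(f)(z)\ \le\ \mathbb{K}_n(f)(z)\ \le\ \left(1+c(\rho)\,\frac nN\right)\mathbb{F}_n(f)(z)$$ and $$\mathbb{K}^{\flat}_n(f)(z)\ \ge\ \left(1-c(\rho)\,\frac nN\right)\,\eta_n(f)/\gamma_{z,n}(1).$$
   Context: **Feynman-Kac model on path space.** Let $(S'_n)_{n\ge0}$ be measurable spaces, $X'_n\in S'_n$ a Markov chain with initial distribution $\eta_0$ on $S'_0$ and Markov transitions $M'_n$ from $S'_{n-1}$ into $S'_n$, and $G'_n:S'_n\to(0,\infty)$ bounded measurable. Let $S_n=S'_0\times\dots\times S'_n$, $X_n=(X'_0,\dots,X'_n)$ with transitions $M_n$ from $S_{n-1}$ into $S_n$, and $G_n(x'_0,\dots,x'_n)=G'_n(x'_n)$. Define $\gamma_n(f)=\mathbb{E}\bigl(f(X_n)\prod_{0\le p<n}G_p(X_p)\bigr)$, $\eta_n(f)=\gamma_n(f)/\gamma_n(1)$, $Q_{n+1}(x,dy)=G_n(x)M_{n+1}(x,dy)$, $Q_{p,n}=Q_{p+1}\cdots Q_n$, $Q_{n,n}=Id$. The potential functions are normalized so that $\eta_n(G_n)=1$ for all $n$ (hence $\gamma_n=\eta_n$). The integer $n$ is the time horizon and $N$ is the number of particles. **(A1)** For any $n\ge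 0$ there is $\rho_n<\infty$ with $Q_{p,q}(1)(x_p)\le\rho_n Q_{p,q}(1)(y_p)$ for all $0\le p\le q\le n$, $x_p,y_p\in S_p$. **(A2)** With $\eta^x_{p,n}(\cdot)\propto Q_{p,n}(x,\cdot)$ (probability measure), there is $\alpha:\mathbb{N}\to\mathbb{R}^+$ with $\sum_n\alpha(n)<\infty$ and $\sup_{x,y\in S_p}\|\eta^x_{p,n}-\eta^y_{p,n}\|_{tv}\le\alpha(n-p)$ for all $0\le p\le n$, where $\|\mu\|_{tv}=\sup_{\|f\|\le1}|\mu(f)|$; and there are $0<\beta_1<\beta_2<\infty$ with $\beta_1\le\inf_{n,x}G_n(x)<\sup_{n,x}G_n(x)\le\beta_2$. (A1)-(A2) are regarded as met as soon as they hold for the marginal model $(S'_n,G'_n,M'_n)$. Under them $\rho:=\sup_n\rho_n<\infty$. **Frozen path.** For $z=(z'_0,\dots,z'_n)\in S_n$ let $z_k:=(z'_0,\dots,z'_k)\in S_k$, $0\le k\le n$. **Dual particle model.** Let $m(x)=\frac1N\sum_{i=1}^N\delta_{x^i}$ for $x=(x^i)_{1\le i\le N}$, $\Psi_G(\eta)(dx)=G(x)\eta(dx)/\eta(G)$, $\Phi_k(\eta)=\Psi_{G_{k-1}}(\eta)M_k$. $\mathcal{X}_{z,k}=(\mathcal{X}^i_{z,k})_{1\le i\le N}\in S_k^N$, $0\le k\le n$, is the Markov chain with initial distribution $\frac1N\sum_{i=1}^N\eta_0^{\otimes(i-1)}\otimes\delta_{z_0}\otimes\eta_0^{\otimes(N-i)}$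 and transitions $$\mathcal{M}_{z,k}(x_{k-1},\cdot)=\frac1N\sum_{i=1}^N\Phi_k(m(x_{k-1}))^{\otimes(i-1)}\otimes\delta_{z_k}\otimes\Phi_k(m(x_{k-1}))^{\otimes(N-i)}.$$ $\mathcal{X}'_{z,k}\in(S'_k)^N$ is the process defined in the same way from $(S'_k,G'_k,M'_k)$ and the frozen states $z'_k$. **Backward kernel.** It is assumed that $G'_k(x)M'_{k+1}(x,dy)=H'_{k+1}(x,y)\nu'_{k+1}(dy)$ for a density $H'_{k+1}$ and a reference measure $\nu'_{k+1}$ on $S'_{k+1}$. For a sequence $x=(x_k)_k$ with $x_k\in (S'_k)^N$, $$\mathbb{H}_{n,m(x)}(u,d(y_0,\dots,y_n))=\delta_u(dy_n)\prod_{0\le k<n}\frac{m(x_k)(dy_k)H'_{k+1}(y_k,y_{k+1})}{m(x_k)(H'_{k+1}(\cdot,y_{k+1}))}.$$ **Particle Gibbs kernels.** $\mathbb{K}_n(f)(z)=\mathbb{E}\left(m(\mathcal{X}_{z,n})(f)\right)$ and $\mathbb{K}^\flat_n(f)(z)=\mathbb{E}\left(m(\mathcal{X}'_{z,n})\mathbb{H}_{n,m(\mathcal{X}'_z)}(f)\right)$. **Feynman-Kac model with a frozen path.** Let $X_{z,k}\in S_k$ be the Markov chain with initial law $\eta_{z,0}=\frac1N\delta_{z_0}+(1-\frac1N)\eta_0$ and transitions $M_{z,k}(x,\cdot)=\frac1N\delta_{z_k}+(1-\frac1N)M_k(x,\cdot)$. Then $\gamma_{z,n}(f)=\mathbb{E}\bigl(f(X_{z,n})\prod_{0\le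 k<n}G_k(X_{z,k})\bigr)$, $\eta_{z,n}(f)=\gamma_{z,n}(f)/\gamma_{z,n}(1)$ and $\mathbb{F}_n(f)(z)=\eta_{z,n}(f)$.
   Formalization: The lower bound for the backward-sampling kernel is stated for n ≥ 1 only, since at n = 0 it fails whenever f(z) < η_0(f); c(ρ) is uniform over all models whose state spaces lie in one fixed, arbitrary carrier set. *)

theory Defs
  imports "HOL-Probability.Probability"
begin

section \<open>Markov chains and path spaces\<close>

text \<open>
  A sequence of measurable spaces is rendered as \<open>S :: nat \<Rightarrow> 'a measure\<close>; only \<open>space (S k)\<close> and
  \<open>sets (S k)\<close> matter. The path space \<open>S\<^sub>0 \<times> \<dots> \<times> S\<^sub>n\<close> is \<open>PiM {..n} S\<close>. In all families of
  transitions, \<open>K k\<close> goes from \<open>S (k - 1)\<close> to \<open>S k\<close>, and \<open>K 0\<close> is never used.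
\<close>

definition path_init :: "(nat \<Rightarrow> 'a measure) \<Rightarrow> 'a measure \<Rightarrow> (nat \<Rightarrow> 'a) measure" where
  "path_init S \<mu> = distr \<mu> (PiM {..0} S) (\<lambda>x. \<lambda>k\<in>{..0}. x)"

definition path_kernel ::
  "(nat \<Rightarrow> 'a measure) \<Rightarrow> (nat \<Rightarrow> 'a \<Rightarrow> 'a measure) \<Rightarrow> nat \<Rightarrow> (nat \<Rightarrow> 'a) \<Rightarrow> (nat \<Rightarrow> 'a) measure" where
  "path_kernel S K k w = distr (K k (w (k - 1))) (PiM {..k} S) (\<lambda>y. w(k := y))"

text \<open>The joint law of \<open>(X\<^sub>0, \<dots>, X\<^sub>n)\<close> for the chain with initial law \<open>\<mu>\<close> and transitions \<open>K\<close>.\<close>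

primrec chain_law ::
  "(nat \<Rightarrow> 'a measure) \<Rightarrow> 'a measure \<Rightarrow> (nat \<Rightarrow> 'a \<Rightarrow> 'a measure) \<Rightarrow> nat \<Rightarrow> (nat \<Rightarrow> 'a) measure" where
  "chain_law S \<mu> K 0 = path_init S \<mu>"
| "chain_law S \<mu> K (Suc n) = chain_law S \<mu> K n \<bind> path_kernel S K (Suc n)"


section \<open>Feynman-Kac models\<close>

record 'a fk_model =
  state :: "nat \<Rightarrow> 'a measure"
  init :: "'a measure"
  mkernel :: "nat \<Rightarrow> 'a \<Rightarrow> 'a measure"
  pot :: "nat \<Rightarrow> 'a \<Rightarrow> real"

definition is_fk_model :: "'a fk_model \<Rightarrow> bool" where
  "is_fk_model F \<longleftrightarrow>
     init F \<in> space (prob_algebra (state F 0)) \<and>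
     (\<forall>k. mkernel F (Suc k) \<in> state F k \<rightarrow>\<^sub>M prob_algebra (state F (Suc k))) \<and>
     (\<forall>k. pot F k \<in> borel_measurable (state F k)) \<and>
     (\<forall>k. \<forall>x\<in>space (state F k). 0 < pot F k x) \<and>
     (\<forall>k. \<exists>B. \<forall>x\<in>space (state F k). pot F k x \<le> B)"

definition path_model :: "'a fk_model \<Rightarrow> (nat \<Rightarrow> 'a) fk_model" where
  "path_model F =
     \<lparr> state = (\<lambda>n. PiM {..n} (state F)),
       init = path_init (state F) (init F),
       mkernel = path_kernel (state F) (mkernel F),
       pot = (\<lambda>n w. pot F n (w n)) \<rparr>"

definition fk_gamma :: "'a fk_model \<Rightarrow> nat \<Rightarrow> ('a \<Rightarrow> real) \<Rightarrow> real" where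
  "fk_gamma F n f =
     (\<integral>w. f (w n) * (\<Prod>p<n. pot F p (w p)) \<partial>chain_law (state F) (init F) (mkernel F) n)"

definition fk_eta :: "'a fk_model \<Rightarrow> nat \<Rightarrow> ('a \<Rightarrow> real) \<Rightarrow> real" where
  "fk_eta F n f = fk_gamma F n f / fk_gamma F n (\<lambda>_. 1)"

text \<open>
  \<open>fk_Q F p n\<close> is the operator \<open>f \<mapsto> Q\<^sub>p\<^sub>,\<^sub>n(f)\<close> on bounded measurable functions, for \<open>p \<le> n\<close>.
\<close>

primrec fk_Q :: "'a fk_model \<Rightarrow> nat \<Rightarrow> nat \<Rightarrow> ('a \<Rightarrow> real) \<Rightarrow> 'a \<Rightarrow> real" where
  "fk_Q F p 0 f = f"
| "fk_Q F p (Suc n) f =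
     (if p \<le> n then fk_Q F p n (\<lambda>x. pot F n x * (\<integral>y. f y \<partial>mkernel F (Suc n) x)) else f)"

text \<open>The probability measure proportional to \<open>Q\<^sub>p\<^sub>,\<^sub>n(x, \<cdot>)\<close>, as a functional on test functions.\<close>

definition fk_eta_from :: "'a fk_model \<Rightarrow> nat \<Rightarrow> nat \<Rightarrow> 'a \<Rightarrow> ('a \<Rightarrow> real) \<Rightarrow> real" where
  "fk_eta_from F p n x f = fk_Q F p n f x / fk_Q F p n (\<lambda>_. 1) x"

text \<open>
  The norm of a signed measure given as a functional. It takes values up to \<open>2\<close> on differences of
  probability measures.
\<close>

definition tv_norm :: "'a measure \<Rightarrow> (('a \<Rightarrow> real) \<Rightarrow> real) \<Rightarrow> real" where
  "tv_norm S \<mu> = (SUP f\<in>{f \<in> borel_measurable S. \<forall>x\<in>space S. \<bar>f x\<bar> \<le> 1}. \<bar>\<mu> f\<bar>)"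


section \<open>Regularity assumptions\<close>

definition fk_ratio_bound :: "'a fk_model \<Rightarrow> nat \<Rightarrow> real \<Rightarrow> bool" where
  "fk_ratio_bound F n r \<longleftrightarrow>
     (\<forall>p q. p \<le> q \<and> q \<le> n \<longrightarrow>
        (\<forall>x\<in>space (state F p). \<forall>y\<in>space (state F p).
           fk_Q F p q (\<lambda>_. 1) x \<le> r * fk_Q F p q (\<lambda>_. 1) y))"

definition fk_A1 :: "'a fk_model \<Rightarrow> bool" where
  "fk_A1 F \<longleftrightarrow> (\<forall>n. \<exists>r. fk_ratio_bound F n r)"

text \<open>
  \<open>fk_rho_at F n\<close> is the smallest admissible constant \<open>\<rho>\<^sub>n\<close>. The supremum over \<open>n\<close> is a real
  supremum, which is meaningful because the two assumptions bound the sequence.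
\<close>

definition fk_rho_at :: "'a fk_model \<Rightarrow> nat \<Rightarrow> real" where
  "fk_rho_at F n = Inf {r. fk_ratio_bound F n r}"

definition fk_rho :: "'a fk_model \<Rightarrow> real" where
  "fk_rho F = (SUP n. fk_rho_at F n)"

text \<open>The extrema of the potentials are taken in \<open>ereal\<close>, so that they exist unconditionally.\<close>

definition fk_A2 :: "'a fk_model \<Rightarrow> bool" where
  "fk_A2 F \<longleftrightarrow>
     (\<exists>\<alpha> :: nat \<Rightarrow> real. (\<forall>k. 0 \<le> \<alpha> k) \<and> summable \<alpha> \<and>
        (\<forall>p n. p \<le> n \<longrightarrow>
           (\<forall>x\<in>space (state F p). \<forall>y\<in>space (state F p).
              tv_norm (state F n) (\<lambda>f. fk_eta_from F p n x f - fk_eta_from F p n y f) \<le> \<alpha> (n - p)))) \<and>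
     (\<exists>\<beta>\<^sub>1 \<beta>\<^sub>2 :: real. 0 < \<beta>\<^sub>1 \<and> \<beta>\<^sub>1 < \<beta>\<^sub>2 \<and>
        ereal \<beta>\<^sub>1 \<le> (INF n. INF x\<in>space (state F n). ereal (pot F n x)) \<and>
        (INF n. INF x\<in>space (state F n). ereal (pot F n x))
          < (SUP n. SUP x\<in>space (state F n). ereal (pot F n x)) \<and>
        (SUP n. SUP x\<in>space (state F n). ereal (pot F n x)) \<le> ereal \<beta>\<^sub>2)"


section \<open>The dual particle model\<close>

text \<open>An \<open>N\<close>-tuple is an element of \<open>PiM {..<N} (\<lambda>_. S)\<close>, so particles are indexed from \<open>0\<close>.\<close>

definition empirical :: "nat \<Rightarrow> 'a measure \<Rightarrow> (nat \<Rightarrow> 'a) \<Rightarrow> 'a measure" where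
  "empirical N S x = distr (uniform_count_measure {..<N}) S x"

definition boltzmann_gibbs :: "('a \<Rightarrow> real) \<Rightarrow> 'a measure \<Rightarrow> 'a measure" where
  "boltzmann_gibbs G \<eta> = density \<eta> (\<lambda>x. ennreal (G x / (\<integral>y. G y \<partial>\<eta>)))"

definition fk_Phi :: "'a fk_model \<Rightarrow> nat \<Rightarrow> 'a measure \<Rightarrow> 'a measure" where
  "fk_Phi F k \<eta> = boltzmann_gibbs (pot F (k - 1)) \<eta> \<bind> mkernel F k"

text \<open>
  \<open>frozen_product N S \<mu> a\<close> is the average over \<open>i\<close> of the product measures with \<open>i\<close>-th factor the
  Dirac mass at \<open>a\<close> and all other factors \<open>\<mu>\<close>.
\<close>

definition frozen_product :: "nat \<Rightarrow> 'a measure \<Rightarrow> 'a measure \<Rightarrow> 'a \<Rightarrow> (nat \<Rightarrow> 'a) measure" where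
  "frozen_product N S \<mu> a =
     uniform_count_measure {..<N} \<bind>
       (\<lambda>i. PiM {..<N} (\<lambda>j. if j = i then return S a else \<mu>))"

text \<open>The joint law of the particle systems at times \<open>0, \<dots>, n\<close>, with frozen states \<open>z\<close>.\<close>

definition dual_law :: "'a fk_model \<Rightarrow> nat \<Rightarrow> (nat \<Rightarrow> 'a) \<Rightarrow> nat \<Rightarrow> (nat \<Rightarrow> nat \<Rightarrow> 'a) measure" where
  "dual_law F N z n =
     chain_law (\<lambda>k. PiM {..<N} (\<lambda>_. state F k))
       (frozen_product N (state F 0) (init F) (z 0))
       (\<lambda>k x. frozen_product N (state F k) (fk_Phi F k (empirical N (state F (k - 1)) x)) (z k))
       n"


section \<open>The backward kernel\<close>

definition backward_density ::
  "'a fk_model \<Rightarrow> (nat \<Rightarrow> 'a \<Rightarrow> 'a \<Rightarrow> real) \<Rightarrow> (nat \<Rightarrow> 'a measure) \<Rightarrow> bool" where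
  "backward_density F H \<nu> \<longleftrightarrow>
     (\<forall>k. sets (\<nu> (Suc k)) = sets (state F (Suc k)) \<and>
        (\<lambda>(x, y). H (Suc k) x y) \<in> borel_measurable (state F k \<Otimes>\<^sub>M state F (Suc k)) \<and>
        (\<forall>x\<in>space (state F k). \<forall>y\<in>space (state F (Suc k)). 0 \<le> H (Suc k) x y) \<and>
        (\<forall>x\<in>space (state F k).
           scale_measure (ennreal (pot F k x)) (mkernel F (Suc k) x) =
           density (\<nu> (Suc k)) (\<lambda>y. ennreal (H (Suc k) x y))))"

text \<open>
  Here \<open>m k\<close> is the empirical measure at time \<open>k\<close>. A factor whose denominator vanishes is \<open>0\<close>.
  For the dual particle model this almost surely happens only at a frozen state \<open>y (Suc k)\<close>, where the
  density may vanish identically because it is only determined up to null sets.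
\<close>

definition backward_kernel ::
  "'a fk_model \<Rightarrow> (nat \<Rightarrow> 'a \<Rightarrow> 'a \<Rightarrow> real) \<Rightarrow> nat \<Rightarrow> (nat \<Rightarrow> 'a measure) \<Rightarrow> 'a \<Rightarrow> (nat \<Rightarrow> 'a) measure" where
  "backward_kernel F H n m u =
     density (PiM {..n} (\<lambda>k. if k < n then m k else return (state F n) u))
       (\<lambda>y. \<Prod>k<n. ennreal (H (Suc k) (y k) (y (Suc k)) / (\<integral>v. H (Suc k) v (y (Suc k)) \<partial>m k)))"


section \<open>Particle Gibbs kernels\<close>

definition gibbs_kernel ::
  "'a fk_model \<Rightarrow> nat \<Rightarrow> nat \<Rightarrow> ((nat \<Rightarrow> 'a) \<Rightarrow> real) \<Rightarrow> (nat \<Rightarrow> 'a) \<Rightarrow> real" where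
  "gibbs_kernel F N n f z =
     (\<integral>x. (\<integral>y. f y \<partial>empirical N (state (path_model F) n) (x n))
        \<partial>dual_law (path_model F) N (\<lambda>k. restrict z {..k}) n)"

definition gibbs_backward_kernel ::
  "'a fk_model \<Rightarrow> (nat \<Rightarrow> 'a \<Rightarrow> 'a \<Rightarrow> real) \<Rightarrow> nat \<Rightarrow> nat \<Rightarrow>
     ((nat \<Rightarrow> 'a) \<Rightarrow> real) \<Rightarrow> (nat \<Rightarrow> 'a) \<Rightarrow> real" where
  "gibbs_backward_kernel F H N n f z =
     (\<integral>x. (\<integral>u. (\<integral>y. f y \<partial>backward_kernel F H n (\<lambda>k. empirical N (state F k) (x k)) u)
            \<partial>empirical N (state F n) (x n))
        \<partial>dual_law F N z n)"


section \<open>The Feynman-Kac model with a frozen path\<close>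

definition frozen_mixture :: "nat \<Rightarrow> 'a measure \<Rightarrow> 'a measure \<Rightarrow> 'a \<Rightarrow> 'a measure" where
  "frozen_mixture N S \<mu> a =
     measure_pmf (bernoulli_pmf (1 / real N)) \<bind> (\<lambda>b. if b then return S a else \<mu>)"

definition frozen_model :: "'a fk_model \<Rightarrow> nat \<Rightarrow> (nat \<Rightarrow> 'a) \<Rightarrow> 'a fk_model" where
  "frozen_model F N z =
     F\<lparr> init := frozen_mixture N (state F 0) (init F) (z 0),
        mkernel := (\<lambda>k x. frozen_mixture N (state F k) (mkernel F k x) (z k)) \<rparr>"

text \<open>The frozen model of the path-space model, along \<open>z\<^sub>k = (z'\<^sub>0, \<dots>, z'\<^sub>k)\<close>.\<close>

definition frozen_path_model :: "'a fk_model \<Rightarrow> nat \<Rightarrow> (nat \<Rightarrow> 'a) \<Rightarrow> (nat \<Rightarrow> 'a) fk_model" where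
  "frozen_path_model F N z = frozen_model (path_model F) N (\<lambda>k. restrict z {..k})"

end

theory Submission
  imports Defs
begin

text \<open>
  Fix the horizon \<open>n\<close> and put \<open>h\<^sub>k = Q\<^sub>k\<^sub>,\<^sub>n(1)\<close>. These functions satisfy \<open>h\<^sub>k = G\<^sub>k M\<^sub>k\<^sub>+\<^sub>1(h\<^sub>k\<^sub>+\<^sub>1)\<close> and
  \<open>h\<^sub>n = 1\<close>, and any two values of \<open>h\<^sub>k\<close> differ by a factor of at most \<open>\<rho>\<close>. Let \<open>m\<^sub>k\<close> be the occupation
  measure of the dual particle system at time \<open>k\<close>. The object to follow through time is the ratio
  \<open>m\<^sub>k(g) / m\<^sub>k(h\<^sub>k)\<close> rather than \<open>m\<^sub>k(g)\<close>.

  Given the particles at time \<open>k\<close>, the ones at time \<open>k + 1\<close> are independent with common law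
  \<open>\<mu> = \<Phi>\<^sub>k\<^sub>+\<^sub>1(m\<^sub>k)\<close>, except for one that sits at \<open>z\<^sub>k\<^sub>+\<^sub>1\<close>. Let \<open>\<mu>\<^sub>z = (1/N) \<delta> + (1 - 1/N) \<mu>\<close> be the law
  of a uniformly chosen particle. An exchangeability argument (\<open>sample_upper\<close>, \<open>sample_lower\<close>,
  combined in \<open>frozen_product_ratio\<close>) shows that the mean of \<open>m\<^sub>k\<^sub>+\<^sub>1(g) / m\<^sub>k\<^sub>+\<^sub>1(h\<^sub>k\<^sub>+\<^sub>1)\<close> equals
  \<open>\<mu>\<^sub>z(g) / \<mu>(h\<^sub>k\<^sub>+\<^sub>1)\<close> up to a factor \<open>1 + O(\<rho>/N)\<close>, for every \<open>g \<ge> 0\<close>. The last quotient is exactly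
  \<open>m\<^sub>k(Q\<^sub>z g) / m\<^sub>k(h\<^sub>k)\<close>, where \<open>Q\<^sub>z g = G\<^sub>k M\<^sub>z\<^sub>,\<^sub>k\<^sub>+\<^sub>1(g)\<close> is the one-step operator of the model with a frozen
  path (\<open>step_ratio_flow\<close>). Hence one step of the particle system is one step of that model up to a
  factor close to \<open>1\<close>, and since \<open>h\<^sub>n = 1\<close> and \<open>\<gamma>\<^sub>n(1) = 1\<close> induction gives
  \<open>K\<^sub>n(f)(z) = (1 + O(\<rho>/N))\<^sup>n\<^sup>+\<^sup>1 \<gamma>\<^sub>z\<^sub>,\<^sub>n(f)\<close> (\<open>mean_ratio_upper\<close>, \<open>mean_ratio_lower\<close>). The same ratio bound
  puts \<open>\<gamma>\<^sub>z\<^sub>,\<^sub>n(1)\<close> between \<open>(1 - 1/N)\<^sup>n\<^sup>+\<^sup>1\<close> and \<open>(1 + \<rho>/N)\<^sup>n\<^sup>+\<^sup>1\<close>, so \<open>\<gamma>\<^sub>z\<^sub>,\<^sub>n(f)\<close> may be replaced by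
  \<open>\<eta>\<^sub>z\<^sub>,\<^sub>n(f)\<close>, and for \<open>N \<ge> c n\<close> all these powers are \<open>1 + O(n/N)\<close>.

  For backward sampling, the role of \<open>g\<close> at time \<open>k\<close> is played by the function that sends a terminal
  particle to the mean of a path functional under the backward kernel. Averaged over the terminal
  particle, this function loses its denominators: the density of \<open>\<Phi>\<^sub>k\<^sub>+\<^sub>1(m\<^sub>k)\<close> is proportional to
  \<open>m\<^sub>k(H(\<cdot>, y))\<close>, which is the normalising constant of the backward transition from \<open>y\<close>. Up to the
  potential, a backward step after a forward step is therefore a plain forward step of the path model
  (\<open>backward_sum_step\<close>), and the induction yields \<open>\<gamma>\<^sub>n(f)\<close>. This computation is valid for the particles
  drawn from \<open>\<Phi>\<^sub>k\<^sub>+\<^sub>1(m\<^sub>k)\<close> but not for the frozen one, whose contribution is discarded; this costs a factor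
  \<open>1 - 1/N\<close> per step and explains why the result is a lower bound in terms of \<open>\<eta>\<^sub>n\<close>.

  Finally, the constant \<open>\<rho>\<close> is finite because \<open>Q\<^sub>p\<^sub>,\<^sub>q(1)(x)\<close> is the product of the means of \<open>G\<^sub>k\<close> under
  \<open>\<eta>\<^sup>x\<^sub>p\<^sub>,\<^sub>k\<close>, and these products are compared for different \<open>x\<close> by the summable bounds in (A2)
  (\<open>ratio_bound_of_A2\<close>). All expectations are handled as integrals of nonnegative extended reals
  and converted to real integrals at the end.
\<close>

section \<open>Resampling one particle of a sample with a frozen particle\<close>

lemma nn_integral_uniform_count_measure:
  assumes "finite A"
  shows "(\<integral>\<^sup>+ i. g i \<partial>uniform_count_measure A) = (\<Sum>i\<in>A. ennreal (1 / real (card A)) * g i)"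
  unfolding uniform_count_measure_def using assms
  by (subst nn_integral_point_measure_finite) (auto simp: mult.commute)

text \<open>
  The coordinate \<open>\<xi> l\<close> and an independent copy \<open>y\<close> of it can trade places. This exchange is the one
  symmetry behind both estimates of this section.
\<close>

lemma nn_integral_PiM_resample:
  fixes D :: "'i \<Rightarrow> 'a measure"
  assumes I: "finite I" and l: "l \<in> I" and D: "\<And>i. prob_space (D i)"
    and F: "(\<lambda>(\<xi>, y). F \<xi> y) \<in> borel_measurable (PiM I D \<Otimes>\<^sub>M D l)"
  shows "(\<integral>\<^sup>+ \<xi>. \<integral>\<^sup>+ y. F \<xi> y \<partial>D l \<partial>PiM I D) = (\<integral>\<^sup>+ \<xi>. \<integral>\<^sup>+ y. F (\<xi>(l := y)) (\<xi> l) \<partial>D l \<partial>PiM I D)"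
proof -
  interpret D: product_prob_space D by (intro product_prob_spaceI D)
  interpret Dl: prob_space "D l" by (rule D)
  interpret P: pair_prob_space "D l" "D l" ..
  define J where "J = I - {l}"
  have J: "finite J" "l \<notin> J" and IJ: "I = insert l J" using I l by (auto simp: J_def)
  have F': "(\<lambda>(\<xi>, y). F \<xi> y) \<in> borel_measurable (PiM (insert l J) D \<Otimes>\<^sub>M D l)"
    using F by (simp add: IJ)
  note [measurable] = F'
  have m1: "(\<lambda>(\<xi>, y). F (\<xi>(l := y)) (\<xi> l)) \<in> borel_measurable (PiM (insert l J) D \<Otimes>\<^sub>M D l)"
  proof -
    have "(\<lambda>(\<xi>, y). (\<xi>(l := y), \<xi> l)) \<in> (PiM (insert l J) D \<Otimes>\<^sub>M D l) \<rightarrow>\<^sub>M (PiM (insert l J) D \<Otimes>\<^sub>M D l)"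
      using measurable_add_dim[of l "insert l J" D] by (simp add: case_prod_beta')
    from measurable_compose[OF this F'] show ?thesis by (simp add: case_prod_beta')
  qed
  note [measurable] = m1
  have "(\<integral>\<^sup>+ \<xi>. \<integral>\<^sup>+ y. F \<xi> y \<partial>D l \<partial>PiM I D)
      = (\<integral>\<^sup>+ w. \<integral>\<^sup>+ x. \<integral>\<^sup>+ y. F (w(l := x)) y \<partial>D l \<partial>D l \<partial>PiM J D)"
    unfolding IJ by (subst D.product_nn_integral_insert[OF J]) simp_all
  also have "\<dots> = (\<integral>\<^sup>+ w. \<integral>\<^sup>+ x. \<integral>\<^sup>+ y. F (w(l := y)) x \<partial>D l \<partial>D l \<partial>PiM J D)"
  proof (rule nn_integral_cong)
    fix w assume [measurable]: "w \<in> space (PiM J D)"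
    have "(\<lambda>(x, y). (w(l := x), y)) \<in> (D l \<Otimes>\<^sub>M D l) \<rightarrow>\<^sub>M (PiM (insert l J) D \<Otimes>\<^sub>M D l)"
      by measurable
    from measurable_compose[OF this F']
    have [measurable]: "(\<lambda>(x, y). F (w(l := x)) y) \<in> borel_measurable (D l \<Otimes>\<^sub>M D l)"
      by (simp add: case_prod_beta')
    show "(\<integral>\<^sup>+ x. \<integral>\<^sup>+ y. F (w(l := x)) y \<partial>D l \<partial>D l) = (\<integral>\<^sup>+ x. \<integral>\<^sup>+ y. F (w(l := y)) x \<partial>D l \<partial>D l)"
      by (rule P.Fubini') simp
  qed
  also have "\<dots> = (\<integral>\<^sup>+ \<xi>. \<integral>\<^sup>+ y. F (\<xi>(l := y)) (\<xi> l) \<partial>D l \<partial>PiM I D)"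
    unfolding IJ by (subst D.product_nn_integral_insert[OF J]) simp_all
  finally show ?thesis .
qed

lemma ennreal_mult_sum_left:
  assumes "\<And>i. i \<in> A \<Longrightarrow> 0 \<le> f i"
  shows "(\<Sum>i\<in>A. c * ennreal (f i)) = c * ennreal (sum f A)"
  using assms by (simp add: sum_distrib_left[symmetric] sum_ennreal)

text \<open>
  A sample of \<open>N\<close> independent particles of law \<open>\<mu>\<close>, except that the law of particle \<open>i\<close> is arbitrary; it
  will be a Dirac mass. The values of \<open>h\<close> are comparable up to the factor \<open>r\<close>.
\<close>

locale frozen_sample =
  fixes N :: nat and S :: "'a measure" and D :: "nat \<Rightarrow> 'a measure" and \<mu> :: "'a measure"
    and i :: nat and h :: "'a \<Rightarrow> real" and r :: real
  assumes N: "N \<ge> 2"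
    and D: "\<And>j. D j \<in> space (prob_algebra S)" and D\<mu>: "\<And>j. j \<noteq> i \<Longrightarrow> D j = \<mu>"
    and h[measurable]: "h \<in> borel_measurable S"
    and h_pos: "\<And>x. x \<in> space S \<Longrightarrow> 0 < h x"
    and h_ratio: "\<And>x y. x \<in> space S \<Longrightarrow> y \<in> space S \<Longrightarrow> h x \<le> r * h y"
    and \<mu>: "\<mu> \<in> space (prob_algebra S)"
begin

abbreviation "P \<equiv> PiM {..<N} D"
abbreviation "T \<xi> \<equiv> (\<Sum>k<N. h (\<xi> k))"

lemma sets_D[measurable_cong]: "sets (D j) = sets S" using D by (auto simp: space_prob_algebra)
lemma sets_\<mu>[measurable_cong]: "sets \<mu> = sets S" using \<mu> by (auto simp: space_prob_algebra)
lemma prob_D: "prob_space (D j)" using D by (auto simp: space_prob_algebra)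
lemma space_D: "space (D j) = space S" by (rule sets_eq_imp_space_eq) (rule sets_D)
lemma space_\<mu>: "space \<mu> = space S" by (rule sets_eq_imp_space_eq) (rule sets_\<mu>)

lemma sample_in: "\<xi> \<in> space P \<Longrightarrow> k < N \<Longrightarrow> \<xi> k \<in> space S"
  by (auto simp: space_PiM space_D PiE_iff)

lemma T_pos: "\<xi> \<in> space P \<Longrightarrow> 0 < T \<xi>"
  using N by (intro sum_pos h_pos sample_in) (auto simp: lessThan_empty_iff)

lemma h_le_T:
  assumes "\<xi> \<in> space P" "y \<in> space S" shows "real N * h y \<le> r * T \<xi>"
proof -
  have "real N * h y = (\<Sum>k<N. h y)" by simp
  also have "\<dots> \<le> (\<Sum>k<N. r * h (\<xi> k))" using assms by (intro sum_mono h_ratio sample_in[of \<xi>]) auto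
  finally show ?thesis by (simp add: sum_distrib_left)
qed

lemma r_nonneg: "0 \<le> r"
proof -
  obtain x where "x \<in> space S"
    using prob_space.not_empty[OF prob_D] space_D by blast
  then have "0 < h x" "1 * h x \<le> r * h x" using h_ratio[of x x] h_pos[of x] by auto
  then show ?thesis by (simp only: mult_le_cancel_right) auto
qed

abbreviation "u \<equiv> (\<integral>y. h y \<partial>\<mu>)"

lemma prob_\<mu>: "prob_space \<mu>" using \<mu> by (auto simp: space_prob_algebra)

lemma integrable_h: "integrable \<mu> h"
proof -
  interpret prob_space \<mu> by (rule prob_\<mu>)
  obtain x where x: "x \<in> space S" using not_empty space_\<mu> by blast
  show ?thesis
    using h_ratio[OF _ x] h_pos by (intro integrable_const_bound[where B="r * h x"])
      (auto intro!: AE_I2 simp: space_\<mu> less_imp_le measurable_cong_sets[OF sets_\<mu> refl])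
qed

lemma ennreal_u: "(\<integral>\<^sup>+ y. h y \<partial>\<mu>) = ennreal u"
  by (rule nn_integral_eq_integral[OF integrable_h]) (auto intro!: AE_I2 simp: space_\<mu> less_imp_le h_pos)

lemma h_le_u: assumes x: "x \<in> space S" shows "h x \<le> r * u"
proof -
  interpret prob_space \<mu> by (rule prob_\<mu>)
  have "h x = (\<integral>y. h x \<partial>\<mu>)" by (simp add: prob_space)
  also have "\<dots> \<le> (\<integral>y. r * h y \<partial>\<mu>)"
    using integrable_h h_ratio[OF x] by (intro integral_mono) (auto simp: space_\<mu>)
  finally show ?thesis by simp
qed

lemma u_pos: "0 < u"
proof -
  interpret prob_space \<mu> by (rule prob_\<mu>)
  obtain x where x: "x \<in> space S" using not_empty space_\<mu> by blast
  have "0 < r * u" using h_pos[OF x] h_le_u[OF x] by simp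
  with r_nonneg show ?thesis by (simp add: zero_less_mult_iff)
qed

text \<open>
  By the ratio bound one more particle changes the total by a relative amount of at most \<open>r / N\<close>.
\<close>

lemma T_add_le: "\<xi> \<in> space P \<Longrightarrow> y \<in> space S \<Longrightarrow> T \<xi> + h y \<le> (1 + r / real N) * T \<xi>"
  using h_le_T[of \<xi> y] N by (simp add: field_simps)

lemma T_update: "l < N \<Longrightarrow> T (\<xi>(l := y)) + h (\<xi> l) = T \<xi> + h y"
  by (simp add: sum.remove[of "{..<N}" l] cong: sum.cong_simp)

lemma T_update_le:
  assumes "\<xi> \<in> space P" "y \<in> space S" "l < N"
  shows "T (\<xi>(l := y)) \<le> (1 + r / real N) * T \<xi>"
  using T_update[OF assms(3), of \<xi> y] T_add_le[OF assms(1,2)] h_pos[OF sample_in[OF assms(1,3)]] by simp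

context
  fixes g :: "'a \<Rightarrow> ennreal" and j :: nat
  assumes g[measurable]: "g \<in> borel_measurable S" and j: "j < N"
begin

text \<open>
  Add an independent particle \<open>y\<close> of law \<open>\<mu>\<close> and look at its share \<open>h(y) / (T + h(y))\<close> of the enlarged
  total. By exchangeability it has, jointly with \<open>g(\<xi>\<^sub>j)\<close>, the same mean as the share of any particle
  other than \<open>i\<close> and \<open>j\<close>. These are at least \<open>N - 1\<close> shares with sum at most \<open>1\<close>, so each one has weighted
  mean at most \<open>E g(\<xi>\<^sub>j) / (N - 1)\<close>. Since \<open>T + h(y) \<le> (1 + r/N) T\<close>, replacing \<open>T + h(y)\<close> by \<open>T\<close> in the
  share of \<open>y\<close> makes the independent factor \<open>h(y)\<close>, of mean \<open>u\<close>, split off.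
\<close>

lemma sample_upper:
  "ennreal ((real N - 1) * u / (1 + r / real N)) * (\<integral>\<^sup>+ \<xi>. g (\<xi> j) * ennreal (1 / T \<xi>) \<partial>P)
    \<le> (\<integral>\<^sup>+ \<xi>. g (\<xi> j) \<partial>P)"
proof -
  let ?a = "\<lambda>\<xi> v y. g (\<xi> j) * ennreal (h v / (T \<xi> + h y))"
  define A where "A = (\<integral>\<^sup>+ \<xi>. \<integral>\<^sup>+ y. ?a \<xi> y y \<partial>\<mu> \<partial>P)"
  define L where "L = {..<N} - {i, j}"
  have L: "finite L" "\<And>l. l \<in> L \<Longrightarrow> l < N \<and> l \<noteq> i \<and> l \<noteq> j" "L \<subseteq> {..<N}" by (auto simp: L_def)
  interpret \<mu>: prob_space \<mu> by (rule prob_\<mu>)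
  have [measurable, simp]: "j \<in> {..<N}" using j by simp
  have A_swap: "A = (\<integral>\<^sup>+ \<xi>. \<integral>\<^sup>+ y. ?a \<xi> (\<xi> l) y \<partial>\<mu> \<partial>P)" if "l \<in> L" for l
  proof -
    have [measurable]: "l \<in> {..<N}" and *: "l \<in> {..<N}" "l \<noteq> i" "l \<noteq> j" using L(2)[OF that] by auto
    have "(\<integral>\<^sup>+ \<xi>. \<integral>\<^sup>+ y. ?a \<xi> y y \<partial>D l \<partial>P)
      = (\<integral>\<^sup>+ \<xi>. \<integral>\<^sup>+ y. g ((\<xi>(l:=y)) j) * ennreal (h (\<xi> l) / (T (\<xi>(l:=y)) + h (\<xi> l))) \<partial>D l \<partial>P)"
      by (rule nn_integral_PiM_resample) (use * prob_D in \<open>auto simp del: sum_mult_indicator\<close>)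
    then show ?thesis using * L(2)[OF that] unfolding A_def
      by (simp add: D\<mu> T_update fun_upd_other del: fun_upd_apply)
  qed
  have "ennreal (real N - 1) * A \<le> ennreal (real (card L) + 1) * A"
  proof (intro mult_right_mono ennreal_leI)
    have "card {i, j} \<le> 2" by (simp add: card_insert_if)
    then show "real N - 1 \<le> real (card L) + 1"
      using diff_card_le_card_Diff[of "{i, j}" "{..<N}"] unfolding L_def by simp
  qed simp
  also have "\<dots> = A + (\<Sum>l\<in>L. A)"
    by (simp add: ennreal_of_nat_eq_real_of_nat distrib_right ennreal_plus[symmetric] del: ennreal_plus)
      (simp add: distrib_right ennreal_of_nat_eq_real_of_nat add.commute)
  also have "(\<Sum>l\<in>L. A) = (\<Sum>l\<in>L. \<integral>\<^sup>+ \<xi>. \<integral>\<^sup>+ y. ?a \<xi> (\<xi> l) y \<partial>\<mu> \<partial>P)"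
    by (intro sum.cong refl A_swap)
  also have "A + \<dots> = (\<integral>\<^sup>+ \<xi>. \<integral>\<^sup>+ y. ?a \<xi> y y +
      (\<Sum>l\<in>L. ?a \<xi> (\<xi> l) y) \<partial>\<mu> \<partial>P)" (is "_ = ?R")
  proof -
    have "?R = (\<integral>\<^sup>+ \<xi>. (\<integral>\<^sup>+ y. ?a \<xi> y y \<partial>\<mu>) +
      (\<Sum>l\<in>L. \<integral>\<^sup>+ y. ?a \<xi> (\<xi> l) y \<partial>\<mu>) \<partial>P)"
      by (rule nn_integral_cong) (simp add: nn_integral_add nn_integral_sum)
    also have "\<dots> = A + (\<Sum>l\<in>L. \<integral>\<^sup>+ \<xi>. \<integral>\<^sup>+ y. ?a \<xi> (\<xi> l) y \<partial>\<mu> \<partial>P)"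
      unfolding A_def using L(3) by (subst nn_integral_add) (auto simp: nn_integral_sum subset_iff)
    finally show ?thesis by simp
  qed
  also have "\<dots> \<le> (\<integral>\<^sup>+ \<xi>. \<integral>\<^sup>+ y. g (\<xi> j) \<partial>\<mu> \<partial>P)"
  proof (intro nn_integral_mono)
    fix \<xi> y assume \<xi>: "\<xi> \<in> space P" and "y \<in> space \<mu>"
    then have y: "y \<in> space S" by (simp add: space_\<mu>)
    have pos: "0 < T \<xi> + h y" using T_pos[OF \<xi>] h_pos[OF y] by simp
    have nn: "0 \<le> h (\<xi> l) / (T \<xi> + h y)" if "l \<in> {..<N}" for l
      using pos h_pos[OF sample_in[OF \<xi>, of l]] that by simp
    have "?a \<xi> y y + (\<Sum>l\<in>L. ?a \<xi> (\<xi> l) y)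
       = g (\<xi> j) * ennreal (h y / (T \<xi> + h y) + (\<Sum>l\<in>L. h (\<xi> l) / (T \<xi> + h y)))"
    proof -
      have "(\<Sum>l\<in>L. ?a \<xi> (\<xi> l) y) = g (\<xi> j) * ennreal (\<Sum>l\<in>L. h (\<xi> l) / (T \<xi> + h y))"
        using nn L(3) by (intro ennreal_mult_sum_left) auto
      moreover have "0 \<le> (\<Sum>l\<in>L. h (\<xi> l) / (T \<xi> + h y))" using nn L(3) by (intro sum_nonneg) auto
      ultimately show ?thesis using pos h_pos[OF y] by (simp add: ennreal_plus distrib_left)
    qed
    also have "\<dots> \<le> g (\<xi> j) * ennreal 1"
    proof (intro mult_left_mono ennreal_leI)
      have "h y / (T \<xi> + h y) + (\<Sum>l\<in>L. h (\<xi> l) / (T \<xi> + h y))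
          \<le> h y / (T \<xi> + h y) + (\<Sum>l<N. h (\<xi> l) / (T \<xi> + h y))"
        using nn L(3) by (intro add_left_mono sum_mono2) auto
      also have "\<dots> = 1" using pos by (simp add: sum_divide_distrib[symmetric] add_divide_distrib[symmetric] add.commute)
      finally show "h y / (T \<xi> + h y) + (\<Sum>l\<in>L. h (\<xi> l) / (T \<xi> + h y)) \<le> 1" .
    qed simp
    finally show "?a \<xi> y y + (\<Sum>l\<in>L. ?a \<xi> (\<xi> l) y) \<le> g (\<xi> j)"
      by simp
  qed
  also have "\<dots> = (\<integral>\<^sup>+ \<xi>. g (\<xi> j) \<partial>P)"
    using prob_space.emeasure_space_1[OF prob_\<mu>] by simp
  finally have upper: "ennreal (real N - 1) * A \<le> (\<integral>\<^sup>+ \<xi>. g (\<xi> j) \<partial>P)" .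
  have "ennreal (u / (1 + r / real N)) * (\<integral>\<^sup>+ \<xi>. g (\<xi> j) * ennreal (1 / T \<xi>) \<partial>P)
     = (\<integral>\<^sup>+ \<xi>. \<integral>\<^sup>+ y. g (\<xi> j) * ennreal (1 / T \<xi>) * ennreal (1 / (1 + r / real N)) * ennreal (h y) \<partial>\<mu> \<partial>P)"
  proof -
    have "(\<integral>\<^sup>+ \<xi>. \<integral>\<^sup>+ y. g (\<xi> j) * ennreal (1 / T \<xi>) * ennreal (1 / (1 + r / real N)) * ennreal (h y) \<partial>\<mu> \<partial>P)
      = (\<integral>\<^sup>+ \<xi>. g (\<xi> j) * ennreal (1 / T \<xi>) * (ennreal (1 / (1 + r / real N)) * ennreal u) \<partial>P)"
      by (rule nn_integral_cong) (simp add: nn_integral_cmult ennreal_u mult.assoc)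
    also have "\<dots> = (\<integral>\<^sup>+ \<xi>. g (\<xi> j) * ennreal (1 / T \<xi>) \<partial>P) * (ennreal (1 / (1 + r / real N)) * ennreal u)"
      by (rule nn_integral_multc) measurable
    finally show ?thesis
      using u_pos r_nonneg by (simp add: ennreal_mult[symmetric] mult.commute)
  qed
  also have "\<dots> \<le> A" unfolding A_def
  proof (intro nn_integral_mono)
    fix \<xi> y assume \<xi>: "\<xi> \<in> space P" and "y \<in> space \<mu>"
    then have y: "y \<in> space S" by (simp add: space_\<mu>)
    have pos: "0 < T \<xi> + h y" "0 < T \<xi>" "0 < h y" using T_pos[OF \<xi>] h_pos[OF y] by simp_all
    have "g (\<xi> j) * ennreal (1 / T \<xi>) * ennreal (1 / (1 + r / real N)) * ennreal (h y)
      = g (\<xi> j) * ennreal (h y / ((1 + r / real N) * T \<xi>))"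
    proof -
      have "ennreal (1 / T \<xi>) * ennreal (1 / (1 + r / real N)) * ennreal (h y) = ennreal (h y / ((1 + r / real N) * T \<xi>))"
        using pos r_nonneg by (simp add: ennreal_mult[symmetric] mult.commute)
      then show ?thesis by (simp add: mult.assoc)
    qed
    also have "\<dots> \<le> ?a \<xi> y y"
      using pos T_add_le[OF \<xi> y] by (intro mult_left_mono ennreal_leI divide_left_mono) auto
    finally show "g (\<xi> j) * ennreal (1 / T \<xi>) * ennreal (1 / (1 + r / real N)) * ennreal (h y)
      \<le> ?a \<xi> y y" .
  qed
  finally have "ennreal (u / (1 + r / real N)) * (\<integral>\<^sup>+ \<xi>. g (\<xi> j) * ennreal (1 / T \<xi>) \<partial>P) \<le> A" .
  then have "ennreal (real N - 1) * (ennreal (u / (1 + r / real N)) * (\<integral>\<^sup>+ \<xi>. g (\<xi> j) * ennreal (1 / T \<xi>) \<partial>P))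
    \<le> ennreal (real N - 1) * A" by (rule mult_left_mono) simp
  also note upper
  finally show ?thesis
    using N u_pos r_nonneg by (simp add: mult.assoc[symmetric] ennreal_mult[symmetric])
qed

text \<open>
  Write \<open>1\<close> as the sum of the shares \<open>h(\<xi>\<^sub>l) / T\<close>. In the term for \<open>l\<close> the total may be replaced, at the cost
  of \<open>1 + r/N\<close>, by the total in which \<open>\<xi>\<^sub>l\<close> is redrawn; then \<open>\<xi>\<^sub>l\<close> is independent of the rest and
  \<open>h(\<xi>\<^sub>l)\<close> can be replaced by its mean \<open>u\<close>. For the two exceptional indices \<open>i\<close> and \<open>j\<close> the crude
  bound \<open>h \<le> r u\<close> is good enough, because there are at most two of them among \<open>N\<close>.
\<close>

lemma sample_lower:
  "(\<integral>\<^sup>+ \<xi>. g (\<xi> j) \<partial>P)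
    \<le> ennreal ((real N + 3 * r) * u) * (\<integral>\<^sup>+ \<xi>. g (\<xi> j) * ennreal (1 / T \<xi>) \<partial>P)"
proof -
  define B where "B = (\<integral>\<^sup>+ \<xi>. g (\<xi> j) * ennreal (1 / T \<xi>) \<partial>P)"
  define c where "c l = (if l = i \<or> l = j then r else 1 + r / real N)" for l
  interpret \<mu>: prob_space \<mu> by (rule prob_\<mu>)
  have [measurable, simp]: "j \<in> {..<N}" using j by simp
  have c_nn: "0 \<le> c l" for l using r_nonneg by (simp add: c_def)
  have term_le: "(\<integral>\<^sup>+ \<xi>. g (\<xi> j) * ennreal (h (\<xi> l) / T \<xi>) \<partial>P) \<le> ennreal (c l * u) * B" if l: "l < N" for l
  proof (cases "l = i \<or> l = j")
    case True
    have "(\<integral>\<^sup>+ \<xi>. g (\<xi> j) * ennreal (h (\<xi> l) / T \<xi>) \<partial>P)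
      \<le> (\<integral>\<^sup>+ \<xi>. ennreal (c l * u) * (g (\<xi> j) * ennreal (1 / T \<xi>)) \<partial>P)"
    proof (intro nn_integral_mono)
      fix \<xi> assume \<xi>: "\<xi> \<in> space P"
      have "g (\<xi> j) * ennreal (h (\<xi> l) / T \<xi>) \<le> g (\<xi> j) * ennreal (r * u / T \<xi>)"
        using h_le_u[OF sample_in[OF \<xi> l]] T_pos[OF \<xi>]
        by (intro mult_left_mono ennreal_leI divide_right_mono) auto
      also have "\<dots> = ennreal (c l * u) * (g (\<xi> j) * ennreal (1 / T \<xi>))"
      proof -
        have "ennreal (r * u / T \<xi>) = ennreal (r * u) * ennreal (1 / T \<xi>)"
          using T_pos[OF \<xi>] r_nonneg u_pos by (simp add: ennreal_mult[symmetric])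
        then show ?thesis using True by (auto simp: c_def mult_ac)
      qed
      finally show "g (\<xi> j) * ennreal (h (\<xi> l) / T \<xi>) \<le> ennreal (c l * u) * (g (\<xi> j) * ennreal (1 / T \<xi>))" .
    qed
    also have "\<dots> = ennreal (c l * u) * B" unfolding B_def by (rule nn_integral_cmult) measurable
    finally show ?thesis .
  next
    case False
    have [measurable, simp]: "l \<in> {..<N}" using l by simp
    have "(\<integral>\<^sup>+ \<xi>. g (\<xi> j) * ennreal (h (\<xi> l) / T \<xi>) \<partial>P)
      = (\<integral>\<^sup>+ \<xi>. \<integral>\<^sup>+ y. g (\<xi> j) * ennreal (h (\<xi> l) / T \<xi>) \<partial>\<mu> \<partial>P)"
      using prob_space.emeasure_space_1[OF prob_\<mu>] by simp
    also have "\<dots> \<le> (\<integral>\<^sup>+ \<xi>. \<integral>\<^sup>+ y. ennreal (c l) * (g (\<xi> j) * ennreal (h (\<xi> l) / T (\<xi>(l := y)))) \<partial>\<mu> \<partial>P)"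
    proof (intro nn_integral_mono)
      fix \<xi> y assume \<xi>: "\<xi> \<in> space P" and "y \<in> space \<mu>"
      then have y: "y \<in> space S" by (simp add: space_\<mu>)
      have \<xi>': "\<xi>(l := y) \<in> space P" using \<xi> y l by (auto simp: space_PiM space_D PiE_iff extensional_def)
      note p = T_pos[OF \<xi>] T_pos[OF \<xi>'] h_pos[OF sample_in[OF \<xi> l]]
      have "0 < c l" using False r_nonneg N by (simp add: c_def add_pos_nonneg)
      then have "h (\<xi> l) / T \<xi> = c l * (h (\<xi> l) / (c l * T \<xi>))" by simp
      also have "\<dots> \<le> c l * (h (\<xi> l) / T (\<xi>(l := y)))"
        using T_update_le[OF \<xi> y l] p c_nn[of l] False
        by (intro mult_left_mono divide_left_mono) (auto simp: c_def intro!: mult_pos_pos add_pos_nonneg r_nonneg)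
      finally have "g (\<xi> j) * ennreal (h (\<xi> l) / T \<xi>) \<le> g (\<xi> j) * ennreal (c l * (h (\<xi> l) / T (\<xi>(l := y))))"
        by (intro mult_left_mono ennreal_leI) auto
      also have "\<dots> = ennreal (c l) * (g (\<xi> j) * ennreal (h (\<xi> l) / T (\<xi>(l := y))))"
        using p c_nn by (subst ennreal_mult) (auto simp: mult_ac)
      finally show "g (\<xi> j) * ennreal (h (\<xi> l) / T \<xi>) \<le> ennreal (c l) * (g (\<xi> j) * ennreal (h (\<xi> l) / T (\<xi>(l := y))))" .
    qed
    also have "\<dots> = (\<integral>\<^sup>+ \<xi>. \<integral>\<^sup>+ y. ennreal (c l) * (g (\<xi> j) * ennreal (h y / T \<xi>)) \<partial>\<mu> \<partial>P)"
    proof -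
      have "(\<integral>\<^sup>+ \<xi>. \<integral>\<^sup>+ y. ennreal (c l) * (g (\<xi> j) * ennreal (h y / T \<xi>)) \<partial>D l \<partial>P)
       = (\<integral>\<^sup>+ \<xi>. \<integral>\<^sup>+ y. ennreal (c l) * (g ((\<xi>(l := y)) j) * ennreal (h (\<xi> l) / T (\<xi>(l := y)))) \<partial>D l \<partial>P)"
        by (rule nn_integral_PiM_resample) (use l prob_D in auto)
      then show ?thesis using False by (simp add: D\<mu>)
    qed
    also have "\<dots> = ennreal (c l * u) * B"
    proof -
      have "(\<integral>\<^sup>+ \<xi>. \<integral>\<^sup>+ y. ennreal (c l) * (g (\<xi> j) * ennreal (h y / T \<xi>)) \<partial>\<mu> \<partial>P)
        = (\<integral>\<^sup>+ \<xi>. ennreal (c l * u) * (g (\<xi> j) * ennreal (1 / T \<xi>)) \<partial>P)"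
      proof (rule nn_integral_cong)
        fix \<xi> assume \<xi>: "\<xi> \<in> space P"
        have "(\<integral>\<^sup>+ y. ennreal (c l) * (g (\<xi> j) * ennreal (h y / T \<xi>)) \<partial>\<mu>)
            = (\<integral>\<^sup>+ y. ennreal (c l) * (g (\<xi> j) * ennreal (1 / T \<xi>)) * ennreal (h y) \<partial>\<mu>)"
          using T_pos[OF \<xi>] h_pos
          by (intro nn_integral_cong) (simp add: space_\<mu> mult.assoc ennreal_mult[symmetric] less_imp_le)
        also have "\<dots> = ennreal (c l) * (g (\<xi> j) * ennreal (1 / T \<xi>)) * ennreal u"
          by (simp add: nn_integral_cmult ennreal_u)
        finally show "(\<integral>\<^sup>+ y. ennreal (c l) * (g (\<xi> j) * ennreal (h y / T \<xi>)) \<partial>\<mu>)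
          = ennreal (c l * u) * (g (\<xi> j) * ennreal (1 / T \<xi>))"
          using c_nn u_pos by (simp add: ennreal_mult mult_ac)
      qed
      also have "\<dots> = ennreal (c l * u) * B" unfolding B_def by (rule nn_integral_cmult) measurable
      finally show ?thesis .
    qed
    finally show ?thesis .
  qed
  have "(\<integral>\<^sup>+ \<xi>. g (\<xi> j) \<partial>P) = (\<integral>\<^sup>+ \<xi>. (\<Sum>l<N. g (\<xi> j) * ennreal (h (\<xi> l) / T \<xi>)) \<partial>P)"
  proof (intro nn_integral_cong)
    fix \<xi> assume \<xi>: "\<xi> \<in> space P"
    have "(\<Sum>l<N. g (\<xi> j) * ennreal (h (\<xi> l) / T \<xi>)) = g (\<xi> j) * ennreal (\<Sum>l<N. h (\<xi> l) / T \<xi>)"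
      using T_pos[OF \<xi>] h_pos[OF sample_in[OF \<xi>]] by (intro ennreal_mult_sum_left) (auto simp: less_imp_le)
    also have "(\<Sum>l<N. h (\<xi> l) / T \<xi>) = 1" using T_pos[OF \<xi>] by (simp add: sum_divide_distrib[symmetric])
    finally show "g (\<xi> j) = (\<Sum>l<N. g (\<xi> j) * ennreal (h (\<xi> l) / T \<xi>))" by simp
  qed
  also have "\<dots> = (\<Sum>l<N. \<integral>\<^sup>+ \<xi>. g (\<xi> j) * ennreal (h (\<xi> l) / T \<xi>) \<partial>P)"
    by (rule nn_integral_sum) measurable
  also have "\<dots> \<le> (\<Sum>l<N. ennreal (c l * u) * B)"
    by (intro sum_mono term_le) auto
  also have "\<dots> = ennreal (sum c {..<N} * u) * B"
    using c_nn u_pos by (simp add: sum_distrib_right[symmetric] sum_ennreal)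
  also have "\<dots> \<le> ennreal ((real N + 3 * r) * u) * B"
  proof (intro mult_right_mono ennreal_leI)
    have "sum c {..<N} \<le> (\<Sum>l<N. (1 + r / real N) + (if l \<in> {i, j} then r else 0))"
      using r_nonneg by (intro sum_mono) (auto simp: c_def)
    also have "\<dots> = real N + r + r * real (card ({..<N} \<inter> {i, j}))"
    proof -
      have "{l. l = i \<or> l = j} = {i, j}" by auto
      then show ?thesis using N by (simp add: sum.distrib sum.If_cases distrib_left)
    qed
    also have "\<dots> \<le> real N + r + r * 2"
    proof (intro add_left_mono mult_left_mono r_nonneg)
      have "card ({..<N} \<inter> {i, j}) \<le> card {i, j}" by (intro card_mono) auto
      also have "\<dots> \<le> 2" by (simp add: card_insert_if)
      finally show "real (card ({..<N} \<inter> {i, j})) \<le> 2" by simp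
    qed
    finally show "sum c {..<N} \<le> real N + 3 * r" by simp
  qed (use u_pos in auto)
  finally show ?thesis by (simp add: B_def)
qed

end
end

section \<open>Frozen products and their mixtures\<close>

lemma measurable_pair_count_space:
  assumes "countable A" and f: "\<And>i. i \<in> A \<Longrightarrow> (\<lambda>x. f x i) \<in> M \<rightarrow>\<^sub>M K"
  shows "(\<lambda>(x, i). f x i) \<in> M \<Otimes>\<^sub>M count_space A \<rightarrow>\<^sub>M K"
  unfolding case_prod_beta'
  by (rule measurable_compose_countable'[where g=snd and I=A])
     (auto intro: measurable_compose[OF measurable_fst f] assms)

lemma PiM_in_prob_algebra:
  assumes "\<And>i. i \<in> I \<Longrightarrow> D i \<in> space (prob_algebra (S i))"
  shows "PiM I D \<in> space (prob_algebra (PiM I S))"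
  using assms by (auto simp: space_prob_algebra intro!: prob_space_PiM sets_PiM_cong)

text \<open>
  Boxes generate the product \<open>\<sigma>\<close>-algebra and are stable under intersection, and on boxes the product
  measure is a finite product of kernels.
\<close>

lemma measurable_PiM_kernel:
  assumes I: "finite I" and K: "\<And>i. K i \<in> M \<rightarrow>\<^sub>M prob_algebra (S i)"
  shows "(\<lambda>x. PiM I (\<lambda>i. K i x)) \<in> M \<rightarrow>\<^sub>M prob_algebra (PiM I S)"
proof (rule measurable_prob_algebra_generated[OF sets_PiM Int_stable_prod_algebra prod_algebra_sets_into_space])
  have Kx: "K i x \<in> space (prob_algebra (S i))" if "x \<in> space M" for x i
    using measurable_space[OF K that] .
  fix x assume x: "x \<in> space M"
  show "prob_space (PiM I (\<lambda>i. K i x))" "sets (PiM I (\<lambda>i. K i x)) = sets (PiM I S)"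
    using PiM_in_prob_algebra[of I "\<lambda>i. K i x" S] Kx[OF x] by (auto simp: space_prob_algebra)
next
  fix A assume "A \<in> prod_algebra I S"
  then obtain X where A: "A = (\<Pi>\<^sub>E i\<in>I. X i)" and X: "\<And>i. i \<in> I \<Longrightarrow> X i \<in> sets (S i)"
    unfolding prod_algebra_eq_finite[OF I] by blast
  have "(\<lambda>x. \<Prod>i\<in>I. emeasure (K i x) (X i)) \<in> borel_measurable M"
    using X by (intro borel_measurable_prod_ennreal emeasure_measurable_subprob_algebra2[OF _ measurable_prob_algebraD[OF K]]) auto
  also have "?this \<longleftrightarrow> (\<lambda>x. emeasure (PiM I (\<lambda>i. K i x)) A) \<in> borel_measurable M"
  proof (rule measurable_cong)
    fix x assume x: "x \<in> space M"
    have *: "K i x \<in> space (prob_algebra (S i))" for i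
      using measurable_space[OF K x] .
    interpret D: product_prob_space "\<lambda>i. K i x"
      by (rule product_prob_spaceI) (use * in \<open>auto simp: space_prob_algebra\<close>)
    show "(\<Prod>i\<in>I. emeasure (K i x) (X i)) = emeasure (PiM I (\<lambda>i. K i x)) A"
      unfolding A using * X by (subst D.emeasure_PiM[OF I]) (auto simp: space_prob_algebra)
  qed
  finally show "(\<lambda>x. emeasure (PiM I (\<lambda>i. K i x)) A) \<in> borel_measurable M" .
qed

lemma uniform_count_in_prob_algebra:
  "N \<ge> 1 \<Longrightarrow> uniform_count_measure {..<N::nat} \<in> space (prob_algebra (count_space {..<N}))"
  by (auto simp: space_prob_algebra sets_uniform_count_measure lessThan_empty_iff intro!: prob_space_uniform_count_measure)

lemma return_in_prob_algebra: "a \<in> space S \<Longrightarrow> return S a \<in> space (prob_algebra S)"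
  by (auto simp: space_prob_algebra prob_space_return)

lemma measurable_frozen_product:
  assumes N: "N \<ge> 1" and a: "a \<in> space S" and \<kappa>: "\<kappa> \<in> M \<rightarrow>\<^sub>M prob_algebra S"
  shows "(\<lambda>x. frozen_product N S (\<kappa> x) a) \<in> M \<rightarrow>\<^sub>M prob_algebra (PiM {..<N} (\<lambda>_. S))"
  unfolding frozen_product_def
proof (rule measurable_bind_prob_space2)
  show "(\<lambda>x. uniform_count_measure {..<N}) \<in> M \<rightarrow>\<^sub>M prob_algebra (count_space {..<N})"
    using uniform_count_in_prob_algebra[OF N] by simp
  show "(\<lambda>(x, i). PiM {..<N} (\<lambda>j. if j = i then return S a else \<kappa> x))
      \<in> M \<Otimes>\<^sub>M count_space {..<N} \<rightarrow>\<^sub>M prob_algebra (PiM {..<N} (\<lambda>_. S))"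
  proof (rule measurable_pair_count_space)
    fix i :: nat
    have "(\<lambda>x. if j = i then return S a else \<kappa> x) \<in> M \<rightarrow>\<^sub>M prob_algebra S" for j
      using \<kappa> return_in_prob_algebra[OF a] by (cases "j = i") simp_all
    then show "(\<lambda>x. PiM {..<N} (\<lambda>j. if j = i then return S a else \<kappa> x))
      \<in> M \<rightarrow>\<^sub>M prob_algebra (PiM {..<N} (\<lambda>_. S))"
      by (intro measurable_PiM_kernel) auto
  qed auto
qed

lemma frozen_product_in_prob_algebra:
  assumes N: "N \<ge> 1" and a: "a \<in> space S" and \<mu>: "\<mu> \<in> space (prob_algebra S)"
  shows "frozen_product N S \<mu> a \<in> space (prob_algebra (PiM {..<N} (\<lambda>_. S)))"
  using measurable_space[OF measurable_frozen_product[OF N a, of "\<lambda>_. \<mu>" "count_space UNIV"]] \<mu> by simp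

lemma nn_integral_frozen_product:
  assumes N: "N \<ge> 1" and a: "a \<in> space S" and \<mu>: "\<mu> \<in> space (prob_algebra S)"
    and \<phi>: "\<phi> \<in> borel_measurable (PiM {..<N} (\<lambda>_. S))"
  shows "(\<integral>\<^sup>+ \<xi>. \<phi> \<xi> \<partial>frozen_product N S \<mu> a)
    = (\<Sum>i<N. ennreal (1 / N) * (\<integral>\<^sup>+ \<xi>. \<phi> \<xi> \<partial>PiM {..<N} (\<lambda>j. if j = i then return S a else \<mu>)))"
proof -
  have "(\<lambda>i. PiM {..<N} (\<lambda>j. if j = i then return S a else \<mu>))
      \<in> uniform_count_measure {..<N} \<rightarrow>\<^sub>M subprob_algebra (PiM {..<N} (\<lambda>_. S))"
    using PiM_in_prob_algebra[of "{..<N}" "\<lambda>j. if j = i then return S a else \<mu>" "\<lambda>_. S" for i]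
      return_in_prob_algebra[OF a] \<mu>
    by (simp add: measurable_cong_sets[OF sets_uniform_count_measure_count_space refl] space_prob_algebra
       space_subprob_algebra prob_space_imp_subprob_space Pi_def)
  from nn_integral_bind[OF \<phi> this] show ?thesis
    by (simp add: frozen_product_def nn_integral_uniform_count_measure)
qed

lemma nn_integral_frozen_mixture:
  assumes N: "N \<ge> 1" and a: "a \<in> space S" and \<mu>: "\<mu> \<in> space (prob_algebra S)"
    and g: "g \<in> borel_measurable S"
  shows "(\<integral>\<^sup>+ y. g y \<partial>frozen_mixture N S \<mu> a)
    = ennreal (1 / N) * g a + ennreal (1 - 1 / N) * (\<integral>\<^sup>+ y. g y \<partial>\<mu>)"
proof -
  have "(\<lambda>b. if b then return S a else \<mu>) \<in> measure_pmf (bernoulli_pmf (1 / N)) \<rightarrow>\<^sub>M subprob_algebra S"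
    using return_in_prob_algebra[OF a] \<mu>
    by (auto simp: space_prob_algebra space_subprob_algebra prob_space_imp_subprob_space)
  from nn_integral_bind[OF g this] show ?thesis
    using N a g by (simp add: frozen_mixture_def nn_integral_return mult.commute)
qed

lemma measurable_frozen_mixture:
  assumes a: "a \<in> space S" and \<kappa>: "\<kappa> \<in> M \<rightarrow>\<^sub>M prob_algebra S"
  shows "(\<lambda>x. frozen_mixture N S (\<kappa> x) a) \<in> M \<rightarrow>\<^sub>M prob_algebra S"
  unfolding frozen_mixture_def
proof (rule measurable_bind_prob_space2)
  show "(\<lambda>x. measure_pmf (bernoulli_pmf (1 / N))) \<in> M \<rightarrow>\<^sub>M prob_algebra (count_space UNIV)"
    by (simp add: space_prob_algebra measure_pmf.prob_space_axioms)
  show "(\<lambda>(x, b). if b then return S a else \<kappa> x) \<in> M \<Otimes>\<^sub>M count_space UNIV \<rightarrow>\<^sub>M prob_algebra S"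
  proof (rule measurable_pair_count_space)
    fix b show "(\<lambda>x. if b then return S a else \<kappa> x) \<in> M \<rightarrow>\<^sub>M prob_algebra S"
      using \<kappa> return_in_prob_algebra[OF a] by (cases b) simp_all
  qed auto
qed

text \<open>
  A uniformly chosen particle of the frozen product has the law given by the frozen mixture: for each
  \<open>j\<close> exactly one of the \<open>N\<close> positions of the frozen particle is \<open>j\<close>.
\<close>

lemma nn_integral_frozen_product_sum:
  assumes N: "N \<ge> 1" and a: "a \<in> space S" and \<mu>: "\<mu> \<in> space (prob_algebra S)"
    and g: "g \<in> borel_measurable S"
  shows "(\<Sum>i<N. \<Sum>j<N. ennreal (1 / N) * (\<integral>\<^sup>+ \<xi>. g (\<xi> j) \<partial>PiM {..<N} (\<lambda>j. if j = i then return S a else \<mu>)))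
    = of_nat N * (\<integral>\<^sup>+ y. g y \<partial>frozen_mixture N S \<mu> a)"
proof -
  have comp: "(\<integral>\<^sup>+ \<xi>. g (\<xi> j) \<partial>PiM {..<N} (\<lambda>j. if j = i then return S a else \<mu>))
     = (if j = i then g a else (\<integral>\<^sup>+ y. g y \<partial>\<mu>))" if "j < N" for i j
  proof -
    let ?D = "\<lambda>j. if j = i then return S a else \<mu>"
    have D: "?D j \<in> space (prob_algebra S)" for j using \<mu> return_in_prob_algebra[OF a] by simp
    then have "distr (PiM {..<N} ?D) (?D j) (\<lambda>\<xi>. \<xi> j) = ?D j"
      using that by (intro distr_PiM_component) (auto simp: space_prob_algebra)
    then have "(\<integral>\<^sup>+ y. g y \<partial>?D j) = (\<integral>\<^sup>+ y. g y \<partial>distr (PiM {..<N} ?D) (?D j) (\<lambda>\<xi>. \<xi> j))" by simp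
    also have "\<dots> = (\<integral>\<^sup>+ \<xi>. g (\<xi> j) \<partial>PiM {..<N} ?D)"
      using D[of j] that g by (intro nn_integral_distr measurable_component_singleton)
        (simp_all add: space_prob_algebra cong: measurable_cong_sets)
    finally show ?thesis using a g by (auto simp: nn_integral_return)
  qed
  have "(\<Sum>i<N. \<Sum>j<N. ennreal (1 / N) * (\<integral>\<^sup>+ \<xi>. g (\<xi> j) \<partial>PiM {..<N} (\<lambda>j. if j = i then return S a else \<mu>)))
     = (\<Sum>i<N. \<Sum>j<N. ennreal (1 / N) * (if j = i then g a else (\<integral>\<^sup>+ y. g y \<partial>\<mu>)))"
    by (intro sum.cong refl) (simp add: comp)
  also have "\<dots> = (\<Sum>i<N. ennreal (1 / N) * (g a + of_nat (N - 1) * (\<integral>\<^sup>+ y. g y \<partial>\<mu>)))"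
  proof (rule sum.cong[OF refl])
    fix i assume "i \<in> {..<N}"
    then have "(\<Sum>j<N. if j = i then g a else (\<integral>\<^sup>+ y. g y \<partial>\<mu>)) = g a + of_nat (N - 1) * (\<integral>\<^sup>+ y. g y \<partial>\<mu>)"
      by (subst sum.remove[of _ i]) auto
    then show "(\<Sum>j<N. ennreal (1 / N) * (if j = i then g a else (\<integral>\<^sup>+ y. g y \<partial>\<mu>)))
      = ennreal (1 / N) * (g a + of_nat (N - 1) * (\<integral>\<^sup>+ y. g y \<partial>\<mu>))"
      by (simp add: sum_distrib_left[symmetric])
  qed
  also have "ennreal (1 / N) * (g a + of_nat (N - 1) * (\<integral>\<^sup>+ y. g y \<partial>\<mu>)) = (\<integral>\<^sup>+ y. g y \<partial>frozen_mixture N S \<mu> a)"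
  proof -
    have "ennreal (1 / N) * of_nat (N - 1) = ennreal (1 - 1 / N)"
      using N by (simp add: ennreal_of_nat_eq_real_of_nat ennreal_mult[symmetric] diff_divide_distrib of_nat_diff)
    then show ?thesis
      by (simp add: nn_integral_frozen_mixture[OF assms] distrib_left mult.assoc[symmetric])
  qed
  finally show ?thesis by simp
qed

lemma nn_integral_frozen_product_mean:
  assumes N: "N \<ge> 1" and a: "a \<in> space S" and \<mu>: "\<mu> \<in> space (prob_algebra S)"
    and g[measurable]: "g \<in> borel_measurable S"
  shows "(\<integral>\<^sup>+ \<xi>. (\<Sum>j<N. g (\<xi> j)) * ennreal (1 / N) \<partial>frozen_product N S \<mu> a)
    = (\<integral>\<^sup>+ y. g y \<partial>frozen_mixture N S \<mu> a)"
proof -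
  let ?D = "\<lambda>i j. if j = i then return S a else \<mu>"
  have "(\<integral>\<^sup>+ \<xi>. (\<Sum>j<N. g (\<xi> j)) * ennreal (1 / N) \<partial>PiM {..<N} (?D i))
    = (\<Sum>j<N. \<integral>\<^sup>+ \<xi>. g (\<xi> j) \<partial>PiM {..<N} (?D i)) * ennreal (1 / N)" for i
  proof -
    have s: "sets (PiM {..<N} (?D i)) = sets (PiM {..<N} (\<lambda>_. S))"
      using \<mu> by (intro sets_PiM_cong) (auto simp: space_prob_algebra)
    have c: "(\<lambda>\<xi>. g (\<xi> j)) \<in> borel_measurable (PiM {..<N} (?D i))" if "j < N" for j
      unfolding measurable_cong_sets[OF s refl] using that
      by (intro measurable_compose[OF measurable_component_singleton[of j "{..<N}" "\<lambda>_. S"] g]) auto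
    have "(\<integral>\<^sup>+ \<xi>. (\<Sum>j<N. g (\<xi> j)) * ennreal (1 / N) \<partial>PiM {..<N} (?D i))
      = (\<integral>\<^sup>+ \<xi>. (\<Sum>j<N. g (\<xi> j)) \<partial>PiM {..<N} (?D i)) * ennreal (1 / N)"
      using c by (intro nn_integral_multc borel_measurable_sum) auto
    also have "(\<integral>\<^sup>+ \<xi>. (\<Sum>j<N. g (\<xi> j)) \<partial>PiM {..<N} (?D i)) = (\<Sum>j<N. \<integral>\<^sup>+ \<xi>. g (\<xi> j) \<partial>PiM {..<N} (?D i))"
      using c by (intro nn_integral_sum) auto
    finally show ?thesis .
  qed
  moreover have "(\<lambda>\<xi>. (\<Sum>j<N. g (\<xi> j)) * ennreal (1 / N)) \<in> borel_measurable (PiM {..<N} (\<lambda>_. S))"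
    by measurable
  ultimately have "(\<integral>\<^sup>+ \<xi>. (\<Sum>j<N. g (\<xi> j)) * ennreal (1 / N) \<partial>frozen_product N S \<mu> a)
    = (\<Sum>i<N. \<Sum>j<N. ennreal (1 / N) * (\<integral>\<^sup>+ \<xi>. g (\<xi> j) \<partial>PiM {..<N} (?D i))) * ennreal (1 / N)"
    by (simp only: nn_integral_frozen_product[OF N a \<mu>] sum_distrib_right sum_distrib_left mult.assoc)
  also have "\<dots> = of_nat N * ennreal (1 / N) * (\<integral>\<^sup>+ y. g y \<partial>frozen_mixture N S \<mu> a)"
    unfolding nn_integral_frozen_product_sum[OF N a \<mu> g] by (simp only: mult_ac)
  also have "of_nat N * ennreal (1 / N) = 1"
    using N by (simp add: ennreal_of_nat_eq_real_of_nat ennreal_mult[symmetric])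
  finally show ?thesis by simp
qed

text \<open>
  This is \<open>m(x)(g) / m(x)(h)\<close>; the factors \<open>1/N\<close> of the two occupation measures cancel.
\<close>

definition particle_ratio :: "nat \<Rightarrow> ('a \<Rightarrow> ennreal) \<Rightarrow> ('a \<Rightarrow> real) \<Rightarrow> (nat \<Rightarrow> 'a) \<Rightarrow> ennreal" where
  "particle_ratio N g h x = (\<Sum>j<N. g (x j)) * ennreal (1 / (\<Sum>j<N. h (x j)))"

lemma measurable_particle_ratio:
  assumes [measurable]: "g \<in> borel_measurable S" "h \<in> borel_measurable S"
  shows "particle_ratio N g h \<in> borel_measurable (PiM {..<N} (\<lambda>_. S))"
  unfolding particle_ratio_def by measurable

text \<open>
  The mean of the ratio of two empirical averages is the ratio of their means up to \<open>1 + O(r/N)\<close>, with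
  constants that do not depend on \<open>g\<close>. It follows by averaging the two sample estimates over the
  observed index \<open>j\<close> and over the position \<open>i\<close> of the frozen particle.
\<close>

lemma frozen_product_ratio:
  assumes N: "N \<ge> 2" and a: "a \<in> space S" and \<mu>: "\<mu> \<in> space (prob_algebra S)"
    and g: "g \<in> borel_measurable S" and h: "h \<in> borel_measurable S"
    and h_pos: "\<And>x. x \<in> space S \<Longrightarrow> 0 < h x"
    and h_ratio: "\<And>x y. x \<in> space S \<Longrightarrow> y \<in> space S \<Longrightarrow> h x \<le> r * h y"
  defines "E \<equiv> (\<integral>\<^sup>+ \<xi>. particle_ratio N g h \<xi> \<partial>frozen_product N S \<mu> a)"
    and "E' \<equiv> (\<integral>\<^sup>+ y. g y \<partial>frozen_mixture N S \<mu> a) * ennreal (1 / (\<integral>y. h y \<partial>\<mu>))"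
  shows "E \<le> ennreal (real N / (real N - 1) * (1 + r / real N)) * E'" and "E' \<le> ennreal (1 + 3 * r / real N) * E"
proof -
  note [measurable] = g h
  let ?D = "\<lambda>i j. if j = i then return S a else \<mu>" and ?u = "\<integral>y. h y \<partial>\<mu>"
  have D: "?D i j \<in> space (prob_algebra S)" for i j using \<mu> return_in_prob_algebra[OF a] by simp
  have fs: "frozen_sample N S (?D i) \<mu> i h r" for i
    by unfold_locales (use N \<mu> return_in_prob_algebra[OF a] h h_pos h_ratio in simp_all)
  interpret f0: frozen_sample N S "?D 0" \<mu> 0 h r by (rule fs)
  have N1: "N \<ge> 1" using N by simp
  define A where "A i j = (\<integral>\<^sup>+ \<xi>. g (\<xi> j) * ennreal (1 / (\<Sum>k<N. h (\<xi> k))) \<partial>PiM {..<N} (?D i))" for i j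
  define B where "B i j = (\<integral>\<^sup>+ \<xi>. g (\<xi> j) \<partial>PiM {..<N} (?D i))" for i j
  have E_eq: "E = (\<Sum>i<N. \<Sum>j<N. ennreal (1 / N) * A i j)"
  proof -
    have "(\<integral>\<^sup>+ \<xi>. particle_ratio N g h \<xi> \<partial>PiM {..<N} (?D i)) = (\<Sum>j<N. A i j)" for i
    proof -
      have s: "sets (PiM {..<N} (?D i)) = sets (PiM {..<N} (\<lambda>_. S))"
      proof (intro sets_PiM_cong refl)
        fix j show "sets (?D i j) = sets S" using D[of j i] by (simp only: space_prob_algebra mem_Collect_eq)
      qed
      show ?thesis unfolding A_def particle_ratio_def sum_distrib_right
        by (rule nn_integral_sum) (simp add: measurable_cong_sets[OF s refl])
    qed
    then show ?thesis unfolding E_def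
      using nn_integral_frozen_product[OF N1 a \<mu> measurable_particle_ratio[OF g h, of N]]
      by (simp add: sum_distrib_left)
  qed
  have E'_eq: "(\<Sum>i<N. \<Sum>j<N. ennreal (1 / N) * B i j) = of_nat N * (\<integral>\<^sup>+ y. g y \<partial>frozen_mixture N S \<mu> a)"
    unfolding B_def by (rule nn_integral_frozen_product_sum[OF N1 a \<mu> g])
  have u: "0 < ?u" by (rule f0.u_pos)
  have r: "0 \<le> r" by (rule f0.r_nonneg)
  define K where "K = (1 + r / N) / ((real N - 1) * ?u)"
  have K: "0 \<le> K" using N u r by (simp add: K_def)
  have "A i j \<le> ennreal K * B i j" if "j < N" for i j
  proof -
    define c where "c = (real N - 1) * ?u / (1 + r / N)"
    have c: "0 \<le> c" using N u r by (simp add: c_def)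
    have "1 + r / N \<noteq> 0" using r by (metis add_pos_nonneg divide_nonneg_nonneg of_nat_0_le_iff zero_less_one less_irrefl)
    then have "K * c = 1"
      using N u by (simp add: K_def c_def of_nat_diff)
    then have "A i j = ennreal (K * c) * A i j" by simp
    also have "\<dots> = ennreal K * (ennreal c * A i j)"
      using K c by (simp add: ennreal_mult mult.assoc)
    also have "\<dots> \<le> ennreal K * B i j"
      using frozen_sample.sample_upper[OF fs g that, of i] by (intro mult_left_mono) (auto simp: A_def B_def c_def)
    finally show ?thesis .
  qed
  then have "E \<le> (\<Sum>i<N. \<Sum>j<N. ennreal K * (ennreal (1 / N) * B i j))"
    unfolding E_eq mult.left_commute[of "ennreal K"] by (intro sum_mono mult_left_mono) auto
  also have "\<dots> = ennreal K * (of_nat N * (\<integral>\<^sup>+ y. g y \<partial>frozen_mixture N S \<mu> a))"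
    unfolding E'_eq[symmetric] by (simp add: sum_distrib_left)
  also have "ennreal K * (of_nat N * (\<integral>\<^sup>+ y. g y \<partial>frozen_mixture N S \<mu> a)) = ennreal (real N / (real N - 1) * (1 + r / real N)) * E'"
  proof -
    have "ennreal K * of_nat N = ennreal (real N / (real N - 1) * (1 + r / real N)) * ennreal (1 / ?u)"
      using K u r N by (simp add: ennreal_of_nat_eq_real_of_nat ennreal_mult[symmetric] K_def of_nat_diff mult.commute)
    then show ?thesis unfolding E'_def mult.assoc[of "ennreal K", symmetric] by (simp only: mult_ac)
  qed
  finally show "E \<le> ennreal (real N / (real N - 1) * (1 + r / real N)) * E'" .
  define L where "L = (real N + 3 * r) * ?u"
  have L: "0 \<le> L" using u r by (simp add: L_def)
  have "of_nat N * (\<integral>\<^sup>+ y. g y \<partial>frozen_mixture N S \<mu> a) \<le> (\<Sum>i<N. \<Sum>j<N. ennreal (1 / N) * (ennreal L * A i j))"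
    unfolding E'_eq[symmetric]
    by (intro sum_mono mult_left_mono) (auto simp: A_def B_def L_def intro!: frozen_sample.sample_lower[OF fs g])
  also have "\<dots> = ennreal L * E" unfolding E_eq by (simp add: sum_distrib_left mult_ac)
  finally have "ennreal (1 / (N * ?u)) * (of_nat N * (\<integral>\<^sup>+ y. g y \<partial>frozen_mixture N S \<mu> a)) \<le> ennreal (1 / (N * ?u)) * (ennreal L * E)"
    by (rule mult_left_mono) simp
  also have "ennreal (1 / (N * ?u)) * (of_nat N * (\<integral>\<^sup>+ y. g y \<partial>frozen_mixture N S \<mu> a)) = E'"
  proof -
    have "ennreal (1 / (N * ?u)) * of_nat N = ennreal (1 / ?u)"
      using u N by (simp add: ennreal_of_nat_eq_real_of_nat ennreal_mult[symmetric])
    then show ?thesis unfolding E'_def mult.assoc[of "ennreal (1 / (N * ?u))", symmetric] by (simp only: mult_ac)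
  qed
  also have "ennreal (1 / (N * ?u)) * (ennreal L * E) = ennreal (1 + 3 * r / real N) * E"
  proof -
    have "1 / (N * ?u) * L = 1 + 3 * r / N" using u N by (simp add: L_def field_simps)
    then show ?thesis using u L by (simp add: mult.assoc[symmetric] ennreal_mult[symmetric])
  qed
  finally show "E' \<le> ennreal (1 + 3 * r / real N) * E" .
qed

section \<open>Markov chains on path spaces\<close>

lemma path_init_in_prob_algebra:
  assumes \<mu>: "\<mu> \<in> space (prob_algebra (S 0))"
  shows "path_init S \<mu> \<in> space (prob_algebra (PiM {..0} S))"
    and "\<phi> \<in> borel_measurable (PiM {..0} S) \<Longrightarrow> (\<integral>\<^sup>+ w. \<phi> w \<partial>path_init S \<mu>) = (\<integral>\<^sup>+ x. \<phi> (\<lambda>k\<in>{..0}. x) \<partial>\<mu>)"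
proof -
  interpret prob_space \<mu> using \<mu> by (simp add: space_prob_algebra)
  have s[measurable_cong]: "sets \<mu> = sets (S 0)" using \<mu> by (simp add: space_prob_algebra)
  have m: "(\<lambda>x. \<lambda>k\<in>{..0}. x) \<in> \<mu> \<rightarrow>\<^sub>M PiM {..0::nat} S"
    by (rule measurable_restrict) (auto simp: measurable_cong_sets[OF s refl])
  show "path_init S \<mu> \<in> space (prob_algebra (PiM {..0} S))"
    using prob_space_distr[OF m] by (simp add: path_init_def space_prob_algebra)
  show "(\<integral>\<^sup>+ w. \<phi> w \<partial>path_init S \<mu>) = (\<integral>\<^sup>+ x. \<phi> (\<lambda>k\<in>{..0}. x) \<partial>\<mu>)" if "\<phi> \<in> borel_measurable (PiM {..0} S)"
    unfolding path_init_def by (rule nn_integral_distr[OF m], unfold measurable_distr_eq1, rule that)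
qed

lemma measurable_path_extend:
  "(\<lambda>(w, y). w(Suc k := y)) \<in> PiM {..k} S \<Otimes>\<^sub>M S (Suc k) \<rightarrow>\<^sub>M PiM {..Suc k} S"
  using measurable_add_dim[of "Suc k" "{..k}" S] by (simp add: atMost_Suc)

lemma path_extend_in_space:
  "w \<in> space (PiM {..k} S) \<Longrightarrow> y \<in> space (S (Suc k)) \<Longrightarrow> w(Suc k := y) \<in> space (PiM {..Suc k} S)"
  using measurable_space[OF measurable_path_extend, of "(w, y)"] by (simp add: space_pair_measure)

lemma measurable_path_extend_const:
  assumes "w \<in> space (PiM {..k} S)"
  shows "(\<lambda>y. w(Suc k := y)) \<in> S (Suc k) \<rightarrow>\<^sub>M PiM {..Suc k} S"
  using measurable_compose[OF measurable_Pair1'[OF assms] measurable_path_extend] by simp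

lemma measurable_path_kernel:
  assumes K: "K (Suc k) \<in> S k \<rightarrow>\<^sub>M prob_algebra (S (Suc k))"
  shows "path_kernel S K (Suc k) \<in> PiM {..k} S \<rightarrow>\<^sub>M prob_algebra (PiM {..Suc k} S)"
proof (rule measurable_prob_algebraI)
  have Kw: "(\<lambda>w. K (Suc k) (w k)) \<in> PiM {..k} S \<rightarrow>\<^sub>M prob_algebra (S (Suc k))"
    by (rule measurable_compose[OF _ K]) simp
  show "path_kernel S K (Suc k) \<in> PiM {..k} S \<rightarrow>\<^sub>M subprob_algebra (PiM {..Suc k} S)"
    unfolding path_kernel_def diff_Suc_1
    by (rule measurable_distr2[OF measurable_path_extend measurable_prob_algebraD[OF Kw]])
  fix w assume w: "w \<in> space (PiM {..k} S)"
  have "prob_space (K (Suc k) (w k))" "sets (K (Suc k) (w k)) = sets (S (Suc k))"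
    using measurable_space[OF Kw w] by (auto simp: space_prob_algebra)
  then show "prob_space (path_kernel S K (Suc k) w)"
    unfolding path_kernel_def diff_Suc_1
    using measurable_path_extend_const[OF w]
    by (intro prob_space.prob_space_distr) (simp_all cong: measurable_cong_sets)
qed

lemma nn_integral_path_kernel:
  assumes K: "K (Suc k) \<in> S k \<rightarrow>\<^sub>M prob_algebra (S (Suc k))"
    and w: "w \<in> space (PiM {..k} S)" and \<phi>: "\<phi> \<in> borel_measurable (PiM {..Suc k} S)"
  shows "(\<integral>\<^sup>+ v. \<phi> v \<partial>path_kernel S K (Suc k) w) = (\<integral>\<^sup>+ y. \<phi> (w(Suc k := y)) \<partial>K (Suc k) (w k))"
proof -
  have "w k \<in> space (S k)" using w by (auto simp: space_PiM)
  then have "sets (K (Suc k) (w k)) = sets (S (Suc k))"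
    using measurable_space[OF K] by (auto simp: space_prob_algebra)
  then show ?thesis
    unfolding path_kernel_def diff_Suc_1
    using measurable_path_extend_const[OF w]
    by (intro nn_integral_distr) (simp_all add: \<phi> cong: measurable_cong_sets)
qed

lemma chain_law_in_prob_algebra:
  assumes \<mu>: "\<mu> \<in> space (prob_algebra (S 0))"
    and K: "\<And>k. K (Suc k) \<in> S k \<rightarrow>\<^sub>M prob_algebra (S (Suc k))"
  shows "chain_law S \<mu> K n \<in> space (prob_algebra (PiM {..n} S))"
proof (induction n)
  case 0 then show ?case using path_init_in_prob_algebra(1)[where S=S, OF \<mu>] by simp
next
  case (Suc n)
  show ?case
    using prob_space_bind'[OF Suc measurable_path_kernel[where S=S and K=K and k=n, OF K]]
      sets_bind'[OF Suc measurable_path_kernel[where S=S and K=K and k=n, OF K]]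
    by (simp add: space_prob_algebra)
qed

lemma nn_integral_chain_law_Suc:
  assumes \<mu>: "\<mu> \<in> space (prob_algebra (S 0))"
    and K: "\<And>k. K (Suc k) \<in> S k \<rightarrow>\<^sub>M prob_algebra (S (Suc k))"
    and \<phi>: "\<phi> \<in> borel_measurable (PiM {..Suc n} S)"
  shows "(\<integral>\<^sup>+ w. \<phi> w \<partial>chain_law S \<mu> K (Suc n))
    = (\<integral>\<^sup>+ w. \<integral>\<^sup>+ y. \<phi> (w(Suc n := y)) \<partial>K (Suc n) (w n) \<partial>chain_law S \<mu> K n)"
proof -
  have s: "sets (chain_law S \<mu> K n) = sets (PiM {..n} S)"
    using chain_law_in_prob_algebra[OF \<mu> K, where n=n] by (simp add: space_prob_algebra)
  note sp = sets_eq_imp_space_eq[OF s]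
  have "path_kernel S K (Suc n) \<in> chain_law S \<mu> K n \<rightarrow>\<^sub>M subprob_algebra (PiM {..Suc n} S)"
    using measurable_prob_algebraD[OF measurable_path_kernel[where S=S and K=K and k=n, OF K]] by (simp add: measurable_cong_sets[OF s refl])
  from nn_integral_bind[OF \<phi> this] have
    "(\<integral>\<^sup>+ w. \<phi> w \<partial>chain_law S \<mu> K (Suc n)) = (\<integral>\<^sup>+ w. \<integral>\<^sup>+ v. \<phi> v \<partial>path_kernel S K (Suc n) w \<partial>chain_law S \<mu> K n)"
    by simp
  also have "\<dots> = (\<integral>\<^sup>+ w. \<integral>\<^sup>+ y. \<phi> (w(Suc n := y)) \<partial>K (Suc n) (w n) \<partial>chain_law S \<mu> K n)"
    by (intro nn_integral_cong nn_integral_path_kernel[where S=S and K=K and k=n, OF K _ \<phi>]) (simp add: sp)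
  finally show ?thesis .
qed

lemma chain_law_cong:
  assumes "\<And>k x. 1 \<le> k \<Longrightarrow> k \<le> n \<Longrightarrow> K k x = K' k x"
  shows "chain_law S \<mu> K n = chain_law S \<mu> K' n"
  using assms
proof (induction n)
  case (Suc n)
  have "path_kernel S K (Suc n) = path_kernel S K' (Suc n)"
    using Suc.prems[of "Suc n"] by (simp add: path_kernel_def fun_eq_iff)
  moreover have "chain_law S \<mu> K n = chain_law S \<mu> K' n" using Suc.prems by (intro Suc.IH) simp
  ultimately show ?case by simp
qed simp

section \<open>Empirical measures and the dual particle law\<close>

context
  fixes N :: nat and S :: "'a measure" and x :: "nat \<Rightarrow> 'a"
  assumes N: "N \<ge> 1" and x: "x \<in> space (PiM {..<N} (\<lambda>_. S))"
begin

lemma particle_in: "i < N \<Longrightarrow> x i \<in> space S" using x by (auto simp: space_PiM)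

lemma particle_measurable: "x \<in> uniform_count_measure {..<N} \<rightarrow>\<^sub>M S"
  using particle_in by (simp add: measurable_cong_sets[OF sets_uniform_count_measure_count_space refl])

lemma empirical_in_prob_algebra: "empirical N S x \<in> space (prob_algebra S)"
  using N unfolding empirical_def
  by (auto simp: space_prob_algebra lessThan_empty_iff
        intro!: prob_space.prob_space_distr prob_space_uniform_count_measure particle_measurable)

lemma nn_integral_empirical:
  "g \<in> borel_measurable S \<Longrightarrow> (\<integral>\<^sup>+ y. g y \<partial>empirical N S x) = (\<Sum>i<N. ennreal (1 / N) * g (x i))"
  unfolding empirical_def
  by (subst nn_integral_distr[OF particle_measurable]) (auto simp: nn_integral_uniform_count_measure)

lemma integral_empirical:
  fixes g :: "'a \<Rightarrow> real"
  shows "g \<in> borel_measurable S \<Longrightarrow> (\<integral>y. g y \<partial>empirical N S x) = (\<Sum>i<N. g (x i)) / N"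
  unfolding empirical_def
  by (subst integral_distr[OF particle_measurable]) (auto simp: integral_uniform_count_measure)

end

abbreviation particle_space :: "nat \<Rightarrow> 'a fk_model \<Rightarrow> nat \<Rightarrow> (nat \<Rightarrow> 'a) measure" where
  "particle_space N F k \<equiv> PiM {..<N} (\<lambda>_. state F k)"

abbreviation path_space :: "'a fk_model \<Rightarrow> nat \<Rightarrow> (nat \<Rightarrow> 'a) measure" where
  "path_space F k \<equiv> PiM {..k} (state F)"

abbreviation dual_kernel :: "'a fk_model \<Rightarrow> nat \<Rightarrow> (nat \<Rightarrow> 'a) \<Rightarrow> nat \<Rightarrow> (nat \<Rightarrow> 'a) \<Rightarrow> (nat \<Rightarrow> 'a) measure" where
  "dual_kernel F N z k x \<equiv>
     frozen_product N (state F (Suc k)) (fk_Phi F (Suc k) (empirical N (state F k) x)) (z (Suc k))"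

text \<open>
  The one-step operator \<open>Q\<^sub>k\<^sub>+\<^sub>1\<close> on nonnegative functions. Working in the extended nonnegative reals
  makes it total, so that no integrability has to be carried through the inductions.
\<close>

definition nn_step :: "'a fk_model \<Rightarrow> nat \<Rightarrow> ('a \<Rightarrow> ennreal) \<Rightarrow> 'a \<Rightarrow> ennreal" where
  "nn_step F k g x = ennreal (pot F k x) * (\<integral>\<^sup>+ y. g y \<partial>mkernel F (Suc k) x)"

context
  fixes F :: "'a fk_model"
  assumes F: "is_fk_model F"
begin

lemma fk_init: "init F \<in> space (prob_algebra (state F 0))"
  and fk_mkernel: "mkernel F (Suc k) \<in> state F k \<rightarrow>\<^sub>M prob_algebra (state F (Suc k))"
  and fk_pot_measurable: "pot F k \<in> borel_measurable (state F k)"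
  and fk_pot_pos: "x \<in> space (state F k) \<Longrightarrow> 0 < pot F k x"
  and fk_pot_bounded: "\<exists>B. \<forall>x\<in>space (state F k). pot F k x \<le> B"
  using F by (auto simp: is_fk_model_def)

lemma fk_mkernel_in: "x \<in> space (state F k) \<Longrightarrow> mkernel F (Suc k) x \<in> space (prob_algebra (state F (Suc k)))"
  using measurable_space[OF fk_mkernel] .

lemma fk_mkernel_sets: "x \<in> space (state F k) \<Longrightarrow> sets (mkernel F (Suc k) x) = sets (state F (Suc k))"
  and fk_mkernel_prob: "x \<in> space (state F k) \<Longrightarrow> prob_space (mkernel F (Suc k) x)"
  using fk_mkernel_in by (auto simp: space_prob_algebra)

lemma fk_mkernel_space: "x \<in> space (state F k) \<Longrightarrow> space (mkernel F (Suc k) x) = space (state F (Suc k))"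
  by (rule sets_eq_imp_space_eq) (rule fk_mkernel_sets)

lemma fk_state_nonempty: "space (state F k) \<noteq> {}"
proof (induction k)
  case 0 show ?case
    using fk_init prob_space.not_empty[of "init F"] sets_eq_imp_space_eq[of "init F" "state F 0"]
    by (auto simp: space_prob_algebra)
next
  case (Suc k)
  then obtain x where x: "x \<in> space (state F k)" by blast
  show ?case using prob_space.not_empty[OF fk_mkernel_prob[OF x]] fk_mkernel_space[OF x] by simp
qed

lemma measurable_nn_step:
  assumes g: "g \<in> borel_measurable (state F (Suc k))"
  shows "nn_step F k g \<in> borel_measurable (state F k)"
  unfolding nn_step_def[abs_def]
  by (intro borel_measurable_times_ennreal measurable_compose[OF fk_pot_measurable measurable_ennreal]
    measurable_compose[OF measurable_prob_algebraD[OF fk_mkernel] nn_integral_measurable_subprob_algebra[OF g]])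

context
  fixes N :: nat assumes N: "N \<ge> 1"
begin

context
  fixes k :: nat and x :: "nat \<Rightarrow> 'a"
  assumes x: "x \<in> space (particle_space N F k)"
begin

lemma sum_pot_pos: "0 < (\<Sum>l<N. pot F k (x l))"
  using N by (intro sum_pos fk_pot_pos particle_in[OF N x]) (auto simp: lessThan_empty_iff)

lemma nn_integral_boltzmann_gibbs:
  assumes g: "g \<in> borel_measurable (state F k)"
  shows "(\<integral>\<^sup>+ y. g y \<partial>boltzmann_gibbs (pot F k) (empirical N (state F k) x))
     = (\<Sum>i<N. ennreal (pot F k (x i) / (\<Sum>l<N. pot F k (x l))) * g (x i))"
proof -
  note [measurable] = fk_pot_measurable g
  have s[measurable_cong]: "sets (empirical N (state F k) x) = sets (state F k)" by (simp add: empirical_def)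
  have "ennreal (1 / N) * ennreal (pot F k (x i) / ((\<Sum>l<N. pot F k (x l)) / N)) = ennreal (pot F k (x i) / (\<Sum>l<N. pot F k (x l)))"
    if "i < N" for i
    using N sum_pot_pos fk_pot_pos[OF particle_in[OF N x that]] by (simp add: ennreal_mult[symmetric] less_imp_le)
  then show ?thesis
    unfolding boltzmann_gibbs_def using N
    by (subst nn_integral_density)
      (auto simp: nn_integral_empirical[OF N x] integral_empirical[OF N x fk_pot_measurable] mult.assoc[symmetric])
qed

lemma boltzmann_gibbs_in_prob_algebra:
  "boltzmann_gibbs (pot F k) (empirical N (state F k) x) \<in> space (prob_algebra (state F k))"
proof -
  let ?b = "boltzmann_gibbs (pot F k) (empirical N (state F k) x)"
  have s: "sets ?b = sets (state F k)" by (simp add: empirical_def boltzmann_gibbs_def)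
  have "(\<Sum>i<N. ennreal (pot F k (x i) / (\<Sum>l<N. pot F k (x l)))) = ennreal (\<Sum>i<N. pot F k (x i) / (\<Sum>l<N. pot F k (x l)))"
    using sum_pot_pos fk_pot_pos[OF particle_in[OF N x]] by (intro sum_ennreal) (simp add: less_imp_le)
  also have "(\<Sum>i<N. pot F k (x i) / (\<Sum>l<N. pot F k (x l))) = 1"
    using sum_pot_pos by (simp add: sum_divide_distrib[symmetric])
  finally have "emeasure ?b (space ?b) = 1"
    using nn_integral_boltzmann_gibbs[of "\<lambda>_. 1"] by simp
  then show ?thesis using s by (auto simp: space_prob_algebra intro!: prob_spaceI)
qed

lemma nn_integral_fk_Phi:
  assumes g: "g \<in> borel_measurable (state F (Suc k))"
  shows "(\<integral>\<^sup>+ y. g y \<partial>fk_Phi F (Suc k) (empirical N (state F k) x))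
    = (\<Sum>i<N. ennreal (pot F k (x i) / (\<Sum>l<N. pot F k (x l))) * (\<integral>\<^sup>+ y. g y \<partial>mkernel F (Suc k) (x i)))"
proof -
  have "sets (boltzmann_gibbs (pot F k) (empirical N (state F k) x)) = sets (state F k)"
    using boltzmann_gibbs_in_prob_algebra by (simp add: space_prob_algebra)
  then have "mkernel F (Suc k) \<in> boltzmann_gibbs (pot F k) (empirical N (state F k) x) \<rightarrow>\<^sub>M subprob_algebra (state F (Suc k))"
    using measurable_prob_algebraD[OF fk_mkernel] by (simp cong: measurable_cong_sets)
  from nn_integral_bind[OF g this] show ?thesis
    unfolding fk_Phi_def diff_Suc_1
    by (simp add: nn_integral_boltzmann_gibbs measurable_compose[OF measurable_prob_algebraD[OF fk_mkernel]
      nn_integral_measurable_subprob_algebra[OF g]])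
qed

lemma fk_Phi_in_prob_algebra:
  "fk_Phi F (Suc k) (empirical N (state F k) x) \<in> space (prob_algebra (state F (Suc k)))"
  using prob_space_bind'[OF boltzmann_gibbs_in_prob_algebra fk_mkernel] sets_bind'[OF boltzmann_gibbs_in_prob_algebra fk_mkernel]
  by (simp add: space_prob_algebra fk_Phi_def)

end

text \<open>
  On empirical measures \<open>\<Phi>\<close> is an explicit finite mixture of the kernels \<open>M(x\<^sub>i, \<cdot>)\<close>, which reduces
  measurability to that of the weights and of the kernel.
\<close>

lemma measurable_fk_Phi:
  "(\<lambda>x. fk_Phi F (Suc k) (empirical N (state F k) x)) \<in> particle_space N F k \<rightarrow>\<^sub>M prob_algebra (state F (Suc k))"
proof (rule measurable_prob_algebraI)
  fix x assume x: "x \<in> space (particle_space N F k)"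
  show "prob_space (fk_Phi F (Suc k) (empirical N (state F k) x))"
    using fk_Phi_in_prob_algebra[OF x] by (simp add: space_prob_algebra)
next
  show "(\<lambda>x. fk_Phi F (Suc k) (empirical N (state F k) x)) \<in> particle_space N F k \<rightarrow>\<^sub>M subprob_algebra (state F (Suc k))"
  proof (rule measurable_subprob_algebra)
    fix x assume x: "x \<in> space (particle_space N F k)"
    show "subprob_space (fk_Phi F (Suc k) (empirical N (state F k) x))"
      "sets (fk_Phi F (Suc k) (empirical N (state F k) x)) = sets (state F (Suc k))"
      using fk_Phi_in_prob_algebra[OF x] by (auto simp: space_prob_algebra prob_space_imp_subprob_space)
  next
    fix A assume A: "A \<in> sets (state F (Suc k))"
    note [measurable] = fk_pot_measurable
    have [measurable]: "(\<lambda>v. \<integral>\<^sup>+ y. indicator A y \<partial>mkernel F (Suc k) v) \<in> borel_measurable (state F k)"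
      using A by (intro measurable_compose[OF measurable_prob_algebraD[OF fk_mkernel]
        nn_integral_measurable_subprob_algebra]) auto
    have "(\<lambda>x. \<Sum>i<N. ennreal (pot F k (x i) / (\<Sum>l<N. pot F k (x l))) * (\<integral>\<^sup>+ y. indicator A y \<partial>mkernel F (Suc k) (x i)))
      \<in> borel_measurable (particle_space N F k)"
      by measurable
    also have "?this \<longleftrightarrow> (\<lambda>x. emeasure (fk_Phi F (Suc k) (empirical N (state F k) x)) A) \<in> borel_measurable (particle_space N F k)"
    proof (rule measurable_cong)
      fix x assume x: "x \<in> space (particle_space N F k)"
      have "sets (fk_Phi F (Suc k) (empirical N (state F k) x)) = sets (state F (Suc k))"
        using fk_Phi_in_prob_algebra[OF x] by (auto simp: space_prob_algebra)
      then show "(\<Sum>i<N. ennreal (pot F k (x i) / (\<Sum>l<N. pot F k (x l))) * (\<integral>\<^sup>+ y. indicator A y \<partial>mkernel F (Suc k) (x i)))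
        = emeasure (fk_Phi F (Suc k) (empirical N (state F k) x)) A"
        using nn_integral_fk_Phi[OF x, of "indicator A"] A by (simp add: nn_integral_indicator)
    qed
    finally show "(\<lambda>x. emeasure (fk_Phi F (Suc k) (empirical N (state F k) x)) A) \<in> borel_measurable (particle_space N F k)" .
  qed
qed

context
  fixes z :: "nat \<Rightarrow> 'a" assumes z: "\<And>k. z k \<in> space (state F k)"
begin

lemma dual_init: "frozen_product N (state F 0) (init F) (z 0) \<in> space (prob_algebra (particle_space N F 0))"
  by (rule frozen_product_in_prob_algebra[OF N z fk_init])

lemma measurable_dual_kernel:
  "(\<lambda>x. frozen_product N (state F (Suc k)) (fk_Phi F (Suc k) (empirical N (state F (Suc k - 1)) x)) (z (Suc k)))
    \<in> particle_space N F k \<rightarrow>\<^sub>M prob_algebra (particle_space N F (Suc k))"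
  unfolding diff_Suc_1 by (rule measurable_frozen_product[OF N z measurable_fk_Phi])

lemma dual_law_in_prob_algebra:
  "dual_law F N z n \<in> space (prob_algebra (PiM {..n} (particle_space N F)))"
  unfolding dual_law_def by (rule chain_law_in_prob_algebra[where S="(particle_space N F)" and
    K="(\<lambda>k x. frozen_product N (state F k) (fk_Phi F k (empirical N (state F (k - 1)) x)) (z k))", OF dual_init measurable_dual_kernel])

lemma sets_dual_law: "sets (dual_law F N z n) = sets (PiM {..n} (particle_space N F))"
  using dual_law_in_prob_algebra by (simp add: space_prob_algebra)

lemma nn_integral_dual_law_0:
  assumes "\<phi> \<in> borel_measurable (PiM {..0} (particle_space N F))"
  shows "(\<integral>\<^sup>+ x. \<phi> x \<partial>dual_law F N z 0)
    = (\<integral>\<^sup>+ \<xi>. \<phi> (\<lambda>k\<in>{..0}. \<xi>) \<partial>frozen_product N (state F 0) (init F) (z 0))"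
  unfolding dual_law_def chain_law.simps by (rule path_init_in_prob_algebra(2)[where S="(particle_space N F)", OF dual_init assms])

lemma nn_integral_dual_law_Suc:
  assumes "\<phi> \<in> borel_measurable (PiM {..Suc n} (particle_space N F))"
  shows "(\<integral>\<^sup>+ x. \<phi> x \<partial>dual_law F N z (Suc n))
    = (\<integral>\<^sup>+ x. \<integral>\<^sup>+ \<xi>. \<phi> (x(Suc n := \<xi>))
        \<partial>dual_kernel F N z n (x n)
        \<partial>dual_law F N z n)"
  unfolding dual_law_def
  by (subst nn_integral_chain_law_Suc[where S="(particle_space N F)" and
    K="(\<lambda>k x. frozen_product N (state F k) (fk_Phi F k (empirical N (state F (k - 1)) x)) (z k))", OF dual_init measurable_dual_kernel assms]) simp

end
end
end

section \<open>Unnormalised flows and Feynman-Kac semigroups\<close>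

definition nn_gamma :: "'a fk_model \<Rightarrow> nat \<Rightarrow> ('a \<Rightarrow> ennreal) \<Rightarrow> ennreal" where
  "nn_gamma F n g =
     (\<integral>\<^sup>+ w. g (w n) * (\<Prod>p<n. ennreal (pot F p (w p))) \<partial>chain_law (state F) (init F) (mkernel F) n)"

definition bounded_measurable :: "'a measure \<Rightarrow> ('a \<Rightarrow> real) \<Rightarrow> bool" where
  "bounded_measurable S f \<longleftrightarrow> f \<in> borel_measurable S \<and> (\<exists>B. \<forall>x\<in>space S. \<bar>f x\<bar> \<le> B)"

definition Q_step :: "'a fk_model \<Rightarrow> nat \<Rightarrow> ('a \<Rightarrow> real) \<Rightarrow> 'a \<Rightarrow> real" where
  "Q_step F k f x = pot F k x * (\<integral>y. f y \<partial>mkernel F (Suc k) x)"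

lemma fk_Q_self [simp]: "fk_Q F n n f = f"
  by (cases n) auto

lemma fk_Q_Suc: "p \<le> n \<Longrightarrow> fk_Q F p (Suc n) f = fk_Q F p n (Q_step F n f)"
  by (simp add: Q_step_def[abs_def])

declare fk_Q.simps(2) [simp del]

text \<open>
  The recursion defining \<open>fk_Q\<close> splits off the last step; the backward induction on particle ratios
  splits off the first one.
\<close>

lemma fk_Q_step_left:
  "p < n \<Longrightarrow> fk_Q F p n f = Q_step F p (fk_Q F (Suc p) n f)"
proof (induction n arbitrary: f)
  case (Suc n)
  show ?case
  proof (cases "p = n")
    case True
    then show ?thesis using fk_Q_Suc[of n n F f] by simp
  next
    case False
    then show ?thesis using Suc by (simp add: fk_Q_Suc)
  qed
qed simp

lemma bounded_measurable_const [simp]: "bounded_measurable S (\<lambda>_. c)"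
  by (auto simp: bounded_measurable_def)

lemma bounded_measurable_integrable:
  assumes f: "bounded_measurable S f" and \<mu>: "\<mu> \<in> space (prob_algebra S)"
  shows "integrable \<mu> f"
proof -
  have s: "sets \<mu> = sets S" using \<mu> by (simp add: space_prob_algebra)
  interpret prob_space \<mu> using \<mu> by (simp add: space_prob_algebra)
  obtain B where B: "\<And>x. x \<in> space S \<Longrightarrow> \<bar>f x\<bar> \<le> B" using f by (auto simp: bounded_measurable_def)
  show ?thesis
    by (rule integrable_const_bound[where B=B])
      (use f B sets_eq_imp_space_eq[OF s] in \<open>auto intro!: AE_I2 simp: bounded_measurable_def measurable_cong_sets[OF s refl]\<close>)
qed

lemma integral_pos_prob:
  assumes f: "bounded_measurable S f" and \<mu>: "\<mu> \<in> space (prob_algebra S)"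
    and pos: "\<And>x. x \<in> space S \<Longrightarrow> 0 < f x"
  shows "0 < (\<integral>y. f y \<partial>\<mu>)"
proof -
  have sp: "space \<mu> = space S" using \<mu> by (intro sets_eq_imp_space_eq) (simp add: space_prob_algebra)
  interpret prob_space \<mu> using \<mu> by (simp add: space_prob_algebra)
  have "expectation (\<lambda>_. 0) < expectation f"
    using bounded_measurable_integrable[OF f \<mu>] pos
    by (intro integral_less_AE_space) (use emeasure_space_1 in \<open>auto simp: sp\<close>)
  then show ?thesis by simp
qed

context
  fixes F :: "'a fk_model"
  assumes F: "is_fk_model F"
begin

lemma nn_gamma_0:
  assumes g: "g \<in> borel_measurable (state F 0)"
  shows "nn_gamma F 0 g = (\<integral>\<^sup>+ x. g x \<partial>init F)"
proof -
  have "(\<lambda>w. g (w 0)) \<in> borel_measurable (path_space F 0)"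
    using g by measurable
  from path_init_in_prob_algebra(2)[where S="state F", OF fk_init[OF F] this] show ?thesis
    by (simp add: nn_gamma_def)
qed

lemma chain_law_fk: "chain_law (state F) (init F) (mkernel F) n \<in> space (prob_algebra (path_space F n))"
  by (rule chain_law_in_prob_algebra[where S="state F" and K="mkernel F", OF fk_init[OF F] fk_mkernel[OF F]])

lemma sets_chain_law_fk: "sets (chain_law (state F) (init F) (mkernel F) n) = sets (path_space F n)"
  using chain_law_fk by (simp add: space_prob_algebra)

lemma space_chain_law_fk: "space (chain_law (state F) (init F) (mkernel F) n) = space (path_space F n)"
  by (rule sets_eq_imp_space_eq) (rule sets_chain_law_fk)

lemma measurable_nn_weight:
  assumes [measurable]: "g \<in> borel_measurable (state F n)"
  shows "(\<lambda>w. g (w n) * (\<Prod>p<n. ennreal (pot F p (w p)))) \<in> borel_measurable (path_space F n)"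
proof -
  note [measurable] = fk_pot_measurable[OF F]
  have "(\<lambda>w. \<Prod>p<n. ennreal (pot F p (w p))) \<in> borel_measurable (path_space F n)"
    by (rule borel_measurable_prod_ennreal) simp
  then show ?thesis by simp
qed

text \<open>
  The potential at time \<open>n\<close> can be absorbed into the test function, so the unnormalised flow is driven by
  the one-step operator.
\<close>

lemma nn_gamma_Suc:
  assumes g: "g \<in> borel_measurable (state F (Suc n))"
  shows "nn_gamma F (Suc n) g = nn_gamma F n (nn_step F n g)"
  unfolding nn_gamma_def
proof (subst nn_integral_chain_law_Suc[where S="state F" and K="mkernel F", OF fk_init[OF F] fk_mkernel[OF F] measurable_nn_weight[OF g]],
    rule nn_integral_cong)
  fix w assume "w \<in> space (chain_law (state F) (init F) (mkernel F) n)"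
  then have w: "w n \<in> space (state F n)" by (auto simp: space_chain_law_fk space_PiM)
  have "(\<integral>\<^sup>+ y. g ((w(Suc n := y)) (Suc n)) * (\<Prod>p<Suc n. ennreal (pot F p ((w(Suc n := y)) p))) \<partial>mkernel F (Suc n) (w n))
      = (\<integral>\<^sup>+ y. g y * (\<Prod>p<Suc n. ennreal (pot F p (w p))) \<partial>mkernel F (Suc n) (w n))"
    by (intro nn_integral_cong) (auto intro!: arg_cong2[where f="(*)"] prod.cong)
  also have "\<dots> = (\<integral>\<^sup>+ y. g y \<partial>mkernel F (Suc n) (w n)) * (\<Prod>p<Suc n. ennreal (pot F p (w p)))"
    using fk_mkernel_sets[OF F w] g by (intro nn_integral_multc) (simp cong: measurable_cong_sets)
  finally show "(\<integral>\<^sup>+ y. g ((w(Suc n := y)) (Suc n)) * (\<Prod>p<Suc n. ennreal (pot F p ((w(Suc n := y)) p))) \<partial>mkernel F (Suc n) (w n))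
    = nn_step F n g (w n) * (\<Prod>p<n. ennreal (pot F p (w p)))"
    by (simp add: nn_step_def mult_ac)
qed

lemma nn_gamma_mono:
  assumes "\<And>x. x \<in> space (state F n) \<Longrightarrow> g x \<le> g' x"
  shows "nn_gamma F n g \<le> nn_gamma F n g'"
  unfolding nn_gamma_def
  by (intro nn_integral_mono mult_right_mono assms) (auto simp: space_chain_law_fk space_PiM)

lemma nn_gamma_cong:
  assumes "\<And>x. x \<in> space (state F n) \<Longrightarrow> g x = g' x"
  shows "nn_gamma F n g = nn_gamma F n g'"
  using assms by (intro antisym nn_gamma_mono) auto

lemma nn_gamma_cmult:
  assumes "g \<in> borel_measurable (state F n)"
  shows "nn_gamma F n (\<lambda>x. c * g x) = c * nn_gamma F n g"
  unfolding nn_gamma_def mult.assoc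
  using measurable_nn_weight[OF assms] by (intro nn_integral_cmult) (simp add: measurable_cong_sets[OF sets_chain_law_fk refl])

lemma nn_gamma_finite: "c \<noteq> \<infinity> \<Longrightarrow> nn_gamma F n (\<lambda>_. c) \<noteq> \<infinity>"
proof (induction n arbitrary: c)
  case 0
  have "prob_space (init F)" using fk_init[OF F] by (simp add: space_prob_algebra)
  with 0 show ?case by (simp add: nn_gamma_0 prob_space.emeasure_space_1)
next
  case (Suc n)
  obtain B where B: "\<And>x. x \<in> space (state F n) \<Longrightarrow> pot F n x \<le> B" using fk_pot_bounded[OF F, of n] by blast
  have "nn_gamma F (Suc n) (\<lambda>_. c) \<le> nn_gamma F n (\<lambda>_. ennreal B * c)"
    unfolding nn_gamma_Suc[OF borel_measurable_const]
  proof (rule nn_gamma_mono)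
    fix x assume x: "x \<in> space (state F n)"
    show "nn_step F n (\<lambda>_. c) x \<le> ennreal B * c"
      using B[OF x] prob_space.emeasure_space_1[OF fk_mkernel_prob[OF F x]]
      by (auto simp: nn_step_def intro!: mult_right_mono ennreal_leI)
  qed
  also have "\<dots> < \<infinity>" using Suc.IH[of "ennreal B * c"] Suc.prems by (simp add: ennreal_mult_eq_top_iff less_top)
  finally show ?case by simp
qed

lemma fk_gamma_eq_nn_gamma:
  assumes f: "f \<in> borel_measurable (state F n)" and nn: "\<And>x. x \<in> space (state F n) \<Longrightarrow> 0 \<le> f x"
    and B: "\<exists>B. \<forall>x\<in>space (state F n). f x \<le> B"
  shows "ennreal (fk_gamma F n f) = nn_gamma F n (\<lambda>x. ennreal (f x))" and "0 \<le> fk_gamma F n f"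
proof -
  obtain B where B: "\<And>x. x \<in> space (state F n) \<Longrightarrow> f x \<le> B" using B by blast
  note [measurable] = f fk_pot_measurable[OF F]
  let ?M = "chain_law (state F) (init F) (mkernel F) n"
  have pos: "0 \<le> (\<Prod>p<n. pot F p (w p))" "0 \<le> f (w n)" if "w \<in> space ?M" for w
    using that fk_pot_pos[OF F] nn by (auto simp: space_chain_law_fk space_PiM PiE_iff less_imp_le intro!: prod_nonneg)
  have "(\<lambda>w. \<Prod>p<n. pot F p (w p)) \<in> borel_measurable (path_space F n)"
    by (rule borel_measurable_prod) simp
  then have m: "(\<lambda>w. f (w n) * (\<Prod>p<n. pot F p (w p))) \<in> borel_measurable ?M"
    by (simp add: measurable_cong_sets[OF sets_chain_law_fk refl])
  have "(\<integral>\<^sup>+ w. ennreal (f (w n) * (\<Prod>p<n. pot F p (w p))) \<partial>?M) = nn_gamma F n (\<lambda>x. ennreal (f x))"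
    unfolding nn_gamma_def
  proof (intro nn_integral_cong)
    fix w assume w: "w \<in> space ?M"
    then have "(\<Prod>p<n. ennreal (pot F p (w p))) = ennreal (\<Prod>p<n. pot F p (w p))"
      using fk_pot_pos[OF F] by (intro prod_ennreal) (auto simp: space_chain_law_fk space_PiM PiE_iff less_imp_le)
    then show "ennreal (f (w n) * (\<Prod>p<n. pot F p (w p))) = ennreal (f (w n)) * (\<Prod>p<n. ennreal (pot F p (w p)))"
      using pos[OF w] by (simp add: ennreal_mult)
  qed
  moreover have "fk_gamma F n f = enn2real (\<integral>\<^sup>+ w. ennreal (f (w n) * (\<Prod>p<n. pot F p (w p))) \<partial>?M)"
    unfolding fk_gamma_def using pos by (intro integral_eq_nn_integral[OF m]) (auto intro!: AE_I2)
  moreover have "nn_gamma F n (\<lambda>x. ennreal (f x)) \<le> nn_gamma F n (\<lambda>_. ennreal B)"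
    by (intro nn_gamma_mono ennreal_leI B)
  then have "nn_gamma F n (\<lambda>x. ennreal (f x)) \<noteq> \<infinity>"
    using nn_gamma_finite[of "ennreal B" n] by (auto simp: top_unique)
  ultimately show "ennreal (fk_gamma F n f) = nn_gamma F n (\<lambda>x. ennreal (f x))" "0 \<le> fk_gamma F n f"
    by (simp_all add: less_top)
qed

lemma bounded_measurable_pot: "bounded_measurable (state F k) (pot F k)"
  using fk_pot_measurable[OF F] fk_pot_bounded[OF F, of k] fk_pot_pos[OF F] unfolding bounded_measurable_def
  by (metis abs_of_pos)

lemma integrable_mkernel:
  "bounded_measurable (state F (Suc k)) f \<Longrightarrow> x \<in> space (state F k) \<Longrightarrow> integrable (mkernel F (Suc k) x) f"
  using bounded_measurable_integrable fk_mkernel_in[OF F] by blast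

lemma Q_step_abs:
  assumes f: "bounded_measurable (state F (Suc k)) f" and g: "bounded_measurable (state F (Suc k)) g"
    and le: "\<And>y. y \<in> space (state F (Suc k)) \<Longrightarrow> \<bar>f y\<bar> \<le> g y" and x: "x \<in> space (state F k)"
  shows "\<bar>Q_step F k f x\<bar> \<le> Q_step F k g x"
proof -
  have "\<bar>\<integral>y. f y \<partial>mkernel F (Suc k) x\<bar> \<le> (\<integral>y. g y \<partial>mkernel F (Suc k) x)"
    using integrable_mkernel[OF f x] integrable_mkernel[OF g x] le fk_mkernel_space[OF F x]
    by (intro order_trans[OF integral_abs_bound integral_mono]) auto
  then show ?thesis unfolding Q_step_def using fk_pot_pos[OF F x] by (simp add: abs_mult)
qed

lemma bounded_measurable_Q_step:
  assumes f: "bounded_measurable (state F (Suc k)) f"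
  shows "bounded_measurable (state F k) (Q_step F k f)"
proof -
  obtain B where B: "\<And>y. y \<in> space (state F (Suc k)) \<Longrightarrow> \<bar>f y\<bar> \<le> B" using f by (auto simp: bounded_measurable_def)
  have "\<bar>f y\<bar> \<le> \<bar>B\<bar>" if "y \<in> space (state F (Suc k))" for y using B[OF that] by simp
  then have bd: "\<bar>Q_step F k f x\<bar> \<le> Q_step F k (\<lambda>_. \<bar>B\<bar>) x" if "x \<in> space (state F k)" for x
    by (intro Q_step_abs f that) auto
  obtain C where C: "\<And>x. x \<in> space (state F k) \<Longrightarrow> pot F k x \<le> C" using fk_pot_bounded[OF F, of k] by blast
  have "\<bar>Q_step F k f x\<bar> \<le> C * \<bar>B\<bar>" if x: "x \<in> space (state F k)" for x
    using bd[OF x] mult_right_mono[OF C[OF x], of "\<bar>B\<bar>"] prob_space.prob_space[OF fk_mkernel_prob[OF F x]]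
    by (simp add: Q_step_def)
  moreover have "Q_step F k f \<in> borel_measurable (state F k)"
    unfolding Q_step_def[abs_def] using f B
    by (intro borel_measurable_times fk_pot_measurable[OF F] measurable_compose[OF measurable_prob_algebraD[OF fk_mkernel[OF F]]
      integral_measurable_subprob_algebra]) (auto simp: bounded_measurable_def)
  ultimately show ?thesis by (auto simp: bounded_measurable_def)
qed

lemma Q_step_pos:
  assumes "bounded_measurable (state F (Suc k)) f" "\<And>y. y \<in> space (state F (Suc k)) \<Longrightarrow> 0 < f y"
    and x: "x \<in> space (state F k)"
  shows "0 < Q_step F k f x"
  unfolding Q_step_def
  using integral_pos_prob[OF assms(1) fk_mkernel_in[OF F x] assms(2)] fk_pot_pos[OF F x] by simp

lemma ennreal_Q_step:
  assumes f: "bounded_measurable (state F (Suc k)) f" and nn: "\<And>y. y \<in> space (state F (Suc k)) \<Longrightarrow> 0 \<le> f y"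
    and x: "x \<in> space (state F k)"
  shows "ennreal (Q_step F k f x) = nn_step F k (\<lambda>y. ennreal (f y)) x"
proof -
  have "(\<integral>\<^sup>+ y. ennreal (f y) \<partial>mkernel F (Suc k) x) = ennreal (\<integral>y. f y \<partial>mkernel F (Suc k) x)"
    using integrable_mkernel[OF f x] nn fk_mkernel_space[OF F x]
    by (intro nn_integral_eq_integral) (auto intro!: AE_I2)
  then show ?thesis using fk_pot_pos[OF F x] by (simp add: Q_step_def nn_step_def ennreal_mult')
qed

lemma bounded_measurable_fk_Q:
  "p \<le> n \<Longrightarrow> bounded_measurable (state F n) f \<Longrightarrow> bounded_measurable (state F p) (fk_Q F p n f)"
proof (induction n arbitrary: f)
  case (Suc n)
  then show ?case
    by (cases "p = Suc n") (auto simp: fk_Q_Suc bounded_measurable_Q_step)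
qed simp

lemma fk_Q_abs:
  assumes "p \<le> n" and f: "bounded_measurable (state F n) f" and g: "bounded_measurable (state F n) g"
    and le: "\<And>y. y \<in> space (state F n) \<Longrightarrow> \<bar>f y\<bar> \<le> g y" and x: "x \<in> space (state F p)"
  shows "\<bar>fk_Q F p n f x\<bar> \<le> fk_Q F p n g x"
  using assms
proof (induction n arbitrary: f g)
  case (Suc n)
  show ?case
  proof (cases "p = Suc n")
    case False
    with Suc.prems have p: "p \<le> n" by simp
    show ?thesis unfolding fk_Q_Suc[OF p]
      by (intro Suc.IH p x bounded_measurable_Q_step Q_step_abs Suc.prems)
  qed (use Suc.prems in auto)
qed auto

lemma fk_Q_pos:
  assumes "p \<le> n" and "bounded_measurable (state F n) f" and "\<And>y. y \<in> space (state F n) \<Longrightarrow> 0 < f y"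
    and x: "x \<in> space (state F p)"
  shows "0 < fk_Q F p n f x"
  using assms
proof (induction n arbitrary: f)
  case (Suc n)
  show ?case
  proof (cases "p = Suc n")
    case False
    with Suc.prems have p: "p \<le> n" by simp
    show ?thesis unfolding fk_Q_Suc[OF p]
      by (intro Suc.IH p x bounded_measurable_Q_step Q_step_pos Suc.prems)
  qed (use Suc.prems in auto)
qed auto

end

section \<open>Propagation of the particle ratio\<close>

lemma frozen_model_sel [simp]:
  "state (frozen_model F N z) = state F" "pot (frozen_model F N z) = pot F"
  "init (frozen_model F N z) = frozen_mixture N (state F 0) (init F) (z 0)"
  "mkernel (frozen_model F N z) k x = frozen_mixture N (state F k) (mkernel F k x) (z k)"
  by (simp_all add: frozen_model_def)

lemma is_fk_model_frozen:
  assumes F: "is_fk_model F" and z: "\<And>k. z k \<in> space (state F k)"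
  shows "is_fk_model (frozen_model F N z)"
proof -
  have "mkernel (frozen_model F N z) (Suc k) = (\<lambda>x. frozen_mixture N (state F (Suc k)) (mkernel F (Suc k) x) (z (Suc k)))" for k
    by (simp add: fun_eq_iff)
  moreover have "frozen_mixture N (state F 0) (init F) (z 0) \<in> space (prob_algebra (state F 0))"
    using measurable_space[OF measurable_frozen_mixture[where a = "z 0" and S="state F 0" and \<kappa>="\<lambda>_. init F" and M="count_space UNIV", OF z], of _ N] fk_init[OF F] by simp
  ultimately show ?thesis
    using F measurable_frozen_mixture[OF z fk_mkernel[OF F]] unfolding is_fk_model_def by simp
qed

text \<open>
  The dual particle system of an arbitrary Feynman-Kac model, up to the horizon \<open>n\<close>. It is used for
  the path model, and for the marginal model when paths are sampled backwards.
\<close>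

locale dual_particles =
  fixes F :: "'a fk_model" and n :: nat and r :: real and N :: nat and z :: "nat \<Rightarrow> 'a"
  assumes F: "is_fk_model F" and r: "fk_ratio_bound F n r" and N: "N \<ge> 2"
    and z: "\<And>k. z k \<in> space (state F k)"
begin

text \<open>
  Reweighting by the future mass \<open>Q\<^sub>k\<^sub>,\<^sub>n(1)\<close> is what makes the one-step relations below close up: it turns
  the selection step into an exact identity.
\<close>

definition h where "h k = fk_Q F k n (\<lambda>_. 1)"
abbreviation "\<gamma>1 \<equiv> (\<integral>y. h 0 y \<partial>init F)"
abbreviation "Fz \<equiv> frozen_model F N z"

lemma N1: "N \<ge> 1" using N by simp

lemma Fz: "is_fk_model Fz" by (rule is_fk_model_frozen[OF F z])

lemma h_bm: "k \<le> n \<Longrightarrow> bounded_measurable (state F k) (h k)"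
  unfolding h_def by (rule bounded_measurable_fk_Q[OF F]) auto

lemma h_measurable: "k \<le> n \<Longrightarrow> h k \<in> borel_measurable (state F k)"
  using h_bm by (auto simp: bounded_measurable_def)

lemma h_pos: "k \<le> n \<Longrightarrow> x \<in> space (state F k) \<Longrightarrow> 0 < h k x"
  unfolding h_def by (rule fk_Q_pos[OF F]) auto

lemma h_ratio: "k \<le> n \<Longrightarrow> x \<in> space (state F k) \<Longrightarrow> y \<in> space (state F k) \<Longrightarrow> h k x \<le> r * h k y"
  using r unfolding h_def fk_ratio_bound_def by auto

lemma h_top: "h n = (\<lambda>_. 1)" by (simp add: h_def)

lemma h_step: "k < n \<Longrightarrow> h k = Q_step F k (h (Suc k))"
  unfolding h_def by (rule fk_Q_step_left)

lemma ennreal_h_step: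
  "k < n \<Longrightarrow> x \<in> space (state F k) \<Longrightarrow> ennreal (h k x) = nn_step F k (\<lambda>y. ennreal (h (Suc k) y)) x"
  unfolding h_step by (rule ennreal_Q_step[OF F]) (auto intro!: h_bm h_pos[THEN less_imp_le])

lemma r_ge_1: "1 \<le> r"
proof -
  obtain x where x: "x \<in> space (state F n)" using fk_state_nonempty[OF F] by blast
  show ?thesis using h_ratio[OF order_refl x x] by (simp add: h_top)
qed

definition "upper_factor = real N / (real N - 1) * (1 + r / real N)"
definition "lower_factor = 1 + 3 * r / real N"

lemma upper_factor_nonneg: "0 \<le> upper_factor" and lower_factor_pos: "0 < lower_factor"
proof -
  show "0 \<le> upper_factor" unfolding upper_factor_def using N r_ge_1 by (intro mult_nonneg_nonneg divide_nonneg_nonneg add_nonneg_nonneg) auto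
  show "0 < lower_factor" unfolding lower_factor_def using N r_ge_1 by (intro add_pos_nonneg divide_nonneg_nonneg) auto
qed

lemma init_ratio:
  assumes g: "g \<in> borel_measurable (state F 0)"
  defines "E \<equiv> (\<integral>\<^sup>+ \<xi>. particle_ratio N g (h 0) \<xi> \<partial>frozen_product N (state F 0) (init F) (z 0))"
    and "E' \<equiv> (\<integral>\<^sup>+ y. g y \<partial>frozen_mixture N (state F 0) (init F) (z 0)) * ennreal (1 / \<gamma>1)"
  shows "E \<le> ennreal upper_factor * E'" and "E' \<le> ennreal lower_factor * E"
proof -
  have k: "0 \<le> n" by simp
  note * = frozen_product_ratio[OF N z[of 0] fk_init[OF F] g h_measurable[OF k] h_pos[OF k] h_ratio[OF k]]
  show "E \<le> ennreal upper_factor * E'" unfolding E_def E'_def upper_factor_def by (rule *(1))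
  show "E' \<le> ennreal lower_factor * E" unfolding E_def E'_def lower_factor_def by (rule *(2))
qed

context
  fixes k and x
  assumes k: "k < n" and x: "x \<in> space (particle_space N F k)"
begin

abbreviation "\<mu> \<equiv> fk_Phi F (Suc k) (empirical N (state F k) x)"
abbreviation "sG \<equiv> (\<Sum>l<N. pot F k (x l))"

lemma x_in: "i < N \<Longrightarrow> x i \<in> space (state F k)"
  by (rule particle_in[OF N1 x])

lemma sG_pos: "0 < sG" by (rule sum_pot_pos[OF F N1 x])

lemma sum_h_pos: "0 < (\<Sum>l<N. h k (x l))"
  using N by (intro sum_pos h_pos x_in) (auto simp: k less_imp_le lessThan_empty_iff)

text \<open>
  Selection by \<open>G\<^sub>k\<close> followed by mutation integrates \<open>h\<^sub>k\<^sub>+\<^sub>1\<close> to \<open>m\<^sub>k(h\<^sub>k) / m\<^sub>k(G\<^sub>k)\<close>, because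
  \<open>G\<^sub>k M\<^sub>k\<^sub>+\<^sub>1(h\<^sub>k\<^sub>+\<^sub>1) = h\<^sub>k\<close>.
\<close>

lemma integral_h_Phi: "(\<integral>y. h (Suc k) y \<partial>\<mu>) = (\<Sum>l<N. h k (x l)) / sG"
proof -
  have \<mu>: "\<mu> \<in> space (prob_algebra (state F (Suc k)))" by (rule fk_Phi_in_prob_algebra[OF F N1 x])
  then have sp: "space \<mu> = space (state F (Suc k))"
    by (intro sets_eq_imp_space_eq) (simp add: space_prob_algebra)
  have bm: "bounded_measurable (state F (Suc k)) (h (Suc k))" using k by (intro h_bm) simp
  have "ennreal (\<integral>y. h (Suc k) y \<partial>\<mu>) = (\<integral>\<^sup>+ y. h (Suc k) y \<partial>\<mu>)"
    using bounded_measurable_integrable[OF bm \<mu>] h_pos[of "Suc k"] k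
    by (intro nn_integral_eq_integral[symmetric]) (auto intro!: AE_I2 simp: sp less_imp_le)
  also have "\<dots> = (\<Sum>i<N. ennreal (pot F k (x i) / sG) * (\<integral>\<^sup>+ y. h (Suc k) y \<partial>mkernel F (Suc k) (x i)))"
    using h_measurable[of "Suc k"] k by (intro nn_integral_fk_Phi[OF F N1 x]) auto
  also have "\<dots> = (\<Sum>i<N. ennreal (h k (x i) / sG))"
  proof (intro sum.cong refl)
    fix i assume "i \<in> {..<N}"
    then have xi: "x i \<in> space (state F k)" by (intro x_in) simp
    have "ennreal (pot F k (x i) / sG) * (\<integral>\<^sup>+ y. h (Suc k) y \<partial>mkernel F (Suc k) (x i))
       = ennreal (1 / sG) * nn_step F k (\<lambda>y. ennreal (h (Suc k) y)) (x i)"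
      using sG_pos fk_pot_pos[OF F xi] by (simp add: nn_step_def mult.assoc[symmetric] ennreal_mult[symmetric])
    also have "\<dots> = ennreal (h k (x i) / sG)"
      unfolding ennreal_h_step[OF k xi, symmetric]
      using sG_pos h_pos[OF less_imp_le[OF k] xi] by (simp add: ennreal_mult[symmetric])
    finally show "ennreal (pot F k (x i) / sG) * (\<integral>\<^sup>+ y. h (Suc k) y \<partial>mkernel F (Suc k) (x i)) = ennreal (h k (x i) / sG)" .
  qed
  also have "\<dots> = ennreal (\<Sum>i<N. h k (x i) / sG)"
    using sG_pos h_pos[OF less_imp_le[OF k] x_in] by (intro sum_ennreal) (simp add: less_imp_le)
  finally show ?thesis
    using sG_pos sum_h_pos integral_pos_prob[OF bm \<mu> h_pos[OF Suc_leI[OF k]]]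
    by (subst (asm) ennreal_inj) (auto simp: sum_divide_distrib[symmetric])
qed

text \<open>
  Both integrals carry the selection normalisation \<open>1 / m\<^sub>k(G\<^sub>k)\<close>. After it cancels, the frozen state
  appears inside the sum over particles, weighted by \<open>G\<^sub>k(x\<^sub>i) / N\<close>, exactly as in the transition
  of the model with a frozen path.
\<close>

lemma step_ratio_flow:
  assumes g: "g \<in> borel_measurable (state F (Suc k))"
  shows "(\<integral>\<^sup>+ y. g y \<partial>frozen_mixture N (state F (Suc k)) \<mu> (z (Suc k))) * ennreal (1 / (\<integral>y. h (Suc k) y \<partial>\<mu>))
    = particle_ratio N (nn_step Fz k g) (h k) x"
proof -
  let ?M = "\<lambda>i. \<integral>\<^sup>+ y. g y \<partial>mkernel F (Suc k) (x i)"
  let ?G = "\<lambda>i. ennreal (pot F k (x i))"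
  have "ennreal sG * (\<integral>\<^sup>+ y. g y \<partial>frozen_mixture N (state F (Suc k)) \<mu> (z (Suc k)))
    = ennreal sG * (ennreal (1 / N) * g (z (Suc k)) + ennreal (1 - 1 / N) * (\<Sum>i<N. ennreal (pot F k (x i) / sG) * ?M i))"
    by (simp add: nn_integral_frozen_mixture[OF N1 z fk_Phi_in_prob_algebra[OF F N1 x] g] nn_integral_fk_Phi[OF F N1 x g])
  also have "\<dots> = ennreal sG * (ennreal (1 / N) * g (z (Suc k))) + ennreal (1 - 1 / N) * (\<Sum>i<N. (ennreal sG * ennreal (pot F k (x i) / sG)) * ?M i)"
    by (simp add: distrib_left sum_distrib_left mult_ac)
  also have "(\<Sum>i<N. (ennreal sG * ennreal (pot F k (x i) / sG)) * ?M i) = (\<Sum>i<N. ?G i * ?M i)"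
    using sG_pos fk_pot_pos[OF F x_in] by (intro sum.cong refl) (simp add: ennreal_mult[symmetric] less_imp_le)
  also have "ennreal sG * (ennreal (1 / N) * g (z (Suc k))) + ennreal (1 - 1 / N) * (\<Sum>i<N. ?G i * ?M i)
    = (\<Sum>i<N. ?G i) * (ennreal (1 / N) * g (z (Suc k))) + ennreal (1 - 1 / N) * (\<Sum>i<N. ?G i * ?M i)"
    using fk_pot_pos[OF F x_in] by (subst sum_ennreal) (simp_all add: less_imp_le)
  also have "(\<Sum>i<N. ?G i) * (ennreal (1 / N) * g (z (Suc k))) + ennreal (1 - 1 / N) * (\<Sum>i<N. ?G i * ?M i)
    = (\<Sum>i<N. ?G i * (ennreal (1 / N) * g (z (Suc k)) + ennreal (1 - 1 / N) * ?M i))"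
    by (simp add: sum_distrib_right sum_distrib_left distrib_left sum.distrib mult_ac)
  also have "\<dots> = (\<Sum>i<N. nn_step Fz k g (x i))"
    using x_in by (intro sum.cong refl)
      (simp add: nn_step_def nn_integral_frozen_mixture[OF N1 z fk_mkernel_in[OF F] g])
  finally have *: "ennreal sG * (\<integral>\<^sup>+ y. g y \<partial>frozen_mixture N (state F (Suc k)) \<mu> (z (Suc k))) = (\<Sum>i<N. nn_step Fz k g (x i))" .
  have "ennreal (1 / (\<integral>y. h (Suc k) y \<partial>\<mu>)) = ennreal sG * ennreal (1 / (\<Sum>l<N. h k (x l)))"
    using sG_pos sum_h_pos by (simp add: integral_h_Phi ennreal_mult[symmetric])
  then show ?thesis unfolding particle_ratio_def *[symmetric] by (simp add: mult_ac)
qed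

lemma step_ratio:
  assumes g: "g \<in> borel_measurable (state F (Suc k))"
  defines "E \<equiv> (\<integral>\<^sup>+ \<xi>. particle_ratio N g (h (Suc k)) \<xi> \<partial>dual_kernel F N z k x)"
  shows "E \<le> ennreal upper_factor * particle_ratio N (nn_step Fz k g) (h k) x"
    and "particle_ratio N (nn_step Fz k g) (h k) x \<le> ennreal lower_factor * E"
proof -
  have k': "Suc k \<le> n" using k by simp
  note * = frozen_product_ratio[OF N z[of "Suc k"] fk_Phi_in_prob_algebra[OF F N1 x] g h_measurable[OF k']
    h_pos[OF k'] h_ratio[OF k'], unfolded step_ratio_flow[OF g]]
  show "E \<le> ennreal upper_factor * particle_ratio N (nn_step Fz k g) (h k) x" unfolding E_def upper_factor_def by (rule *(1))
  show "particle_ratio N (nn_step Fz k g) (h k) x \<le> ennreal lower_factor * E" unfolding E_def lower_factor_def by (rule *(2))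
qed

end

text \<open>
  At \<open>k = n\<close> the denominator is constant, and this is the mean of the occupation measure itself.
\<close>

definition mean_ratio where "mean_ratio k g = (\<integral>\<^sup>+ x. particle_ratio N g (h k) (x k) \<partial>dual_law F N z k)"

lemma space_dual_law: "space (dual_law F N z k) = space (PiM {..k} (particle_space N F))"
  by (rule sets_eq_imp_space_eq) (rule sets_dual_law[OF F N1 z])

lemma dual_component: "x \<in> space (dual_law F N z k) \<Longrightarrow> j \<le> k \<Longrightarrow> x j \<in> space (particle_space N F j)"
  unfolding space_dual_law by (subst (asm) space_PiM) auto

lemma measurable_ratio_at:
  assumes "g \<in> borel_measurable (state F k)" "k \<le> n"
  shows "(\<lambda>x. particle_ratio N g (h k) (x k)) \<in> borel_measurable (PiM {..k} (particle_space N F))"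
  by (rule measurable_compose[OF _ measurable_particle_ratio[OF assms(1) h_measurable[OF assms(2)]]]) simp

lemma mean_ratio_0: "g \<in> borel_measurable (state F 0) \<Longrightarrow>
  mean_ratio 0 g = (\<integral>\<^sup>+ \<xi>. particle_ratio N g (h 0) \<xi> \<partial>frozen_product N (state F 0) (init F) (z 0))"
  unfolding mean_ratio_def by (subst nn_integral_dual_law_0[OF F N1 z measurable_ratio_at]) auto

lemma mean_ratio_Suc: "g \<in> borel_measurable (state F (Suc k)) \<Longrightarrow> Suc k \<le> n \<Longrightarrow>
  mean_ratio (Suc k) g = (\<integral>\<^sup>+ x. \<integral>\<^sup>+ \<xi>. particle_ratio N g (h (Suc k)) \<xi>
    \<partial>dual_kernel F N z k (x k) \<partial>dual_law F N z k)"
  unfolding mean_ratio_def by (subst nn_integral_dual_law_Suc[OF F N1 z measurable_ratio_at]) auto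

lemma nn_step_measurable: "g \<in> borel_measurable (state F (Suc k)) \<Longrightarrow> nn_step Fz k g \<in> borel_measurable (state F k)"
  using measurable_nn_step[OF Fz, of g k] by simp

lemma measurable_ratio_dual:
  assumes "g \<in> borel_measurable (state F k)" "k \<le> n"
  shows "(\<lambda>x. particle_ratio N g (h k) (x k)) \<in> borel_measurable (dual_law F N z k)"
  using measurable_ratio_at[OF assms] by (simp add: measurable_cong_sets[OF sets_dual_law[OF F N1 z] refl])

text \<open>
  Each step of the particle system contributes one factor and replaces \<open>g\<close> by its image under the
  frozen one-step operator; the initial sampling contributes one more factor.
\<close>

lemma mean_ratio_upper:
  "k \<le> n \<Longrightarrow> g \<in> borel_measurable (state F k) \<Longrightarrow> mean_ratio k g \<le> ennreal (upper_factor ^ Suc k) * (nn_gamma Fz k g * ennreal (1 / \<gamma>1))"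
proof (induction k arbitrary: g)
  case 0
  then show ?case using init_ratio(1)[of g] nn_gamma_0[OF Fz, of g] by (simp add: mean_ratio_0)
next
  case (Suc k)
  have m: "nn_step Fz k g \<in> borel_measurable (state F k)" by (rule nn_step_measurable[OF Suc.prems(2)])
  have "mean_ratio (Suc k) g \<le> (\<integral>\<^sup>+ x. ennreal upper_factor * particle_ratio N (nn_step Fz k g) (h k) (x k) \<partial>dual_law F N z k)"
    unfolding mean_ratio_Suc[OF Suc.prems(2,1)]
    using Suc.prems by (intro nn_integral_mono step_ratio(1) dual_component) auto
  also have "\<dots> = ennreal upper_factor * mean_ratio k (nn_step Fz k g)"
    unfolding mean_ratio_def using Suc.prems by (intro nn_integral_cmult measurable_ratio_dual m) auto
  also have "\<dots> \<le> ennreal upper_factor * (ennreal (upper_factor ^ Suc k) * (nn_gamma Fz k (nn_step Fz k g) * ennreal (1 / \<gamma>1)))"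
    using Suc.prems by (intro mult_left_mono Suc.IH m) auto
  also have "\<dots> = ennreal (upper_factor ^ Suc (Suc k)) * (nn_gamma Fz (Suc k) g * ennreal (1 / \<gamma>1))"
    using upper_factor_nonneg nn_gamma_Suc[OF Fz, of g k] Suc.prems(2) by (simp add: ennreal_mult mult.assoc)
  finally show ?case .
qed

lemma mean_ratio_lower:
  "k \<le> n \<Longrightarrow> g \<in> borel_measurable (state F k) \<Longrightarrow> nn_gamma Fz k g * ennreal (1 / \<gamma>1) \<le> ennreal (lower_factor ^ Suc k) * mean_ratio k g"
proof (induction k arbitrary: g)
  case 0
  then show ?case using init_ratio(2)[of g] nn_gamma_0[OF Fz, of g] by (simp add: mean_ratio_0)
next
  case (Suc k)
  have m: "nn_step Fz k g \<in> borel_measurable (state F k)" by (rule nn_step_measurable[OF Suc.prems(2)])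
  have "nn_gamma Fz (Suc k) g * ennreal (1 / \<gamma>1) = nn_gamma Fz k (nn_step Fz k g) * ennreal (1 / \<gamma>1)"
    using nn_gamma_Suc[OF Fz, of g k] Suc.prems(2) by simp
  also have "\<dots> \<le> ennreal (lower_factor ^ Suc k) * mean_ratio k (nn_step Fz k g)"
    using Suc.prems by (intro Suc.IH m) auto
  finally have flow: "nn_gamma Fz (Suc k) g * ennreal (1 / \<gamma>1) \<le> ennreal (lower_factor ^ Suc k) * mean_ratio k (nn_step Fz k g)" .
  have "mean_ratio k (nn_step Fz k g) \<le> (\<integral>\<^sup>+ x. ennreal lower_factor * (\<integral>\<^sup>+ \<xi>. particle_ratio N g (h (Suc k)) \<xi>
    \<partial>dual_kernel F N z k (x k)) \<partial>dual_law F N z k)"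
    unfolding mean_ratio_def using Suc.prems by (intro nn_integral_mono step_ratio(2) dual_component) auto
  also have "\<dots> = ennreal lower_factor * mean_ratio (Suc k) g"
    unfolding mean_ratio_Suc[OF Suc.prems(2,1)]
  proof (rule nn_integral_cmult)
    have "(\<lambda>x. dual_kernel F N z k (x k))
      \<in> dual_law F N z k \<rightarrow>\<^sub>M prob_algebra (particle_space N F (Suc k))"
      unfolding measurable_cong_sets[OF sets_dual_law[OF F N1 z] refl]
      using measurable_compose[OF measurable_component_singleton[of k "{..k}" "\<lambda>k. particle_space N F k"] measurable_dual_kernel[OF F N1 z, of k]]
      by simp
    from measurable_compose[OF measurable_prob_algebraD[OF this] nn_integral_measurable_subprob_algebra[OF
      measurable_particle_ratio[OF Suc.prems(2) h_measurable[OF Suc.prems(1)]]]]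
    show "(\<lambda>x. \<integral>\<^sup>+ \<xi>. particle_ratio N g (h (Suc k)) \<xi>
      \<partial>dual_kernel F N z k (x k))
      \<in> borel_measurable (dual_law F N z k)" .
  qed
  finally have "mean_ratio k (nn_step Fz k g) \<le> ennreal lower_factor * mean_ratio (Suc k) g" .
  from order_trans[OF flow mult_left_mono[OF this]]
  have "nn_gamma Fz (Suc k) g * ennreal (1 / \<gamma>1) \<le> ennreal (lower_factor ^ Suc k) * (ennreal lower_factor * mean_ratio (Suc k) g)" by simp
  then show ?case using lower_factor_pos by (simp add: ennreal_mult mult_ac)
qed

text \<open>
  Under the ratio bound, visiting the frozen state with probability \<open>1/N\<close> cannot increase the future mass by
  more than the factor \<open>1 + r/N\<close>.
\<close>

lemma frozen_mixture_h_le: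
  assumes k: "k \<le> n" and \<eta>: "\<eta> \<in> space (prob_algebra (state F k))"
  shows "(\<integral>\<^sup>+ y. h k y \<partial>frozen_mixture N (state F k) \<eta> (z k)) \<le> ennreal (1 + r / N) * (\<integral>\<^sup>+ y. h k y \<partial>\<eta>)"
proof -
  interpret prob_space \<eta> using \<eta> by (simp add: space_prob_algebra)
  have s: "sets \<eta> = sets (state F k)" using \<eta> by (simp add: space_prob_algebra)
  have hm: "(\<lambda>y. ennreal (h k y)) \<in> borel_measurable (state F k)" using h_measurable[OF k] by simp
  have "ennreal (h k (z k)) = (\<integral>\<^sup>+ y. ennreal (h k (z k)) \<partial>\<eta>)" by (simp add: emeasure_space_1)
  also have "\<dots> \<le> (\<integral>\<^sup>+ y. ennreal r * ennreal (h k y) \<partial>\<eta>)"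
    using h_ratio[OF k z] h_pos[OF k] r_ge_1 sets_eq_imp_space_eq[OF s]
    by (intro nn_integral_mono) (auto simp: ennreal_mult'[symmetric] intro!: ennreal_leI)
  also have "\<dots> = ennreal r * (\<integral>\<^sup>+ y. h k y \<partial>\<eta>)"
    using hm by (intro nn_integral_cmult) (simp add: measurable_cong_sets[OF s refl])
  finally have hz: "ennreal (h k (z k)) \<le> ennreal r * (\<integral>\<^sup>+ y. h k y \<partial>\<eta>)" .
  have "(\<integral>\<^sup>+ y. h k y \<partial>frozen_mixture N (state F k) \<eta> (z k))
    = ennreal (1 / N) * ennreal (h k (z k)) + ennreal (1 - 1 / N) * (\<integral>\<^sup>+ y. h k y \<partial>\<eta>)"
    by (rule nn_integral_frozen_mixture[OF N1 z \<eta> hm])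
  also have "\<dots> \<le> ennreal (1 / N) * (ennreal r * (\<integral>\<^sup>+ y. h k y \<partial>\<eta>)) + 1 * (\<integral>\<^sup>+ y. h k y \<partial>\<eta>)"
    using N by (intro add_mono mult_mono hz) (auto simp: ennreal_le_1)
  also have "\<dots> = ennreal (1 + r / N) * (\<integral>\<^sup>+ y. h k y \<partial>\<eta>)"
  proof -
    have "ennreal (1 + r / N) = ennreal (1 / N) * ennreal r + 1"
      using r_ge_1 by (simp add: ennreal_mult[symmetric] ennreal_plus add.commute)
    then show ?thesis by (simp add: distrib_right mult.assoc)
  qed
  finally show ?thesis .
qed

text \<open>
  The quantity \<open>\<gamma>\<^sub>k(h\<^sub>k)\<close> does not depend on \<open>k\<close>. At time \<open>n\<close> it is \<open>\<gamma>\<^sub>n(1)\<close> and at time \<open>0\<close> it is the integral of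
  \<open>h\<^sub>0\<close>.
\<close>

lemma gamma1_eq: "nn_gamma F n (\<lambda>_. 1) = ennreal \<gamma>1"
proof -
  have "k \<le> n \<Longrightarrow> nn_gamma F k (\<lambda>y. ennreal (h k y)) = ennreal \<gamma>1" for k
  proof (induction k)
    case 0
    have "(\<integral>\<^sup>+ y. h 0 y \<partial>init F) = ennreal \<gamma>1"
      using bounded_measurable_integrable[OF h_bm[of 0] fk_init[OF F]] fk_init[OF F] h_pos[of 0]
        sets_eq_imp_space_eq[of "init F" "state F 0"]
      by (intro nn_integral_eq_integral) (auto intro!: AE_I2 simp: space_prob_algebra less_imp_le)
    moreover have "(\<lambda>y. ennreal (h 0 y)) \<in> borel_measurable (state F 0)" using h_measurable[of 0] by simp
    ultimately show ?case by (simp add: nn_gamma_0[OF F])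
  next
    case (Suc k)
    have "(\<lambda>y. ennreal (h (Suc k) y)) \<in> borel_measurable (state F (Suc k))" using h_measurable[OF Suc.prems] by simp
    then have "nn_gamma F (Suc k) (\<lambda>y. ennreal (h (Suc k) y)) = nn_gamma F k (nn_step F k (\<lambda>y. ennreal (h (Suc k) y)))"
      by (rule nn_gamma_Suc[OF F])
    also have "\<dots> = nn_gamma F k (\<lambda>y. ennreal (h k y))"
      using Suc.prems by (intro nn_gamma_cong[OF F] ennreal_h_step[symmetric]) auto
    finally show ?case using Suc by simp
  qed
  from this[of n] show ?thesis by (simp add: h_top)
qed

lemma gamma1_pos: "0 < \<gamma>1"
  by (rule integral_pos_prob[OF h_bm fk_init[OF F] h_pos]) auto

lemma gamma_frozen_upper: "nn_gamma Fz n (\<lambda>_. 1) \<le> ennreal ((1 + r / N) ^ Suc n) * ennreal \<gamma>1"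
proof -
  let ?c = "1 + r / N"
  have c: "0 \<le> ?c" using r_ge_1 by simp
  have "k \<le> n \<Longrightarrow> nn_gamma Fz k (\<lambda>y. ennreal (h k y)) \<le> ennreal (?c ^ Suc k) * nn_gamma F k (\<lambda>y. ennreal (h k y))" for k
  proof (induction k)
    case 0
    have "(\<lambda>y. ennreal (h 0 y)) \<in> borel_measurable (state F 0)" using h_measurable[of 0] by simp
    then show ?case using frozen_mixture_h_le[of 0 "init F"] fk_init[OF F] by (simp add: nn_gamma_0[OF F] nn_gamma_0[OF Fz])
  next
    case (Suc k)
    have m: "(\<lambda>y. ennreal (h (Suc k) y)) \<in> borel_measurable (state F (Suc k))" using h_measurable[OF Suc.prems] by simp
    have mk: "(\<lambda>y. ennreal (h k y)) \<in> borel_measurable (state F k)" using h_measurable[of k] Suc.prems by simp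
    have "nn_gamma Fz (Suc k) (\<lambda>y. ennreal (h (Suc k) y)) = nn_gamma Fz k (nn_step Fz k (\<lambda>y. ennreal (h (Suc k) y)))"
      using m by (intro nn_gamma_Suc[OF Fz]) simp
    also have "\<dots> \<le> nn_gamma Fz k (\<lambda>y. ennreal ?c * ennreal (h k y))"
    proof (rule nn_gamma_mono[OF Fz])
      fix x assume "x \<in> space (state Fz k)"
      then have x: "x \<in> space (state F k)" by simp
      have "nn_step Fz k (\<lambda>y. ennreal (h (Suc k) y)) x
        \<le> ennreal (pot F k x) * (ennreal ?c * (\<integral>\<^sup>+ y. h (Suc k) y \<partial>mkernel F (Suc k) x))"
        unfolding nn_step_def using frozen_mixture_h_le[OF Suc.prems fk_mkernel_in[OF F x]]
        by (simp add: mult_left_mono)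
      also have "\<dots> = ennreal ?c * ennreal (h k x)"
        using Suc.prems x by (simp add: ennreal_h_step nn_step_def mult.left_commute)
      finally show "nn_step Fz k (\<lambda>y. ennreal (h (Suc k) y)) x \<le> ennreal ?c * ennreal (h k x)" .
    qed
    also have "\<dots> = ennreal ?c * nn_gamma Fz k (\<lambda>y. ennreal (h k y))"
      using mk by (intro nn_gamma_cmult[OF Fz]) simp
    also have "\<dots> \<le> ennreal ?c * (ennreal (?c ^ Suc k) * nn_gamma F k (\<lambda>y. ennreal (h k y)))"
      using Suc by (intro mult_left_mono) auto
    also have "nn_gamma F k (\<lambda>y. ennreal (h k y)) = nn_gamma F (Suc k) (\<lambda>y. ennreal (h (Suc k) y))"
      unfolding nn_gamma_Suc[OF F m] using Suc.prems by (intro nn_gamma_cong[OF F] ennreal_h_step) auto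
    finally show ?case using c by (simp add: ennreal_mult mult.assoc)
  qed
  from this[of n] show ?thesis using gamma1_eq by (simp add: h_top)
qed

text \<open>
  Keep the trajectories that never jump to the frozen path.
\<close>

lemma nn_step_frozen_ge:
  assumes v: "v \<in> space (state F k)" and \<phi>: "\<phi> \<in> borel_measurable (state F (Suc k))"
  shows "ennreal (1 - 1 / N) * nn_step F k \<phi> v \<le> nn_step Fz k \<phi> v"
proof -
  have "ennreal (1 - 1 / N) * (\<integral>\<^sup>+ y. \<phi> y \<partial>mkernel F (Suc k) v) \<le> (\<integral>\<^sup>+ y. \<phi> y \<partial>mkernel Fz (Suc k) v)"
    by (simp add: nn_integral_frozen_mixture[OF N1 z fk_mkernel_in[OF F v] \<phi>])
  then show ?thesis
    unfolding nn_step_def mult.left_commute[of "ennreal (1 - 1 / N)"] frozen_model_sel by (intro mult_left_mono) auto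
qed

lemma gamma_frozen_lower:
  "g \<in> borel_measurable (state F k) \<Longrightarrow> ennreal ((1 - 1 / N) ^ Suc k) * nn_gamma F k g \<le> nn_gamma Fz k g"
proof (induction k arbitrary: g)
  case 0
  then show ?case using nn_integral_frozen_mixture[OF N1 z fk_init[OF F] 0]
    by (simp add: nn_gamma_0[OF F] nn_gamma_0[OF Fz])
next
  case (Suc k)
  let ?c = "1 - 1 / real N"
  have c: "0 \<le> ?c" using N by simp
  have mF: "nn_step F k g \<in> borel_measurable (state F k)" by (rule measurable_nn_step[OF F Suc.prems])
  have "ennreal (?c ^ Suc (Suc k)) * nn_gamma F (Suc k) g = ennreal ?c * (ennreal (?c ^ Suc k) * nn_gamma F k (nn_step F k g))"
    using c by (simp add: nn_gamma_Suc[OF F Suc.prems] ennreal_mult mult.assoc)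
  also have "\<dots> \<le> ennreal ?c * nn_gamma Fz k (nn_step F k g)"
    by (intro mult_left_mono Suc.IH mF) auto
  also have "\<dots> = nn_gamma Fz k (\<lambda>x. ennreal ?c * nn_step F k g x)"
    using mF by (intro nn_gamma_cmult[OF Fz, symmetric]) simp
  also have "\<dots> \<le> nn_gamma Fz k (nn_step Fz k g)"
  proof (rule nn_gamma_mono[OF Fz])
    fix x assume "x \<in> space (state Fz k)"
    then have x: "x \<in> space (state F k)" by simp
    show "ennreal ?c * nn_step F k g x \<le> nn_step Fz k g x" by (rule nn_step_frozen_ge[OF x Suc.prems])
  qed
  also have "\<dots> = nn_gamma Fz (Suc k) g"
    using Suc.prems by (intro nn_gamma_Suc[OF Fz, symmetric]) simp
  finally show ?case .
qed

end

section \<open>The backward kernel on empirical measures\<close>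

text \<open>
  The integral of \<open>g\<close> under the backward kernel from the terminal state \<open>u\<close>, as nested sums over ancestor
  indices: the ancestor \<open>x k i\<close> is chosen with probability proportional to \<open>H(x k i, u)\<close>. If
  all these densities vanish, the terms are zero because division by zero is zero, in agreement
  with the convention for the kernel.
\<close>

primrec backward_sum :: "(nat \<Rightarrow> 'a \<Rightarrow> 'a \<Rightarrow> real) \<Rightarrow> nat \<Rightarrow> (nat \<Rightarrow> nat \<Rightarrow> 'a) \<Rightarrow> nat \<Rightarrow> ((nat \<Rightarrow> 'a) \<Rightarrow> ennreal) \<Rightarrow> 'a \<Rightarrow> ennreal" where
  "backward_sum H N x 0 g u = g (\<lambda>j\<in>{..0}. u)"
| "backward_sum H N x (Suc k) g u =
    (\<Sum>i<N. ennreal (H (Suc k) (x k i) u / (\<Sum>l<N. H (Suc k) (x k l) u)) *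
      backward_sum H N x k (\<lambda>w. g (w(Suc k := u))) (x k i))"

lemma backward_sum_cong_particles:
  "(\<And>j. j < k \<Longrightarrow> x j = x' j) \<Longrightarrow> backward_sum H N x k g u = backward_sum H N x' k g u"
proof (induction k arbitrary: g u)
  case (Suc k)
  have "backward_sum H N x k g u = backward_sum H N x' k g u" for g u using Suc.prems by (intro Suc.IH) simp
  then show ?case using Suc.prems[of k] by simp
qed simp

lemma backward_sum_cmult: "backward_sum H N x k (\<lambda>w. c * g w) u = c * backward_sum H N x k g u"
  by (induction k arbitrary: g u) (simp_all add: sum_distrib_left mult.left_commute)

text \<open>
  The density of the backward kernel with its integrals written as averages over particles.
\<close>

definition backward_weight :: "(nat \<Rightarrow> 'a \<Rightarrow> 'a \<Rightarrow> real) \<Rightarrow> nat \<Rightarrow> (nat \<Rightarrow> nat \<Rightarrow> 'a) \<Rightarrow> nat \<Rightarrow> (nat \<Rightarrow> 'a) \<Rightarrow> ennreal" where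
  "backward_weight H N x k y = (\<Prod>j<k. ennreal (H (Suc j) (y j) (y (Suc j)) / ((\<Sum>l<N. H (Suc j) (x j l) (y (Suc j))) / N)))"

lemma nn_integral_PiM_last:
  fixes E :: "nat \<Rightarrow> 'a measure"
  assumes E: "\<And>j. E j \<in> space (prob_algebra (S j))" and \<phi>: "\<phi> \<in> borel_measurable (PiM {..k} S)"
  shows "(\<integral>\<^sup>+ y. \<phi> y \<partial>PiM {..k} E) = (\<integral>\<^sup>+ w. \<integral>\<^sup>+ v. \<phi> (w(k := v)) \<partial>E k \<partial>PiM {..<k} E)"
proof -
  interpret E: product_prob_space E by (rule product_prob_spaceI) (use E in \<open>auto simp: space_prob_algebra\<close>)
  have s: "sets (PiM {..k} E) = sets (PiM {..k} S)"
    using E by (intro sets_PiM_cong) (auto simp: space_prob_algebra)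
  have "{..k} = insert k {..<k}" by auto
  moreover have "\<phi> \<in> borel_measurable (PiM {..k} E)" using \<phi> by (simp add: measurable_cong_sets[OF s refl])
  ultimately show ?thesis by (simp add: E.product_nn_integral_insert)
qed

lemma measurable_fun_upd_last:
  assumes "w \<in> space (PiM {..<k::nat} S)"
  shows "(\<lambda>v. w(k := v)) \<in> S k \<rightarrow>\<^sub>M PiM {..k} S"
proof -
  have "insert k {..<k} = {..k}" by auto
  then show ?thesis
    using measurable_compose[OF measurable_Pair1'[OF assms] measurable_add_dim[of k "{..<k}" S]] by simp
qed

lemma measurable_fun_upd_last2:
  assumes "v \<in> space (S k)"
  shows "(\<lambda>w. w(k := v)) \<in> PiM {..<k::nat} S \<rightarrow>\<^sub>M PiM {..k} S"
proof -
  have "insert k {..<k} = {..k}" by auto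
  then show ?thesis
    using measurable_compose[OF measurable_Pair2'[OF assms] measurable_add_dim[of k "{..<k}" S]] by simp
qed

locale backward_model =
  fixes F :: "'a fk_model" and H :: "nat \<Rightarrow> 'a \<Rightarrow> 'a \<Rightarrow> real" and \<nu> :: "nat \<Rightarrow> 'a measure" and N :: nat
  assumes F: "is_fk_model F" and H: "backward_density F H \<nu>" and N1: "N \<ge> 1"
begin

lemma H_measurable: "(\<lambda>(x, y). H (Suc k) x y) \<in> borel_measurable (state F k \<Otimes>\<^sub>M state F (Suc k))"
  and H_nonneg: "x \<in> space (state F k) \<Longrightarrow> y \<in> space (state F (Suc k)) \<Longrightarrow> 0 \<le> H (Suc k) x y"
  and sets_\<nu>: "sets (\<nu> (Suc k)) = sets (state F (Suc k))"
  and H_density: "x \<in> space (state F k) \<Longrightarrow> scale_measure (ennreal (pot F k x)) (mkernel F (Suc k) x) =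
           density (\<nu> (Suc k)) (\<lambda>y. ennreal (H (Suc k) x y))"
  using H by (auto simp: backward_density_def)

lemma H_measurable2:
  assumes "a \<in> R \<rightarrow>\<^sub>M state F k" "b \<in> R \<rightarrow>\<^sub>M state F (Suc k)"
  shows "(\<lambda>r. H (Suc k) (a r) (b r)) \<in> borel_measurable R"
  using measurable_compose[OF measurable_Pair[OF assms] H_measurable] by simp

text \<open>
  The induction peels off the last state of the path, which then becomes a parameter of the functional.
  Hence the functional, the particles and the terminal state all depend on a common parameter \<open>r\<close>.
\<close>

lemma backward_sum_measurable:
  assumes f: "(\<lambda>(r, w). f r w) \<in> borel_measurable (R \<Otimes>\<^sub>M path_space F k)"
    and X: "\<And>j. j < k \<Longrightarrow> X j \<in> R \<rightarrow>\<^sub>M particle_space N F j"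
    and W: "W \<in> R \<rightarrow>\<^sub>M state F k"
  shows "(\<lambda>r. backward_sum H N (\<lambda>j. X j r) k (f r) (W r)) \<in> borel_measurable R"
  using f X W
proof (induction k arbitrary: f W)
  case 0
  have "(\<lambda>r. \<lambda>j\<in>{..0}. W r) \<in> R \<rightarrow>\<^sub>M path_space F 0"
    using "0.prems"(3) by (intro measurable_restrict) auto
  from measurable_compose[OF measurable_Pair[OF measurable_ident_sets[OF refl] this] "0.prems"(1)]
  show ?case by simp
next
  case (Suc k)
  have Xi: "(\<lambda>r. X k r i) \<in> R \<rightarrow>\<^sub>M state F k" if "i < N" for i
    using that by (intro measurable_compose[OF Suc.prems(2)[of k] measurable_component_singleton]) auto
  have f': "(\<lambda>(r, w). f r (w(Suc k := W r))) \<in> borel_measurable (R \<Otimes>\<^sub>M path_space F k)"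
  proof -
    have "(\<lambda>p. (snd p, W (fst p))) \<in> R \<Otimes>\<^sub>M path_space F k \<rightarrow>\<^sub>M path_space F k \<Otimes>\<^sub>M state F (Suc k)"
      by (intro measurable_Pair measurable_snd measurable_compose[OF measurable_fst Suc.prems(3)])
    from measurable_compose[OF this measurable_path_extend]
    have "(\<lambda>p. (snd p)(Suc k := W (fst p))) \<in> R \<Otimes>\<^sub>M path_space F k \<rightarrow>\<^sub>M path_space F (Suc k)" by simp
    from measurable_compose[OF measurable_Pair[OF measurable_fst this] Suc.prems(1)]
    show ?thesis by (simp add: case_prod_beta')
  qed
  have "(\<lambda>r. backward_sum H N (\<lambda>j. X j r) k (\<lambda>w. f r (w(Suc k := W r))) (X k r i)) \<in> borel_measurable R" if "i < N" for i
    using Suc.prems(2) by (intro Suc.IH f' Xi that) auto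
  moreover have "(\<lambda>r. ennreal (H (Suc k) (X k r i) (W r) / (\<Sum>l<N. H (Suc k) (X k r l) (W r)))) \<in> borel_measurable R" if "i < N" for i
    using that by (intro measurable_compose[OF _ measurable_ennreal] borel_measurable_divide borel_measurable_sum H_measurable2 Xi Suc.prems(3)) auto
  ultimately show ?case by (auto intro!: borel_measurable_sum borel_measurable_times_ennreal)
qed

lemma backward_sum_measurable_state:
  assumes g: "g \<in> borel_measurable (path_space F k)"
    and x: "\<And>j. j < k \<Longrightarrow> x j \<in> space (particle_space N F j)"
  shows "backward_sum H N x k g \<in> borel_measurable (state F k)"
  using g by (intro backward_sum_measurable[where X="\<lambda>j _. x j" and f="\<lambda>_. g" and W="\<lambda>u. u"])
    (auto intro!: x measurable_const measurable_compose[OF measurable_snd] simp: case_prod_beta')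

context
  fixes x :: "nat \<Rightarrow> nat \<Rightarrow> 'a" and K :: nat
  assumes x: "\<And>j. j < K \<Longrightarrow> x j \<in> space (particle_space N F j)"
begin

lemma part_in: "j < K \<Longrightarrow> i < N \<Longrightarrow> x j i \<in> space (state F j)"
  by (rule particle_in[OF N1 x])

text \<open>
  Backward paths end at the given terminal state, so the functional matters on such paths only.
\<close>

lemma backward_sum_cong:
  assumes "k \<le> K" "u \<in> space (state F k)"
    and "\<And>w. w \<in> space (path_space F k) \<Longrightarrow> w k = u \<Longrightarrow> g w = g' w"
  shows "backward_sum H N x k g u = backward_sum H N x k g' u"
  using assms
proof (induction k arbitrary: g g' u)
  case 0
  then show ?case by (auto simp: space_PiM)
next
  case (Suc k)
  have "backward_sum H N x k (\<lambda>w. g (w(Suc k := u))) (x k i) = backward_sum H N x k (\<lambda>w. g' (w(Suc k := u))) (x k i)"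
    if "i < N" for i
    using Suc.prems that by (intro Suc.IH part_in Suc.prems(3) path_extend_in_space) auto
  then show ?case by simp
qed

lemma backward_sum_le:
  assumes "k \<le> K" "u \<in> space (state F k)"
    and "\<And>w. w \<in> space (path_space F k) \<Longrightarrow> g w \<le> c"
  shows "backward_sum H N x k g u \<le> c"
  using assms
proof (induction k arbitrary: g u)
  case 0
  then show ?case by (auto simp: space_PiM)
next
  case (Suc k)
  let ?H = "\<lambda>i. H (Suc k) (x k i) u"
  have nn: "0 \<le> ?H i" if "i < N" for i using Suc.prems that by (intro H_nonneg part_in) auto
  have "backward_sum H N x (Suc k) g u \<le> (\<Sum>i<N. ennreal (?H i / (\<Sum>l<N. ?H l)) * c)"
    unfolding backward_sum.simps using Suc.prems
    by (intro sum_mono mult_left_mono Suc.IH part_in Suc.prems(3) path_extend_in_space) auto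
  also have "\<dots> = ennreal (\<Sum>i<N. ?H i / (\<Sum>l<N. ?H l)) * c"
    using nn by (subst sum_ennreal[symmetric]) (auto simp: sum_distrib_right intro!: divide_nonneg_nonneg sum_nonneg)
  also have "\<dots> \<le> ennreal 1 * c"
    by (intro mult_right_mono ennreal_leI) (auto simp: sum_divide_distrib[symmetric])
  finally show ?case by simp
qed

lemma backward_sum_nn_integral:
  assumes "k \<le> K" "u \<in> space (state F k)" "sigma_finite_measure M"
    and "(\<lambda>(y, w). f w y) \<in> borel_measurable (M \<Otimes>\<^sub>M path_space F k)"
  shows "backward_sum H N x k (\<lambda>w. \<integral>\<^sup>+ y. f w y \<partial>M) u = (\<integral>\<^sup>+ y. backward_sum H N x k (\<lambda>w. f w y) u \<partial>M)"
  using assms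
proof (induction k arbitrary: f u)
  case 0
  then show ?case by simp
next
  case (Suc k)
  let ?f = "\<lambda>w y. f (w(Suc k := u)) y"
  have f': "(\<lambda>(y, w). ?f w y) \<in> borel_measurable (M \<Otimes>\<^sub>M path_space F k)"
  proof -
    have "(\<lambda>p. (fst p, (snd p)(Suc k := u))) \<in> M \<Otimes>\<^sub>M path_space F k \<rightarrow>\<^sub>M M \<Otimes>\<^sub>M path_space F (Suc k)"
    proof (intro measurable_Pair measurable_fst)
      have "(\<lambda>p. (snd p, u)) \<in> M \<Otimes>\<^sub>M path_space F k \<rightarrow>\<^sub>M path_space F k \<Otimes>\<^sub>M state F (Suc k)"
        using Suc.prems(2) by (intro measurable_Pair measurable_snd) simp
      from measurable_compose[OF this measurable_path_extend]
      show "(\<lambda>p. (snd p)(Suc k := u)) \<in> M \<Otimes>\<^sub>M path_space F k \<rightarrow>\<^sub>M path_space F (Suc k)" by simp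
    qed
    from measurable_compose[OF this Suc.prems(4)] show ?thesis by (simp add: case_prod_beta')
  qed
  let ?c = "\<lambda>i. ennreal (H (Suc k) (x k i) u / (\<Sum>l<N. H (Suc k) (x k l) u))"
  have IH: "backward_sum H N x k (\<lambda>w. \<integral>\<^sup>+ y. ?f w y \<partial>M) (x k i) = (\<integral>\<^sup>+ y. backward_sum H N x k (\<lambda>w. ?f w y) (x k i) \<partial>M)"
    if "i < N" for i
    using Suc.prems that by (intro Suc.IH part_in f') auto
  have m: "(\<lambda>y. backward_sum H N x k (\<lambda>w. ?f w y) (x k i)) \<in> borel_measurable M" if "i < N" for i
    using Suc.prems(1) that f'
    by (intro backward_sum_measurable[where X="\<lambda>j _. x j" and W="\<lambda>_. x k i" and f="\<lambda>y w. ?f w y"])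
      (auto intro!: x part_in measurable_const)
  have "(\<integral>\<^sup>+ y. backward_sum H N x (Suc k) (\<lambda>w. f w y) u \<partial>M)
      = (\<Sum>i<N. \<integral>\<^sup>+ y. ?c i * backward_sum H N x k (\<lambda>w. ?f w y) (x k i) \<partial>M)"
    unfolding backward_sum.simps using m by (intro nn_integral_sum) auto
  also have "\<dots> = (\<Sum>i<N. ?c i * (\<integral>\<^sup>+ y. backward_sum H N x k (\<lambda>w. ?f w y) (x k i) \<partial>M))"
    using m by (intro sum.cong refl nn_integral_cmult) auto
  finally show ?case by (simp add: IH)
qed

abbreviation "emp j \<equiv> empirical N (state F j) (x j)"

lemma measurable_backward_weight:
  "k \<le> K \<Longrightarrow> backward_weight H N x k \<in> borel_measurable (path_space F k)"
  unfolding backward_weight_def[abs_def]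
proof (intro borel_measurable_prod_ennreal measurable_compose[OF _ measurable_ennreal] borel_measurable_divide borel_measurable_sum borel_measurable_const)
  fix j assume k: "k \<le> K" and "j \<in> {..<k}"
  then have j: "j < k" by simp
  have c: "(\<lambda>y. y j) \<in> path_space F k \<rightarrow>\<^sub>M state F j" "(\<lambda>y. y (Suc j)) \<in> path_space F k \<rightarrow>\<^sub>M state F (Suc j)"
    using j by (auto intro!: measurable_component_singleton)
  show "(\<lambda>y. H (Suc j) (y j) (y (Suc j))) \<in> borel_measurable (path_space F k)"
    by (intro H_measurable2 c)
  fix l assume "l \<in> {..<N}"
  then show "(\<lambda>y. H (Suc j) (x j l) (y (Suc j))) \<in> borel_measurable (path_space F k)"
    using j k by (intro H_measurable2 c measurable_const part_in) auto
qed

lemma emp_in: "j < K \<Longrightarrow> emp j \<in> space (prob_algebra (state F j))"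
  by (rule empirical_in_prob_algebra[OF N1 x])

text \<open>
  The last factor of the product measure is a Dirac mass; integrating it out pins the terminal state.
\<close>

lemma nn_integral_backward_kernel_weight:
  assumes k: "k \<le> K" and u: "u \<in> space (state F k)" and g: "g \<in> borel_measurable (path_space F k)"
  shows "(\<integral>\<^sup>+ y. g y \<partial>backward_kernel F H k emp u)
    = (\<integral>\<^sup>+ w. g (w(k := u)) * backward_weight H N x k (w(k := u)) \<partial>PiM {..<k} emp)"
proof -
  \<comment> \<open>product integrals require probability measures at every index, hence also outside the horizon\<close>
  define D where "D j = (if j < k then emp j else if j = k then return (state F k) u else return (state F j) (SOME v. v \<in> space (state F j)))" for j
  have D: "D j \<in> space (prob_algebra (state F j))" for j
    using k u emp_in fk_state_nonempty[OF F, of j] by (auto simp: D_def intro!: return_in_prob_algebra some_in_eq[THEN iffD2])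
  have PD: "PiM {..k} (\<lambda>j. if j < k then emp j else return (state F k) u) = PiM {..k} D"
    by (intro PiM_cong) (auto simp: D_def)
  have s: "sets (PiM {..k} D) = sets (path_space F k)"
    using D by (intro sets_PiM_cong) (auto simp: space_prob_algebra)
  note sp = sets_eq_imp_space_eq[OF s]
  let ?w = "\<lambda>y. \<Prod>j<k. ennreal (H (Suc j) (y j) (y (Suc j)) / (\<integral>v. H (Suc j) v (y (Suc j)) \<partial>emp j))"
  have w_eq: "?w y = backward_weight H N x k y" if y: "y \<in> space (path_space F k)" for y
    unfolding backward_weight_def
  proof (intro prod.cong refl)
    fix j assume "j \<in> {..<k}"
    then have j: "j < k" by simp
    then have "y (Suc j) \<in> space (state F (Suc j))" using y by (auto simp: space_PiM PiE_iff)
    then have "(\<lambda>v. H (Suc j) v (y (Suc j))) \<in> borel_measurable (state F j)"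
      by (intro H_measurable2) auto
    from integral_empirical[OF N1 x this] j k
    show "ennreal (H (Suc j) (y j) (y (Suc j)) / (\<integral>v. H (Suc j) v (y (Suc j)) \<partial>emp j))
      = ennreal (H (Suc j) (y j) (y (Suc j)) / ((\<Sum>l<N. H (Suc j) (x j l) (y (Suc j))) / N))" by simp
  qed
  have wm: "backward_weight H N x k \<in> borel_measurable (PiM {..k} D)"
    using measurable_backward_weight[OF k] by (simp add: measurable_cong_sets[OF s refl])
  have "?w \<in> borel_measurable (PiM {..k} D)"
    using wm by (subst measurable_cong[OF w_eq]) (auto simp: sp)
  then have "(\<integral>\<^sup>+ y. g y \<partial>backward_kernel F H k emp u) = (\<integral>\<^sup>+ y. ?w y * g y \<partial>PiM {..k} D)"
    unfolding backward_kernel_def PD using g by (intro nn_integral_density) (auto simp: measurable_cong_sets[OF s refl])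
  also have "\<dots> = (\<integral>\<^sup>+ y. g y * backward_weight H N x k y \<partial>PiM {..k} D)"
    by (intro nn_integral_cong) (simp add: sp w_eq mult.commute)
  also have "\<dots> = (\<integral>\<^sup>+ w. \<integral>\<^sup>+ v. g (w(k := v)) * backward_weight H N x k (w(k := v)) \<partial>D k \<partial>PiM {..<k} D)"
    using g measurable_backward_weight[OF k] by (intro nn_integral_PiM_last[OF D]) auto
  also have "\<dots> = (\<integral>\<^sup>+ w. g (w(k := u)) * backward_weight H N x k (w(k := u)) \<partial>PiM {..<k} D)"
  proof (intro nn_integral_cong)
    fix w assume "w \<in> space (PiM {..<k} D)"
    moreover have "sets (PiM {..<k} D) = sets (PiM {..<k} (state F))"
      using D by (intro sets_PiM_cong) (auto simp: space_prob_algebra)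
    ultimately have w: "w \<in> space (PiM {..<k} (state F))" using sets_eq_imp_space_eq by blast
    have "(\<lambda>v. w(k := v)) \<in> state F k \<rightarrow>\<^sub>M path_space F k" by (rule measurable_fun_upd_last[OF w])
    from measurable_compose[OF this, of "\<lambda>y. g y * backward_weight H N x k y" borel] g measurable_backward_weight[OF k]
    have "(\<lambda>v. g (w(k := v)) * backward_weight H N x k (w(k := v))) \<in> borel_measurable (state F k)" by simp
    from nn_integral_return[OF u this]
    show "(\<integral>\<^sup>+ v. g (w(k := v)) * backward_weight H N x k (w(k := v)) \<partial>D k) = g (w(k := u)) * backward_weight H N x k (w(k := u))"
      by (simp add: D_def)
  qed
  also have "PiM {..<k} D = PiM {..<k} emp" by (intro PiM_cong) (auto simp: D_def)
  finally show ?thesis .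
qed

text \<open>
  Integrating out the state at time \<open>k\<close> against the empirical measure produces the sum over ancestors;
  what remains is the backward kernel that starts from the chosen ancestor.
\<close>

lemma nn_integral_backward_kernel:
  "k \<le> K \<Longrightarrow> u \<in> space (state F k) \<Longrightarrow> g \<in> borel_measurable (path_space F k) \<Longrightarrow>
    (\<integral>\<^sup>+ y. g y \<partial>backward_kernel F H k emp u) = backward_sum H N x k g u"
proof (induction k arbitrary: g u)
  case 0
  have "(\<lambda>_. undefined)(0 := u) = (\<lambda>j\<in>{..0::nat}. u)" by (auto simp: fun_eq_iff)
  then show ?case
    by (subst nn_integral_backward_kernel_weight[OF 0]) (simp add: nn_integral_empty backward_weight_def PiM_empty nn_integral_count_space_finite)
next
  case (Suc k)
  define D where "D j = (if j < Suc k then emp j else return (state F j) (SOME v. v \<in> space (state F j)))" for j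
  have D: "D j \<in> space (prob_algebra (state F j))" for j
    using Suc.prems(1) emp_in fk_state_nonempty[OF F, of j] by (auto simp: D_def intro!: return_in_prob_algebra some_in_eq[THEN iffD2])
  have sD: "sets (PiM {..<k} D) = sets (PiM {..<k} (state F))" "space (PiM {..<k} D) = space (PiM {..<k} (state F))"
    using D by (auto intro!: sets_PiM_cong sets_eq_imp_space_eq simp: space_prob_algebra)
  let ?g = "\<lambda>w. g (w(Suc k := u))"
  let ?gw = "\<lambda>i w. ?g (w(k := x k i)) * backward_weight H N x k (w(k := x k i))"
  let ?rat = "\<lambda>v. ennreal (H (Suc k) v u / ((\<Sum>l<N. H (Suc k) (x k l) u) / N))"
  have ext: "(\<lambda>w. w(Suc k := u)) \<in> path_space F k \<rightarrow>\<^sub>M path_space F (Suc k)"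
    using measurable_compose[OF measurable_Pair2'[OF Suc.prems(2), of "path_space F k"] measurable_path_extend] by simp
  have gm: "?g \<in> borel_measurable (path_space F k)" by (rule measurable_compose[OF ext Suc.prems(3)])
  have weight_Suc: "backward_weight H N x (Suc k) (w(Suc k := u)) = backward_weight H N x k w * ?rat (w k)" for w
  proof -
    have "backward_weight H N x k (w(Suc k := u)) = backward_weight H N x k w"
      unfolding backward_weight_def by (intro prod.cong refl) auto
    then show ?thesis by (simp add: backward_weight_def)
  qed
  have ratm: "?rat \<in> borel_measurable (state F k)"
    using Suc.prems(2) by (intro measurable_compose[OF _ measurable_ennreal] borel_measurable_divide H_measurable2) auto
  have wm: "backward_weight H N x k \<in> borel_measurable (path_space F k)"
    using Suc.prems by (intro measurable_backward_weight) simp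
  have "(\<integral>\<^sup>+ y. g y \<partial>backward_kernel F H (Suc k) emp u)
      = (\<integral>\<^sup>+ w. ?g w * (backward_weight H N x k w * ?rat (w k)) \<partial>PiM {..<Suc k} emp)"
    by (simp only: nn_integral_backward_kernel_weight[OF Suc.prems] weight_Suc)
  also have "PiM {..<Suc k} emp = PiM {..k} D" by (intro PiM_cong) (auto simp: D_def)
  also have "(\<integral>\<^sup>+ w. ?g w * (backward_weight H N x k w * ?rat (w k)) \<partial>PiM {..k} D)
    = (\<integral>\<^sup>+ w. \<integral>\<^sup>+ v. ?g (w(k := v)) * (backward_weight H N x k (w(k := v)) * ?rat ((w(k := v)) k)) \<partial>D k \<partial>PiM {..<k} D)"
    using gm wm measurable_compose[OF measurable_component_singleton[of k "{..k}" "state F"] ratm]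
    by (intro nn_integral_PiM_last[OF D]) auto
  also have "\<dots> = (\<integral>\<^sup>+ w. (\<Sum>i<N. ennreal (1 / N) * ?rat (x k i) * (?gw i w)) \<partial>PiM {..<k} D)"
  proof (rule nn_integral_cong)
    fix w assume "w \<in> space (PiM {..<k} D)"
    then have w: "w \<in> space (PiM {..<k} (state F))" by (simp add: sD)
    note upd = measurable_fun_upd_last[OF w]
    have "(\<lambda>v. ?g (w(k := v)) * (backward_weight H N x k (w(k := v)) * ?rat v)) \<in> borel_measurable (state F k)"
      by (intro borel_measurable_times_ennreal measurable_compose[OF upd gm] measurable_compose[OF upd wm] ratm)
    from nn_integral_empirical[OF N1 x this] Suc.prems(1)
    show "(\<integral>\<^sup>+ v. ?g (w(k := v)) * (backward_weight H N x k (w(k := v)) * ?rat ((w(k := v)) k)) \<partial>D k)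
      = (\<Sum>i<N. ennreal (1 / N) * ?rat (x k i) * (?gw i w))"
      by (simp add: D_def mult_ac)
  qed
  also have "\<dots> = (\<Sum>i<N. ennreal (1 / N) * ?rat (x k i) * (\<integral>\<^sup>+ w. ?gw i w \<partial>PiM {..<k} D))"
  proof -
    have m: "(\<lambda>w. ?gw i w) \<in> borel_measurable (PiM {..<k} D)" if "i < N" for i
    proof -
      note upd = measurable_fun_upd_last2[where S="state F" and k=k, OF part_in[OF Suc_le_lessD[OF Suc.prems(1)] that]]
      show ?thesis unfolding measurable_cong_sets[OF sD(1) refl]
        by (intro borel_measurable_times_ennreal measurable_compose[OF upd gm] measurable_compose[OF upd wm])
    qed
    show ?thesis
      using m by (subst nn_integral_sum) (auto intro!: sum.cong nn_integral_cmult)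
  qed
  also have "PiM {..<k} D = PiM {..<k} emp" by (intro PiM_cong) (auto simp: D_def)
  also have "(\<Sum>i<N. ennreal (1 / N) * ?rat (x k i) * (\<integral>\<^sup>+ w. ?gw i w \<partial>PiM {..<k} emp))
    = (\<Sum>i<N. ennreal (H (Suc k) (x k i) u / (\<Sum>l<N. H (Suc k) (x k l) u)) * backward_sum H N x k ?g (x k i))"
  proof (rule sum.cong[OF refl])
    fix i assume "i \<in> {..<N}"
    then have i: "i < N" by simp
    have k: "k \<le> K" "k < K" using Suc.prems(1) by auto
    have nn: "0 \<le> H (Suc k) (x k l) u" if "l < N" for l using k that Suc.prems(2) by (intro H_nonneg part_in) auto
    have "ennreal (1 / N) * ?rat (x k i) = ennreal (H (Suc k) (x k i) u / (\<Sum>l<N. H (Suc k) (x k l) u))"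
      using N1 nn[OF i] nn by (subst ennreal_mult[symmetric]) (auto intro!: divide_nonneg_nonneg mult_nonneg_nonneg sum_nonneg)
    moreover have "(\<integral>\<^sup>+ w. ?gw i w \<partial>PiM {..<k} emp) = backward_sum H N x k ?g (x k i)"
      by (rule trans[OF nn_integral_backward_kernel_weight[OF k(1) part_in[OF k(2) i] gm, symmetric]
        Suc.IH[OF k(1) part_in[OF k(2) i] gm]])
    ultimately show "ennreal (1 / N) * ?rat (x k i) * (\<integral>\<^sup>+ w. ?gw i w \<partial>PiM {..<k} emp)
      = ennreal (H (Suc k) (x k i) u / (\<Sum>l<N. H (Suc k) (x k l) u)) * backward_sum H N x k ?g (x k i)" by simp
  qed
  also have "\<dots> = backward_sum H N x (Suc k) g u" by simp
  finally show ?case .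
qed

end
end

section \<open>Backward sampling after a forward step\<close>

declare backward_sum.simps(2) [simp del]

lemma path_model_sel [simp]:
  "state (path_model F) n = path_space F n" "pot (path_model F) n w = pot F n (w n)"
  "init (path_model F) = path_init (state F) (init F)"
  "mkernel (path_model F) = path_kernel (state F) (mkernel F)"
  by (simp_all add: path_model_def)

lemma is_fk_model_path:
  assumes F: "is_fk_model F"
  shows "is_fk_model (path_model F)"
  unfolding is_fk_model_def path_model_sel(1,3,4)
proof (intro conjI allI ballI)
  show "path_init (state F) (init F) \<in> space (prob_algebra (path_space F 0))"
    by (rule path_init_in_prob_algebra(1)[where S="state F", OF fk_init[OF F]])
  fix k
  show "path_kernel (state F) (mkernel F) (Suc k) \<in> path_space F k \<rightarrow>\<^sub>M prob_algebra (path_space F (Suc k))"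
    by (rule measurable_path_kernel[where S="state F" and K="mkernel F", OF fk_mkernel[OF F]])
  show "pot (path_model F) k \<in> borel_measurable (path_space F k)"
    unfolding path_model_sel(2)[abs_def]
    by (rule measurable_compose[OF measurable_component_singleton[of k "{..k}" "state F"] fk_pot_measurable[OF F]]) simp
  have wk: "w k \<in> space (state F k)" if "w \<in> space (path_space F k)" for w
    using that by (auto simp: space_PiM)
  show "0 < pot (path_model F) k w" if "w \<in> space (path_space F k)" for w
    using fk_pot_pos[OF F wk[OF that]] by simp
  show "\<exists>B. \<forall>w\<in>space (path_space F k). pot (path_model F) k w \<le> B"
    using fk_pot_bounded[OF F, of k] wk by auto
qed

lemma nn_step_path_model:
  assumes F: "is_fk_model F" and w: "w \<in> space (path_space F k)" and g: "g \<in> borel_measurable (path_space F (Suc k))"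
  shows "nn_step (path_model F) k g w = ennreal (pot F k (w k)) * (\<integral>\<^sup>+ y. g (w(Suc k := y)) \<partial>mkernel F (Suc k) (w k))"
  unfolding nn_step_def
  by (simp add: nn_integral_path_kernel[where S="state F" and K="mkernel F" and k=k, OF fk_mkernel[OF F] w g])

context backward_model
begin

lemma nn_step_density:
  assumes v: "v \<in> space (state F k)" and \<phi>: "\<phi> \<in> borel_measurable (state F (Suc k))"
  shows "nn_step F k \<phi> v = (\<integral>\<^sup>+ y. ennreal (H (Suc k) v y) * \<phi> y \<partial>\<nu> (Suc k))"
proof -
  have "nn_step F k \<phi> v = (\<integral>\<^sup>+ y. \<phi> y \<partial>scale_measure (ennreal (pot F k v)) (mkernel F (Suc k) v))"
    using \<phi> fk_mkernel_sets[OF F v] by (simp add: nn_step_def nn_integral_scale_measure cong: measurable_cong_sets)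
  also have "\<dots> = (\<integral>\<^sup>+ y. \<phi> y \<partial>density (\<nu> (Suc k)) (\<lambda>y. ennreal (H (Suc k) v y)))"
    by (simp add: H_density[OF v])
  also have "\<dots> = (\<integral>\<^sup>+ y. ennreal (H (Suc k) v y) * \<phi> y \<partial>\<nu> (Suc k))"
    using \<phi> v by (intro nn_integral_density measurable_compose[OF _ measurable_ennreal] H_measurable2)
      (simp_all add: sets_\<nu> cong: measurable_cong_sets)
  finally show ?thesis .
qed

text \<open>
  Let \<open>u\<close> be a state of the next generation. In terms of \<open>\<nu>\<close>, the left-hand side integrates the backward
  functional at \<open>u\<close> against \<open>\<Sum>\<^sub>i H(x\<^sub>i, u)\<close>, which is precisely the denominator of the backward
  transition at \<open>u\<close>. What is left is \<open>\<Sum>\<^sub>i H(x\<^sub>i, u)\<close> times the functional started from \<open>x\<^sub>i\<close>, and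
  \<open>H(x\<^sub>i, u) \<nu>(du) = G(x\<^sub>i) M(x\<^sub>i, du)\<close> turns this into one step of the path model.
\<close>

lemma backward_sum_step:
  assumes x: "\<And>j. j < Suc k \<Longrightarrow> x j \<in> space (particle_space N F j)"
    and g: "g \<in> borel_measurable (path_space F (Suc k))"
  shows "(\<Sum>i<N. nn_step F k (backward_sum H N x (Suc k) g) (x k i))
    = (\<Sum>i<N. backward_sum H N x k (nn_step (path_model F) k g) (x k i))"
proof -
  let ?h = "\<lambda>i u. H (Suc k) (x k i) u"
  let ?B = "\<lambda>i u. backward_sum H N x k (\<lambda>w. g (w(Suc k := u))) (x k i)"
  have xi: "x k i \<in> space (state F k)" if "i < N" for i using part_in[OF x, of "Suc k"] that by simp
  have xk: "\<And>j. j < k \<Longrightarrow> x j \<in> space (particle_space N F j)" using x by simp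
  have gm: "(\<lambda>(u, w). g (w(Suc k := u))) \<in> borel_measurable (M \<Otimes>\<^sub>M path_space F k)"
    if M: "sets M = sets (state F (Suc k))" for M
  proof -
    have "(\<lambda>p. (snd p, fst p)) \<in> M \<Otimes>\<^sub>M path_space F k \<rightarrow>\<^sub>M path_space F k \<Otimes>\<^sub>M state F (Suc k)"
      using M by (intro measurable_Pair measurable_snd) (simp add: measurable_cong_sets[OF refl M[symmetric]])
    from measurable_compose[OF measurable_compose[OF this measurable_path_extend] g]
    show ?thesis by (simp add: case_prod_beta')
  qed
  have Bm: "?B i \<in> borel_measurable (state F (Suc k))" if "i < N" for i
    using gm[OF refl] xk xi[OF that]
    by (intro backward_sum_measurable[where X="\<lambda>j _. x j" and W="\<lambda>_. x k i" and f="\<lambda>u w. g (w(Suc k := u))"])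
      (auto intro!: measurable_const)
  have hm: "(\<lambda>u. ennreal (?h i u)) \<in> borel_measurable (state F (Suc k))" if "i < N" for i
    using xi[OF that] by (intro measurable_compose[OF _ measurable_ennreal] H_measurable2) auto
  have Sm: "backward_sum H N x (Suc k) g \<in> borel_measurable (state F (Suc k))"
    by (rule backward_sum_measurable_state[OF g x])
  have s: "sets (\<nu> (Suc k)) = sets (state F (Suc k))" by (rule sets_\<nu>)
  note sp = sets_eq_imp_space_eq[OF s]
  have "(\<Sum>i<N. nn_step F k (backward_sum H N x (Suc k) g) (x k i))
    = (\<Sum>i<N. \<integral>\<^sup>+ u. ennreal (?h i u) * backward_sum H N x (Suc k) g u \<partial>\<nu> (Suc k))"
    using xi by (intro sum.cong refl nn_step_density Sm) auto
  also have "\<dots> = (\<integral>\<^sup>+ u. (\<Sum>i<N. ennreal (?h i u) * backward_sum H N x (Suc k) g u) \<partial>\<nu> (Suc k))"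
    using hm Sm by (intro nn_integral_sum[symmetric]) (simp add: measurable_cong_sets[OF s refl])
  also have "\<dots> = (\<integral>\<^sup>+ u. (\<Sum>i<N. ennreal (?h i u) * ?B i u) \<partial>\<nu> (Suc k))"
  proof (rule nn_integral_cong)
    fix u assume "u \<in> space (\<nu> (Suc k))"
    then have u: "u \<in> space (state F (Suc k))" by (simp add: sp)
    have nn: "0 \<le> ?h i u" if "i < N" for i using H_nonneg[OF xi[OF that] u] .
    have "(\<Sum>i<N. ennreal (?h i u) * backward_sum H N x (Suc k) g u)
      = (\<Sum>i<N. ennreal (\<Sum>l<N. ?h l u) * ennreal (?h i u / (\<Sum>l<N. ?h l u)) * ?B i u)"
    proof -
      have "(\<Sum>i<N. ennreal (?h i u)) = ennreal (\<Sum>l<N. ?h l u)" using nn by (intro sum_ennreal) auto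
      then show ?thesis
        unfolding sum_distrib_right[symmetric] by (simp only: backward_sum.simps(2) sum_distrib_left mult.assoc)
    qed
    also have "\<dots> = (\<Sum>i<N. ennreal (?h i u) * ?B i u)"
    proof (intro sum.cong refl)
      fix i assume "i \<in> {..<N}"
      then have i: "i < N" by simp
      \<comment> \<open>a vanishing denominator is harmless: all numerators vanish with it\<close>
      have "(\<Sum>l<N. ?h l u) = 0 \<Longrightarrow> ?h i u = 0"
        using sum_nonneg_eq_0_iff[of "{..<N}" "\<lambda>l. ?h l u"] nn i by auto
      then have "(\<Sum>l<N. ?h l u) * (?h i u / (\<Sum>l<N. ?h l u)) = ?h i u" by auto
      then show "ennreal (\<Sum>l<N. ?h l u) * ennreal (?h i u / (\<Sum>l<N. ?h l u)) * ?B i u = ennreal (?h i u) * ?B i u"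
        using nn i by (subst ennreal_mult[symmetric]) (auto intro!: sum_nonneg divide_nonneg_nonneg)
    qed
    finally show "(\<Sum>i<N. ennreal (?h i u) * backward_sum H N x (Suc k) g u) = (\<Sum>i<N. ennreal (?h i u) * ?B i u)" .
  qed
  also have "\<dots> = (\<Sum>i<N. \<integral>\<^sup>+ u. ennreal (?h i u) * ?B i u \<partial>\<nu> (Suc k))"
    using hm Bm by (intro nn_integral_sum) (simp add: measurable_cong_sets[OF s refl])
  also have "\<dots> = (\<Sum>i<N. nn_step F k (?B i) (x k i))"
    using xi Bm by (intro sum.cong refl nn_step_density[symmetric]) auto
  also have "\<dots> = (\<Sum>i<N. backward_sum H N x k (nn_step (path_model F) k g) (x k i))"
  proof (intro sum.cong refl)
    fix i assume "i \<in> {..<N}"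
    then have i: "i < N" by simp
    note v = xi[OF i]
    interpret prob_space "mkernel F (Suc k) (x k i)" by (rule fk_mkernel_prob[OF F v])
    have "backward_sum H N x k (nn_step (path_model F) k g) (x k i)
      = backward_sum H N x k (\<lambda>w. ennreal (pot F k (x k i)) * (\<integral>\<^sup>+ y. g (w(Suc k := y)) \<partial>mkernel F (Suc k) (x k i))) (x k i)"
      by (rule backward_sum_cong[OF xk order_refl v]) (simp_all add: nn_step_path_model[OF F _ g])
    also have "\<dots> = ennreal (pot F k (x k i)) * backward_sum H N x k (\<lambda>w. \<integral>\<^sup>+ y. g (w(Suc k := y)) \<partial>mkernel F (Suc k) (x k i)) (x k i)"
      by (rule backward_sum_cmult)
    also have "backward_sum H N x k (\<lambda>w. \<integral>\<^sup>+ y. g (w(Suc k := y)) \<partial>mkernel F (Suc k) (x k i)) (x k i)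
      = (\<integral>\<^sup>+ y. ?B i y \<partial>mkernel F (Suc k) (x k i))"
      by (rule backward_sum_nn_integral[OF xk order_refl v sigma_finite_measure_axioms gm[OF fk_mkernel_sets[OF F v]]])
    finally show "nn_step F k (?B i) (x k i) = backward_sum H N x k (nn_step (path_model F) k g) (x k i)"
      by (simp only: nn_step_def[of F])
  qed
  finally show ?thesis .
qed

end

locale backward_particles = dual_particles F n r N z + backward_model F H \<nu> N
  for F :: "'a fk_model" and n r N z H \<nu>
begin

abbreviation "PS k \<equiv> PiM {..k} (particle_space N F)"

text \<open>
  The analogue of \<open>mean_ratio\<close> for a functional \<open>g\<close> of the whole path, evaluated by backward sampling.
\<close>

definition backward_mean_ratio where "backward_mean_ratio k g = (\<integral>\<^sup>+ x. particle_ratio N (backward_sum H N x k g) (h k) (x k) \<partial>dual_law F N z k)"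

lemma measurable_backward_sum_particle:
  assumes g: "g \<in> borel_measurable (path_space F k)" and i: "i < N"
  shows "(\<lambda>x. backward_sum H N x k g (x k i)) \<in> borel_measurable (PS k)"
proof -
  have "(\<lambda>x. backward_sum H N (\<lambda>j. x j) k g (x k i)) \<in> borel_measurable (PS k)"
  proof (rule backward_sum_measurable[where X="\<lambda>j x. x j" and W="\<lambda>x. x k i" and f="\<lambda>_. g"])
    show "(\<lambda>(r, w). g w) \<in> borel_measurable (PS k \<Otimes>\<^sub>M path_space F k)"
      using measurable_compose[OF measurable_snd g] by (simp add: case_prod_beta')
    show "(\<lambda>x. x j) \<in> PS k \<rightarrow>\<^sub>M particle_space N F j" if "j < k" for j
      using that by (intro measurable_component_singleton) simp
    show "(\<lambda>x. x k i) \<in> PS k \<rightarrow>\<^sub>M state F k"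
      by (rule measurable_compose[OF measurable_component_singleton[of k "{..k}"] measurable_component_singleton])
        (use i in auto)
  qed
  then show ?thesis by simp
qed

lemma measurable_backward_ratio:
  assumes g: "g \<in> borel_measurable (path_space F k)" and k: "k \<le> n"
  shows "(\<lambda>x. particle_ratio N (backward_sum H N x k g) (h k) (x k)) \<in> borel_measurable (PS k)"
proof -
  have "(\<lambda>x. h k (x k j)) \<in> borel_measurable (PS k)" if "j < N" for j
    using that
    by (intro measurable_compose[OF measurable_compose[OF
      measurable_component_singleton[of k "{..k}" "\<lambda>k. particle_space N F k"]
      measurable_component_singleton[of j "{..<N}" "\<lambda>_. state F k"]] h_measurable[OF k]]) auto
  then show ?thesis unfolding particle_ratio_def
    using measurable_backward_sum_particle[OF g]
    by (intro borel_measurable_times_ennreal borel_measurable_sum measurable_compose[OF _ measurable_ennreal] borel_measurable_divide) auto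
qed

lemma backward_mean_ratio_0:
  assumes g: "g \<in> borel_measurable (path_space F 0)"
  shows "backward_mean_ratio 0 g = (\<integral>\<^sup>+ \<xi>. particle_ratio N (\<lambda>u. g (\<lambda>j\<in>{..0}. u)) (h 0) \<xi> \<partial>frozen_product N (state F 0) (init F) (z 0))"
  unfolding backward_mean_ratio_def
  by (subst nn_integral_dual_law_0[OF F N1 z measurable_backward_ratio[OF g]]) (simp_all add: particle_ratio_def[abs_def])

text \<open>
  The identity \<open>backward_sum_step\<close> describes the particles drawn from \<open>\<Phi>\<^sub>k\<^sub>+\<^sub>1(m\<^sub>k)\<close>. At the frozen state the
  denominator of the backward transition has nothing to cancel with, so this term is dropped, which
  leaves the factor \<open>1 - 1/N\<close>.
\<close>

lemma backward_mean_ratio_step: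
  assumes g: "g \<in> borel_measurable (path_space F (Suc k))" and k: "Suc k \<le> n"
  shows "ennreal (1 - 1 / N) * backward_mean_ratio k (nn_step (path_model F) k g) \<le> ennreal lower_factor * backward_mean_ratio (Suc k) g"
proof -
  have kn: "k < n" using k by simp
  have PM: "is_fk_model (path_model F)" by (rule is_fk_model_path[OF F])
  have gs: "nn_step (path_model F) k g \<in> borel_measurable (path_space F k)"
    using measurable_nn_step[OF PM, of g k] g by simp
  let ?\<Phi> = "\<lambda>x. dual_kernel F N z k (x k)"
  let ?R = "\<lambda>x. particle_ratio N (backward_sum H N x (Suc k) g) (h (Suc k))"
  have "ennreal (1 - 1 / N) * backward_mean_ratio k (nn_step (path_model F) k g)
    = (\<integral>\<^sup>+ x. ennreal (1 - 1 / N) * particle_ratio N (backward_sum H N x k (nn_step (path_model F) k g)) (h k) (x k) \<partial>dual_law F N z k)"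
    unfolding backward_mean_ratio_def using measurable_backward_ratio[OF gs] kn
    by (intro nn_integral_cmult[symmetric]) (simp add: measurable_cong_sets[OF sets_dual_law[OF F N1 z] refl])
  also have "\<dots> \<le> (\<integral>\<^sup>+ x. \<integral>\<^sup>+ \<xi>. ennreal lower_factor * ?R x \<xi> \<partial>?\<Phi> x \<partial>dual_law F N z k)"
  proof (rule nn_integral_mono)
    fix x assume x: "x \<in> space (dual_law F N z k)"
    have xs: "x j \<in> space (particle_space N F j)" if "j < Suc k" for j
      using dual_component[OF x] that by simp
    have xk: "x k \<in> space (particle_space N F k)" by (rule xs) simp
    let ?\<phi> = "backward_sum H N x (Suc k) g"
    have \<phi>: "?\<phi> \<in> borel_measurable (state F (Suc k))" by (rule backward_sum_measurable_state[OF g xs])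
    have "(\<Sum>i<N. backward_sum H N x k (nn_step (path_model F) k g) (x k i)) = (\<Sum>i<N. nn_step F k ?\<phi> (x k i))"
      by (rule backward_sum_step[OF xs g, symmetric])
    then have "ennreal (1 - 1 / N) * particle_ratio N (backward_sum H N x k (nn_step (path_model F) k g)) (h k) (x k)
      = (\<Sum>i<N. ennreal (1 - 1 / N) * nn_step F k ?\<phi> (x k i)) * ennreal (1 / (\<Sum>i<N. h k (x k i)))"
      by (simp only: particle_ratio_def sum_distrib_left[symmetric] mult.assoc)
    also have "\<dots> \<le> particle_ratio N (nn_step Fz k ?\<phi>) (h k) (x k)"
      unfolding particle_ratio_def
      by (intro mult_right_mono sum_mono nn_step_frozen_ge \<phi> particle_in[OF N1 xk]) auto
    also have "\<dots> \<le> ennreal lower_factor * (\<integral>\<^sup>+ \<xi>. ?R x \<xi> \<partial>?\<Phi> x)"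
      by (rule step_ratio(2)[OF kn xk \<phi>])
    also have "\<dots> = (\<integral>\<^sup>+ \<xi>. ennreal lower_factor * ?R x \<xi> \<partial>?\<Phi> x)"
    proof (rule nn_integral_cmult[symmetric])
      have "sets (?\<Phi> x) = sets (particle_space N F (Suc k))"
        using frozen_product_in_prob_algebra[OF N1 z fk_Phi_in_prob_algebra[OF F N1 xk]] by (simp add: space_prob_algebra)
      then show "?R x \<in> borel_measurable (?\<Phi> x)"
        using measurable_particle_ratio[OF \<phi> h_measurable[OF k], of N] by (simp cong: measurable_cong_sets)
    qed
    finally show "ennreal (1 - 1 / N) * particle_ratio N (backward_sum H N x k (nn_step (path_model F) k g)) (h k) (x k)
      \<le> (\<integral>\<^sup>+ \<xi>. ennreal lower_factor * ?R x \<xi> \<partial>?\<Phi> x)" .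
  qed
  also have "\<dots> = (\<integral>\<^sup>+ x. ennreal lower_factor * ?R x (x (Suc k)) \<partial>dual_law F N z (Suc k))"
  proof -
    have "?R (x(Suc k := \<xi>)) = ?R x" for x \<xi>
    proof -
      have "backward_sum H N (x(Suc k := \<xi>)) (Suc k) g = backward_sum H N x (Suc k) g"
        by (intro ext backward_sum_cong_particles) auto
      then show ?thesis by (rule arg_cong)
    qed
    moreover have "(\<lambda>x. ennreal lower_factor * ?R x (x (Suc k))) \<in> borel_measurable (PS (Suc k))"
      using measurable_backward_ratio[OF g k] by (intro borel_measurable_times_ennreal) auto
    ultimately show ?thesis
      by (subst nn_integral_dual_law_Suc[OF F N1 z]) (simp_all only: fun_upd_same)
  qed
  also have "\<dots> = ennreal lower_factor * backward_mean_ratio (Suc k) g"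
    unfolding backward_mean_ratio_def using measurable_backward_ratio[OF g k]
    by (intro nn_integral_cmult) (simp add: measurable_cong_sets[OF sets_dual_law[OF F N1 z] refl])
  finally show ?thesis .
qed

lemma backward_mean_ratio_lower:
  "k \<le> n \<Longrightarrow> g \<in> borel_measurable (path_space F k) \<Longrightarrow>
    ennreal ((1 - 1 / N) ^ Suc k) * (nn_gamma (path_model F) k g * ennreal (1 / \<gamma>1)) \<le> ennreal (lower_factor ^ Suc k) * backward_mean_ratio k g"
proof (induction k arbitrary: g)
  case 0
  let ?g = "\<lambda>u. g (\<lambda>j\<in>{..0}. u)"
  have PM: "is_fk_model (path_model F)" by (rule is_fk_model_path[OF F])
  have "(\<lambda>u. \<lambda>j\<in>{..0::nat}. u) \<in> state F 0 \<rightarrow>\<^sub>M path_space F 0" by (rule measurable_restrict) auto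
  from measurable_compose[OF this "0.prems"(2)] have gm: "?g \<in> borel_measurable (state F 0)" .
  have "nn_gamma (path_model F) 0 g = (\<integral>\<^sup>+ u. ?g u \<partial>init F)"
    by (rule trans[OF nn_gamma_0[OF PM, of g, unfolded path_model_sel, OF "0.prems"(2)]
      path_init_in_prob_algebra(2)[where S="state F", OF fk_init[OF F] "0.prems"(2)]])
  then have "ennreal (1 - 1 / N) * nn_gamma (path_model F) 0 g \<le> (\<integral>\<^sup>+ u. ?g u \<partial>frozen_mixture N (state F 0) (init F) (z 0))"
    unfolding nn_integral_frozen_mixture[OF N1 z fk_init[OF F] gm] by (simp only: add_increasing zero_le order_refl)
  from order_trans[OF mult_right_mono[OF this, of "ennreal (1 / \<gamma>1)"] init_ratio(2)[OF gm]]
  show ?case by (simp only: backward_mean_ratio_0[OF "0.prems"(2)] power_Suc power_0 mult_1_right mult.assoc zero_le)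
next
  case (Suc k)
  have PM: "is_fk_model (path_model F)" by (rule is_fk_model_path[OF F])
  have gs: "nn_step (path_model F) k g \<in> borel_measurable (path_space F k)"
    using measurable_nn_step[OF PM, of g k] Suc.prems(2) by simp
  have c: "0 \<le> 1 - 1 / real N" using N by simp
  have eq: "nn_gamma (path_model F) (Suc k) g = nn_gamma (path_model F) k (nn_step (path_model F) k g)"
    using Suc.prems(2) by (intro nn_gamma_Suc[OF PM]) simp
  have "ennreal ((1 - 1 / N) ^ Suc (Suc k)) * (nn_gamma (path_model F) (Suc k) g * ennreal (1 / \<gamma>1))
    = ennreal (1 - 1 / N) * (ennreal ((1 - 1 / N) ^ Suc k) * (nn_gamma (path_model F) k (nn_step (path_model F) k g) * ennreal (1 / \<gamma>1)))"
    unfolding eq power_Suc[of _ "Suc k"] using c by (subst ennreal_mult) (auto simp: mult.assoc)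
  also have "\<dots> \<le> ennreal (1 - 1 / N) * (ennreal (lower_factor ^ Suc k) * backward_mean_ratio k (nn_step (path_model F) k g))"
    using Suc.prems by (intro mult_left_mono Suc.IH gs) auto
  also have "\<dots> = ennreal (lower_factor ^ Suc k) * (ennreal (1 - 1 / N) * backward_mean_ratio k (nn_step (path_model F) k g))"
    by (rule mult.left_commute)
  also have "\<dots> \<le> ennreal (lower_factor ^ Suc k) * (ennreal lower_factor * backward_mean_ratio (Suc k) g)"
    by (intro mult_left_mono backward_mean_ratio_step Suc.prems) auto
  also have "\<dots> = ennreal (lower_factor ^ Suc (Suc k)) * backward_mean_ratio (Suc k) g"
    unfolding power_Suc[of _ "Suc k"] using lower_factor_pos by (subst ennreal_mult) (auto simp: mult_ac)
  finally show ?case .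
qed

end

section \<open>The uniform ratio bound and the path model\<close>

lemma Q_step_cmult: "Q_step F k (\<lambda>x. c * f x) = (\<lambda>x. c * Q_step F k f x)"
  by (simp add: Q_step_def fun_eq_iff)

lemma fk_Q_cmult: "fk_Q F p n (\<lambda>x. c * f x) x = c * fk_Q F p n f x"
proof (induction n arbitrary: f)
  case (Suc n)
  then show ?case
    by (cases "p \<le> n") (simp add: fk_Q_Suc Q_step_cmult, simp add: fk_Q.simps(2))
qed simp

context
  fixes F :: "'a fk_model"
  assumes F: "is_fk_model F"
begin

lemma Q_step_cong:
  assumes "\<And>y. y \<in> space (state F (Suc k)) \<Longrightarrow> f y = g y" and x: "x \<in> space (state F k)"
  shows "Q_step F k f x = Q_step F k g x"
  unfolding Q_step_def using assms fk_mkernel_space[OF F x]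
  by (intro arg_cong2[where f="(*)"] refl Bochner_Integration.integral_cong) auto

lemma fk_Q_cong:
  assumes "p \<le> n" and "\<And>y. y \<in> space (state F n) \<Longrightarrow> f y = g y" and x: "x \<in> space (state F p)"
  shows "fk_Q F p n f x = fk_Q F p n g x"
  using assms
proof (induction n arbitrary: f g)
  case (Suc n)
  show ?case
  proof (cases "p = Suc n")
    case False
    with Suc.prems have p: "p \<le> n" by simp
    show ?thesis unfolding fk_Q_Suc[OF p] by (intro Suc.IH p x Q_step_cong Suc.prems)
  qed (use Suc.prems in auto)
qed auto

lemma Q_step_1: "x \<in> space (state F k) \<Longrightarrow> Q_step F k (\<lambda>_. 1) x = pot F k x"
  using prob_space.prob_space[OF fk_mkernel_prob[OF F]] by (simp add: Q_step_def)

lemma fk_Q_one_pos: "p \<le> n \<Longrightarrow> x \<in> space (state F p) \<Longrightarrow> 0 < fk_Q F p n (\<lambda>_. 1) x"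
  by (rule fk_Q_pos[OF F]) auto

text \<open>
  Iterating this writes \<open>Q\<^sub>p\<^sub>,\<^sub>q(1)(x)\<close> as the product of the means of \<open>G\<^sub>k\<close> under \<open>\<eta>\<^sup>x\<^sub>p\<^sub>,\<^sub>k\<close>.
\<close>

lemma fk_Q_one_Suc:
  assumes "p \<le> n" "x \<in> space (state F p)"
  shows "fk_Q F p (Suc n) (\<lambda>_. 1) x = fk_eta_from F p n x (pot F n) * fk_Q F p n (\<lambda>_. 1) x"
proof -
  have "fk_Q F p (Suc n) (\<lambda>_. 1) x = fk_Q F p n (pot F n) x"
    unfolding fk_Q_Suc[OF assms(1)] by (rule fk_Q_cong) (use assms Q_step_1 in auto)
  then show ?thesis using fk_Q_one_pos[OF assms] by (simp add: fk_eta_from_def)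
qed

lemma fk_eta_from_abs_le:
  assumes "p \<le> n" "x \<in> space (state F p)" "f \<in> borel_measurable (state F n)" "\<forall>y\<in>space (state F n). \<bar>f y\<bar> \<le> 1"
  shows "\<bar>fk_eta_from F p n x f\<bar> \<le> 1"
proof -
  have "\<bar>fk_Q F p n f x\<bar> \<le> fk_Q F p n (\<lambda>_. 1) x"
    using assms by (intro fk_Q_abs[OF F]) (auto simp: bounded_measurable_def)
  then show ?thesis using fk_Q_one_pos[OF assms(1,2)] by (simp add: fk_eta_from_def)
qed

text \<open>
  The supremum in the total variation norm is a real one, so its defining set must be bounded first.
\<close>

lemma fk_eta_from_diff_le_tv:
  fixes f :: "'a \<Rightarrow> real"
  assumes p: "p \<le> n" "x \<in> space (state F p)" "y \<in> space (state F p)"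
    and f: "f \<in> borel_measurable (state F n)" "\<forall>v\<in>space (state F n). \<bar>f v\<bar> \<le> 1"
  shows "\<bar>fk_eta_from F p n x f - fk_eta_from F p n y f\<bar>
    \<le> tv_norm (state F n) (\<lambda>f. fk_eta_from F p n x f - fk_eta_from F p n y f)"
  unfolding tv_norm_def
proof (rule cSUP_upper)
  show "f \<in> {f \<in> borel_measurable (state F n). \<forall>x\<in>space (state F n). \<bar>f x\<bar> \<le> 1}" using f by simp
  show "bdd_above ((\<lambda>f. \<bar>fk_eta_from F p n x f - fk_eta_from F p n y f\<bar>) ` {f \<in> borel_measurable (state F n). \<forall>x\<in>space (state F n). \<bar>f x\<bar> \<le> 1})"
  proof (rule bdd_aboveI2[where M=2])
    fix f :: "'a \<Rightarrow> real" assume "f \<in> {f \<in> borel_measurable (state F n). \<forall>x\<in>space (state F n). \<bar>f x\<bar> \<le> 1}"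
    then show "\<bar>fk_eta_from F p n x f - fk_eta_from F p n y f\<bar> \<le> 2"
      using fk_eta_from_abs_le[OF p(1,2), of f] fk_eta_from_abs_le[OF p(1,3), of f] by simp
  qed
qed

text \<open>
  Change the starting point in each factor of the product formula for \<open>Q\<^sub>p\<^sub>,\<^sub>q(1)\<close>. The mean of \<open>G\<^sub>k\<close> is at
  least \<open>\<beta>\<^sub>1\<close> and changes by at most \<open>\<beta>\<^sub>2 \<alpha>(k - p)\<close>, hence by a factor of at most
  \<open>exp ((\<beta>\<^sub>2/\<beta>\<^sub>1) \<alpha>(k - p))\<close>. The product of these factors is bounded since \<open>\<alpha>\<close> is summable.
\<close>

lemma ratio_bound_of_A2:
  assumes A2: "fk_A2 F"
  shows "\<exists>r. \<forall>n. fk_ratio_bound F n r"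
proof -
  note A2' = A2[unfolded fk_A2_def]
  obtain \<alpha> :: "nat \<Rightarrow> real" where \<alpha>_all: "(\<forall>k. 0 \<le> \<alpha> k) \<and> summable \<alpha> \<and>
        (\<forall>p n. p \<le> n \<longrightarrow>
           (\<forall>x\<in>space (state F p). \<forall>y\<in>space (state F p).
              tv_norm (state F n) (\<lambda>f. fk_eta_from F p n x f - fk_eta_from F p n y f) \<le> \<alpha> (n - p)))"
    using conjunct1[OF A2'] by (rule exE)
  then have \<alpha>: "\<And>k. 0 \<le> \<alpha> k" "summable \<alpha>" by auto
  have tv: "tv_norm (state F n) (\<lambda>f. fk_eta_from F p n x f - fk_eta_from F p n y f) \<le> \<alpha> (n - p)"
    if "p \<le> n" "x \<in> space (state F p)" "y \<in> space (state F p)" for p n x y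
    using conjunct2[OF conjunct2[OF \<alpha>_all]] that by simp
  obtain \<beta>1 \<beta>2 :: real where \<beta>: "0 < \<beta>1" "\<beta>1 < \<beta>2"
    and lo: "ereal \<beta>1 \<le> (INF n. INF x\<in>space (state F n). ereal (pot F n x))"
    and hi: "(SUP n. SUP x\<in>space (state F n). ereal (pot F n x)) \<le> ereal \<beta>2"
    using conjunct2[OF A2'] by (elim exE conjE)
  have lo: "\<beta>1 \<le> pot F n x" and hi: "pot F n x \<le> \<beta>2" if "x \<in> space (state F n)" for n x
    using lo hi that by (auto simp: le_INF_iff SUP_le_iff)
  define c where "c = \<beta>2 / \<beta>1"
  have c: "0 \<le> c" using \<beta> by (simp add: c_def)
  have bound: "fk_Q F p (p + d) (\<lambda>_. 1) x \<le> exp (c * (\<Sum>i<d. \<alpha> i)) * fk_Q F p (p + d) (\<lambda>_. 1) y"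
    if x: "x \<in> space (state F p)" and y: "y \<in> space (state F p)" for p d x y
  proof (induction d)
    case (Suc d)
    let ?n = "p + d" and ?G = "\<lambda>v. pot F (p + d) v / \<beta>2"
    let ?ex = "fk_eta_from F p ?n x" and ?ey = "fk_eta_from F p ?n y"
    have pn: "p \<le> ?n" by simp
    have G: "?G \<in> borel_measurable (state F ?n)" "\<forall>v\<in>space (state F ?n). \<bar>?G v\<bar> \<le> 1"
      using fk_pot_measurable[OF F] hi fk_pot_pos[OF F] \<beta> by (auto simp: less_imp_le)
    have "?ex (pot F ?n) - ?ey (pot F ?n) = \<beta>2 * (?ex ?G - ?ey ?G)"
      using fk_Q_cmult[of F p ?n "1 / \<beta>2" "pot F ?n"] \<beta> by (simp add: fk_eta_from_def field_simps)
    also have "\<dots> \<le> \<beta>2 * \<alpha> d"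
      using fk_eta_from_diff_le_tv[OF pn x y G] tv[OF pn x y] \<beta> by (intro mult_left_mono) auto
    finally have d1: "?ex (pot F ?n) \<le> ?ey (pot F ?n) + \<beta>2 * \<alpha> d" by simp
    have "\<beta>1 * fk_Q F p ?n (\<lambda>_. 1) y \<le> fk_Q F p ?n (pot F ?n) y"
    proof -
      have "\<bar>fk_Q F p ?n (\<lambda>_. \<beta>1) y\<bar> \<le> fk_Q F p ?n (pot F ?n) y"
        using lo \<beta> y by (intro fk_Q_abs[OF F]) (auto simp: bounded_measurable_pot[OF F])
      then show ?thesis using fk_Q_cmult[of F p ?n \<beta>1 "\<lambda>_. 1" y] by simp
    qed
    then have e1: "\<beta>1 \<le> ?ey (pot F ?n)" using fk_Q_one_pos[OF pn y] by (simp add: fk_eta_from_def field_simps)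
    have "?ex (pot F ?n) \<le> (1 + c * \<alpha> d) * ?ey (pot F ?n)"
    proof -
      have "\<beta>2 * \<alpha> d = (c * \<alpha> d) * \<beta>1" using \<beta> by (simp add: c_def)
      also have "\<dots> \<le> (c * \<alpha> d) * ?ey (pot F ?n)" using e1 c \<alpha> by (intro mult_left_mono) auto
      finally show ?thesis using d1 by (simp add: distrib_right)
    qed
    also have "\<dots> \<le> exp (c * \<alpha> d) * ?ey (pot F ?n)" using e1 \<beta> by (intro mult_right_mono) auto
    finally have e2: "?ex (pot F ?n) \<le> exp (c * \<alpha> d) * ?ey (pot F ?n)" .
    have "fk_Q F p (p + Suc d) (\<lambda>_. 1) x = ?ex (pot F ?n) * fk_Q F p ?n (\<lambda>_. 1) x"
      using fk_Q_one_Suc[OF pn x] by simp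
    also have "\<dots> \<le> (exp (c * \<alpha> d) * ?ey (pot F ?n)) * (exp (c * (\<Sum>i<d. \<alpha> i)) * fk_Q F p ?n (\<lambda>_. 1) y)"
      using e1 e2 Suc \<beta> fk_Q_one_pos[OF pn x] by (intro mult_mono) auto
    also have "\<dots> = exp (c * (\<Sum>i<Suc d. \<alpha> i)) * fk_Q F p (p + Suc d) (\<lambda>_. 1) y"
      using fk_Q_one_Suc[OF pn y] by (simp add: distrib_left exp_add mult_ac)
    finally show ?case .
  qed simp
  have "fk_ratio_bound F n (exp (c * suminf \<alpha>))" for n
    unfolding fk_ratio_bound_def
  proof (intro allI impI ballI)
    fix p q x y assume pq: "p \<le> q \<and> q \<le> n" and x: "x \<in> space (state F p)" and y: "y \<in> space (state F p)"
    have "fk_Q F p q (\<lambda>_. 1) x \<le> exp (c * (\<Sum>i<q - p. \<alpha> i)) * fk_Q F p q (\<lambda>_. 1) y"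
      using bound[OF x y, of "q - p"] pq by simp
    also have "\<dots> \<le> exp (c * suminf \<alpha>) * fk_Q F p q (\<lambda>_. 1) y"
      using fk_Q_one_pos[of p q y] pq y \<alpha> c
      by (intro mult_right_mono) (auto intro!: mult_left_mono sum_le_suminf)
    finally show "fk_Q F p q (\<lambda>_. 1) x \<le> exp (c * suminf \<alpha>) * fk_Q F p q (\<lambda>_. 1) y" .
  qed
  then show ?thesis by blast
qed

lemma ratio_bound_ge_1:
  assumes "fk_ratio_bound F n r" shows "1 \<le> r"
proof -
  obtain x where "x \<in> space (state F 0)" using fk_state_nonempty[OF F] by blast
  then show ?thesis using assms unfolding fk_ratio_bound_def by (auto dest!: spec[of _ 0])
qed

lemma ratio_bound_mono:
  assumes "fk_ratio_bound F n r" "r \<le> r'" shows "fk_ratio_bound F n r'"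
  unfolding fk_ratio_bound_def
proof (intro allI impI ballI)
  fix p q x y assume pq: "p \<le> q \<and> q \<le> n" and x: "x \<in> space (state F p)" and y: "y \<in> space (state F p)"
  have "fk_Q F p q (\<lambda>_. 1) x \<le> r * fk_Q F p q (\<lambda>_. 1) y"
    using assms(1) pq x y unfolding fk_ratio_bound_def by blast
  also have "\<dots> \<le> r' * fk_Q F p q (\<lambda>_. 1) y"
    using assms(2) fk_Q_one_pos[of p q y] pq y by (intro mult_right_mono) auto
  finally show "fk_Q F p q (\<lambda>_. 1) x \<le> r' * fk_Q F p q (\<lambda>_. 1) y" .
qed

text \<open>
  The infimum of the admissible constants is admissible, since each constraint on \<open>r\<close> is a closed
  half-line.
\<close>

lemma ratio_bound_rho_at:
  assumes ex: "\<exists>r. fk_ratio_bound F n r"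
  shows "fk_ratio_bound F n (fk_rho_at F n)"
  unfolding fk_ratio_bound_def
proof (intro allI impI ballI)
  fix p q x y assume pq: "p \<le> q \<and> q \<le> n" and x: "x \<in> space (state F p)" and y: "y \<in> space (state F p)"
  have pos: "0 < fk_Q F p q (\<lambda>_. 1) y" using pq y by (intro fk_Q_one_pos) auto
  have "fk_Q F p q (\<lambda>_. 1) x / fk_Q F p q (\<lambda>_. 1) y \<le> fk_rho_at F n"
    unfolding fk_rho_at_def
  proof (rule cInf_greatest)
    fix r assume "r \<in> {r. fk_ratio_bound F n r}"
    then have "fk_Q F p q (\<lambda>_. 1) x \<le> r * fk_Q F p q (\<lambda>_. 1) y"
      using pq x y unfolding fk_ratio_bound_def by blast
    then show "fk_Q F p q (\<lambda>_. 1) x / fk_Q F p q (\<lambda>_. 1) y \<le> r" using pos by (simp add: divide_le_eq)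
  qed (use ex in auto)
  then show "fk_Q F p q (\<lambda>_. 1) x \<le> fk_rho_at F n * fk_Q F p q (\<lambda>_. 1) y"
    using pos by (simp add: divide_le_eq)
qed

text \<open>
  A bound uniform in the horizon keeps the real supremum that defines \<open>\<rho>\<close> from degenerating.
\<close>

lemma ratio_bound_rho:
  assumes A2: "fk_A2 F"
  shows "fk_ratio_bound F n (fk_rho F)"
proof -
  obtain r where r: "\<And>n. fk_ratio_bound F n r" using ratio_bound_of_A2[OF A2] by blast
  have "fk_rho_at F n \<le> r" for n
    unfolding fk_rho_at_def using r ratio_bound_ge_1
    by (intro cInf_lower bdd_belowI[where m=1]) auto
  then have "fk_rho_at F n \<le> fk_rho F"
    unfolding fk_rho_def by (intro cSUP_upper bdd_aboveI2[where M=r]) auto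
  then show ?thesis using ratio_bound_rho_at[of n] r ratio_bound_mono by blast
qed

lemma Q_step_path_model:
  assumes w: "w \<in> space (path_space F k)" and f: "f \<in> borel_measurable (state F (Suc k))"
  shows "Q_step (path_model F) k (\<lambda>w. f (w (Suc k))) w = Q_step F k f (w k)"
proof -
  have wk: "w k \<in> space (state F k)" using w by (auto simp: space_PiM)
  have "(\<lambda>v. f (v (Suc k))) \<in> borel_measurable (path_space F (Suc k))"
    by (rule measurable_compose[OF measurable_component_singleton[of "Suc k" "{..Suc k}" "state F"] f]) simp
  then have "(\<integral>v. f (v (Suc k)) \<partial>path_kernel (state F) (mkernel F) (Suc k) w) = (\<integral>y. f y \<partial>mkernel F (Suc k) (w k))"
    unfolding path_kernel_def diff_Suc_1 using measurable_path_extend_const[OF w] fk_mkernel_sets[OF F wk]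
    by (subst integral_distr) (simp_all cong: measurable_cong_sets)
  then show ?thesis by (simp add: Q_step_def)
qed

end

lemma fk_Q_path_model:
  assumes F: "is_fk_model F" and "p \<le> n" and "bounded_measurable (state F n) f" and w: "w \<in> space (path_space F p)"
  shows "fk_Q (path_model F) p n (\<lambda>w. f (w n)) w = fk_Q F p n f (w p)"
  using assms(2,3)
proof (induction n arbitrary: f)
  case (Suc n)
  show ?case
  proof (cases "p = Suc n")
    case False
    with Suc.prems have p: "p \<le> n" by simp
    have "fk_Q (path_model F) p (Suc n) (\<lambda>w. f (w (Suc n))) w = fk_Q (path_model F) p n (\<lambda>w. Q_step F n f (w n)) w"
      unfolding fk_Q_Suc[OF p] using Suc.prems w
      by (intro fk_Q_cong[OF is_fk_model_path[OF F] p] Q_step_path_model[OF F]) (auto simp: bounded_measurable_def)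
    also have "\<dots> = fk_Q F p n (Q_step F n f) (w p)"
      by (intro Suc.IH p bounded_measurable_Q_step[OF F] Suc.prems)
    finally show ?thesis by (simp add: fk_Q_Suc[OF p])
  qed simp
qed simp

text \<open>
  The total mass \<open>Q\<^sub>p\<^sub>,\<^sub>q(1)\<close> of the path model depends on the last state of the path alone.
\<close>

lemma ratio_bound_path_model:
  assumes F: "is_fk_model F" and r: "fk_ratio_bound F n r"
  shows "fk_ratio_bound (path_model F) n r"
  unfolding fk_ratio_bound_def
proof (intro allI impI ballI)
  fix p q w v assume pq: "p \<le> q \<and> q \<le> n" and wv: "w \<in> space (state (path_model F) p)" "v \<in> space (state (path_model F) p)"
  then have "w p \<in> space (state F p)" "v p \<in> space (state F p)" by (auto simp: space_PiM)
  then have "fk_Q F p q (\<lambda>_. 1) (w p) \<le> r * fk_Q F p q (\<lambda>_. 1) (v p)"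
    using r pq unfolding fk_ratio_bound_def by blast
  then show "fk_Q (path_model F) p q (\<lambda>_. 1) w \<le> r * fk_Q (path_model F) p q (\<lambda>_. 1) v"
    using fk_Q_path_model[OF F, of p q "\<lambda>_. 1"] pq wv by simp
qed

text \<open>
  If all \<open>\<eta>\<^sub>k(G\<^sub>k)\<close> equal \<open>1\<close> the normalising constants telescope. The hypothesis also excludes a vanishing
  \<open>\<gamma>\<^sub>k(1)\<close>, since then \<open>\<eta>\<^sub>k\<close> would be \<open>0\<close> by the convention on division.
\<close>

lemma fk_gamma_one:
  assumes F: "is_fk_model F" and norm: "\<And>k. fk_eta F k (pot F k) = 1"
  shows "fk_gamma F n (\<lambda>_. 1) = 1"
proof (induction n)
  case 0
  have "prob_space (init F)" using fk_init[OF F] by (simp add: space_prob_algebra)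
  then have "ennreal (fk_gamma F 0 (\<lambda>_. 1)) = 1"
    by (subst fk_gamma_eq_nn_gamma[OF F]) (auto simp: nn_gamma_0[OF F] prob_space.emeasure_space_1)
  then show ?case by simp
next
  case (Suc n)
  have "fk_gamma F n (pot F n) = 1" using norm[of n] Suc by (simp add: fk_eta_def)
  then have "1 = nn_gamma F n (\<lambda>x. ennreal (pot F n x))"
    using fk_gamma_eq_nn_gamma(1)[OF F fk_pot_measurable[OF F] less_imp_le[OF fk_pot_pos[OF F]] fk_pot_bounded[OF F], of n] by simp
  also have "\<dots> = nn_gamma F n (nn_step F n (\<lambda>_. 1))"
    using prob_space.emeasure_space_1[OF fk_mkernel_prob[OF F]]
    by (intro nn_gamma_cong[OF F]) (simp add: nn_step_def)
  also have "\<dots> = nn_gamma F (Suc n) (\<lambda>_. 1)" by (rule nn_gamma_Suc[OF F, symmetric]) simp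
  finally have "ennreal (fk_gamma F (Suc n) (\<lambda>_. 1)) = 1"
    by (subst fk_gamma_eq_nn_gamma[OF F]) auto
  then show ?case by simp
qed

section \<open>Numerical estimates\<close>

text \<open>
  The base of the power is at most \<open>exp ((2 + 2 r) / N)\<close>. As \<open>n + 1 \<le> 2 n\<close>, the whole product is at most
  \<open>exp t\<close> with \<open>t = 4 (1 + r) n / N \<le> 1/2\<close>, and \<open>exp t \<le> 1 + 2 t\<close> in this range.
\<close>

lemma upper_constant:
  fixes r :: real and n N :: nat
  assumes n: "1 \<le> n" and r: "1 \<le> r" and N: "8 * (1 + r) * n \<le> N"
  shows "(real N / (real N - 1) * (1 + r / real N)) ^ Suc n * (1 + r / real N) ^ Suc n \<le> 1 + 8 * (1 + r) * n / N"
proof -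
  have "16 * 1 \<le> 8 * (1 + r) * n" using n r by (intro mult_mono) auto
  then have N2: "2 \<le> real N" using N by simp
  have "4 * (1 + r) * n \<le> 8 * (1 + r) * n" using r by (intro mult_right_mono) auto
  then have t1: "4 * (1 + r) * n / N \<le> 1" using N N2 by (simp only: divide_le_eq) auto
  have "real N / (real N - 1) = 1 + 1 / (real N - 1)" using N2 by (simp add: field_simps)
  also have "1 / (real N - 1) \<le> 2 / real N" using N2 by (simp add: field_simps)
  also have "1 + 2 / real N \<le> exp (2 / real N)" by (rule exp_ge_add_one_self)
  finally have e1: "real N / (real N - 1) \<le> exp (2 / real N)" by simp
  have e2: "1 + r / real N \<le> exp (r / real N)" by (rule exp_ge_add_one_self)
  have "real N / (real N - 1) * (1 + r / real N) * (1 + r / real N) \<le> exp (2 / real N) * exp (r / real N) * exp (r / real N)"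
    using e1 e2 r N2 by (intro mult_mono) auto
  also have "\<dots> = exp (2 * (1 + r) / real N)"
    by (simp add: exp_add[symmetric] add_divide_distrib[symmetric] algebra_simps)
  finally have "(real N / (real N - 1) * (1 + r / real N) * (1 + r / real N)) ^ Suc n \<le> exp (2 * (1 + r) / real N) ^ Suc n"
    using r N2 by (intro power_mono) auto
  also have "\<dots> = exp (real (Suc n) * (2 * (1 + r) / real N))" by (simp only: exp_of_nat_mult)
  also have "\<dots> \<le> exp (4 * (1 + r) * n / N)"
  proof -
    have "real (Suc n) * (2 * (1 + r)) \<le> (2 * real n) * (2 * (1 + r))" using n r by (intro mult_right_mono) auto
    then show ?thesis using N2 by (simp add: divide_right_mono mult_ac)
  qed
  also have "exp (4 * (1 + r) * n / N) \<le> 1 + 8 * (1 + r) * n / N"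
  proof -
    define t where "t = 4 * (1 + r) * n / N"
    have t: "0 \<le> t" "t \<le> 1" using r t1 by (simp_all add: t_def)
    then have "exp t \<le> 1 + t + t\<^sup>2" by (rule exp_bound)
    also have "t\<^sup>2 \<le> t" using t by (simp add: power2_eq_square mult_left_le)
    finally have "exp t \<le> 1 + 2 * t" by simp
    moreover have "8 * (1 + r) * n / N = 2 * t" by (simp add: t_def algebra_simps)
    ultimately show ?thesis by (simp only: t_def)
  qed
  finally show ?thesis by (simp only: power_mult_distrib)
qed

text \<open>
  Bernoulli's inequality for \<open>1 - (3 r + 2) / N\<close>. One factor \<open>(1 - 1/N)\<^sup>n\<^sup>+\<^sup>1\<close> on the right pays for the
  normalising constant \<open>\<gamma>\<^sub>z\<^sub>,\<^sub>n(1)\<close>, the other one for the frozen particles that are dropped in backward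
  sampling.
\<close>

lemma lower_constant:
  fixes r :: real and n N :: nat
  assumes n: "1 \<le> n" and r: "1 \<le> r" and N: "8 * (1 + r) * n \<le> N"
  shows "(1 - 8 * (1 + r) * n / N) * (1 + 3 * r / real N) ^ Suc n \<le> (1 - 1 / real N) ^ Suc n * (1 - 1 / real N) ^ Suc n"
proof -
  have "16 * 1 \<le> 8 * (1 + r) * n" using n r by (intro mult_mono) auto
  then have N2: "2 \<le> real N" using N by simp
  let ?a = "3 * r / N" and ?b = "1 / real N"
  have "8 * (1 + r) * 1 \<le> 8 * (1 + r) * real n" using n r by (intro mult_left_mono) auto
  from order_trans[OF this N] have "3 * r + 2 \<le> real N" using r by simp
  then have s: "?a + 2 * ?b \<le> 1" using N2 by (simp add: field_simps)
  have ab: "0 \<le> ?a" "0 \<le> ?b" using r by auto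
  have "1 - 8 * (1 + r) * n / N \<le> 1 + real (Suc n) * (- (?a + 2 * ?b))"
  proof -
    have "real (Suc n) * (3 * r + 2) \<le> (2 * real n) * (4 * (1 + r))" using n r by (intro mult_mono) auto
    then have "real (Suc n) * (3 * r + 2) / N \<le> (2 * real n) * (4 * (1 + r)) / N" by (rule divide_right_mono) simp
    moreover have "?a + 2 * ?b = (3 * r + 2) / N" by (simp add: add_divide_distrib)
    moreover have "8 * (1 + r) * n / N = (2 * real n) * (4 * (1 + r)) / N" by (simp add: algebra_simps)
    ultimately show ?thesis by (simp only: mult_minus_right times_divide_eq_right)
  qed
  also have "\<dots> \<le> (1 + - (?a + 2 * ?b)) ^ Suc n"
    using s by (intro Bernoulli_inequality) simp
  finally have "(1 - 8 * (1 + r) * n / N) * (1 + ?a) ^ Suc n \<le> (1 + - (?a + 2 * ?b)) ^ Suc n * (1 + ?a) ^ Suc n"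
    using ab by (intro mult_right_mono) auto
  also have "\<dots> = ((1 + - (?a + 2 * ?b)) * (1 + ?a)) ^ Suc n" by (simp only: power_mult_distrib)
  also have "\<dots> \<le> ((1 - ?b) * (1 - ?b)) ^ Suc n"
  proof (rule power_mono)
    have "(1 + - (a + 2 * b)) * (1 + a) \<le> (1 - b) * (1 - b)" if "0 \<le> a" "0 \<le> b" for a b :: real
    proof -
      have "(1 - b) * (1 - b) = (1 + - (a + 2 * b)) * (1 + a) + (b * b + a * a + 2 * (a * b))"
        by (simp add: algebra_simps)
      then show ?thesis using that by simp
    qed
    from this[OF ab] show "(1 + - (?a + 2 * ?b)) * (1 + ?a) \<le> (1 - ?b) * (1 - ?b)" .
    show "0 \<le> (1 + - (?a + 2 * ?b)) * (1 + ?a)" using s ab by (intro mult_nonneg_nonneg) auto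
  qed
  also have "\<dots> = (1 - ?b) ^ Suc n * (1 - ?b) ^ Suc n" by (simp only: power_mult_distrib)
  finally show ?thesis .
qed

section \<open>Bounds for the particle Gibbs kernels\<close>

lemma (in prob_space) ennreal_integral_mean:
  fixes \<phi> :: "nat \<Rightarrow> 'a \<Rightarrow> real"
  assumes N: "N \<ge> 1" and m: "\<And>i. i < N \<Longrightarrow> \<phi> i \<in> borel_measurable M"
    and nn: "\<And>i x. i < N \<Longrightarrow> x \<in> space M \<Longrightarrow> 0 \<le> \<phi> i x"
    and le: "\<And>i x. i < N \<Longrightarrow> x \<in> space M \<Longrightarrow> \<phi> i x \<le> B"
  shows "ennreal (\<integral>x. (\<Sum>i<N. \<phi> i x) / N \<partial>M) = (\<integral>\<^sup>+ x. (\<Sum>i<N. ennreal (\<phi> i x)) * ennreal (1 / N) \<partial>M)"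
    and "0 \<le> (\<integral>x. (\<Sum>i<N. \<phi> i x) / N \<partial>M)"
proof -
  let ?\<phi> = "\<lambda>x. (\<Sum>i<N. \<phi> i x) / N"
  have bd: "0 \<le> ?\<phi> x" "?\<phi> x \<le> B" if "x \<in> space M" for x
  proof -
    show "0 \<le> ?\<phi> x" using nn that by (auto intro!: divide_nonneg_nonneg sum_nonneg)
    have "(\<Sum>i<N. \<phi> i x) \<le> (\<Sum>i<N. B)" using le that by (intro sum_mono) auto
    then show "?\<phi> x \<le> B" using N by (simp add: divide_le_eq mult.commute)
  qed
  have int: "integrable M ?\<phi>"
  proof (rule integrable_const_bound[OF AE_I2])
    show "?\<phi> \<in> borel_measurable M" using m by (intro borel_measurable_divide borel_measurable_sum) auto
    fix x assume "x \<in> space M"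
    from bd[OF this] show "norm (?\<phi> x) \<le> B" by (simp only: real_norm_def abs_of_nonneg)
  qed
  show "0 \<le> (\<integral>x. ?\<phi> x \<partial>M)" using bd by (intro integral_nonneg_AE AE_I2)
  have "ennreal (\<integral>x. ?\<phi> x \<partial>M) = (\<integral>\<^sup>+ x. ennreal (?\<phi> x) \<partial>M)"
    using bd by (intro nn_integral_eq_integral[symmetric] int AE_I2)
  also have "\<dots> = (\<integral>\<^sup>+ x. (\<Sum>i<N. ennreal (\<phi> i x)) * ennreal (1 / N) \<partial>M)"
  proof (intro nn_integral_cong)
    fix x assume x: "x \<in> space M"
    have "(\<Sum>i<N. ennreal (\<phi> i x)) = ennreal (\<Sum>i<N. \<phi> i x)" using nn[OF _ x] by (intro sum_ennreal) auto
    then show "ennreal (?\<phi> x) = (\<Sum>i<N. ennreal (\<phi> i x)) * ennreal (1 / N)"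
      by (simp add: ennreal_mult''[symmetric])
  qed
  finally show "ennreal (\<integral>x. ?\<phi> x \<partial>M) = (\<integral>\<^sup>+ x. (\<Sum>i<N. ennreal (\<phi> i x)) * ennreal (1 / N) \<partial>M)" .
qed

lemma ennreal_mean_empirical:
  assumes F: "is_fk_model F" and N: "N \<ge> 1" and z: "\<And>k. z k \<in> space (state F k)"
    and f: "f \<in> borel_measurable (state F n)" and nn: "\<And>y. y \<in> space (state F n) \<Longrightarrow> 0 \<le> f y"
    and B: "\<exists>B. \<forall>y\<in>space (state F n). f y \<le> B"
  defines "K \<equiv> (\<integral>x. (\<integral>y. f y \<partial>empirical N (state F n) (x n)) \<partial>dual_law F N z n)"
  shows "ennreal K = (\<integral>\<^sup>+ x. (\<Sum>i<N. ennreal (f (x n i))) * ennreal (1 / N) \<partial>dual_law F N z n)" and "0 \<le> K"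
proof -
  let ?L = "dual_law F N z n"
  interpret prob_space ?L using dual_law_in_prob_algebra[OF F N z] by (simp add: space_prob_algebra)
  have s: "sets ?L = sets (PiM {..n} (particle_space N F))" by (rule sets_dual_law[OF F N z])
  have xn: "x n \<in> space (particle_space N F n)" if "x \<in> space ?L" for x
    using that unfolding sets_eq_imp_space_eq[OF s] by (subst (asm) space_PiM) auto
  obtain B where B: "\<And>y. y \<in> space (state F n) \<Longrightarrow> f y \<le> B" using B by blast
  have m: "(\<lambda>x. f (x n i)) \<in> borel_measurable ?L" if "i < N" for i
    unfolding measurable_cong_sets[OF s refl] using that
    by (intro measurable_compose[OF measurable_compose[OF
      measurable_component_singleton[of n "{..n}" "\<lambda>k. particle_space N F k"]
      measurable_component_singleton[of i "{..<N}" "\<lambda>_. state F n"]] f]) auto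
  have K: "K = (\<integral>x. (\<Sum>i<N. f (x n i)) / N \<partial>?L)"
    unfolding K_def by (intro Bochner_Integration.integral_cong refl integral_empirical[OF N xn f])
  have lo: "0 \<le> f (x n i)" and up: "f (x n i) \<le> B" if "i < N" "x \<in> space ?L" for i x
    using nn[OF particle_in[OF N xn]] B[OF particle_in[OF N xn]] that by auto
  note mean = ennreal_integral_mean[of N "\<lambda>i x. f (x n i)" B, OF N]
  show "ennreal K = (\<integral>\<^sup>+ x. (\<Sum>i<N. ennreal (f (x n i))) * ennreal (1 / N) \<partial>?L)"
    unfolding K by (rule mean(1)) (use m lo up in auto)
  show "0 \<le> K" unfolding K by (rule mean(2)) (use m lo up in auto)
qed

text \<open>
  At horizon \<open>0\<close> there is no room for an error term, since \<open>n/N = 0\<close>: the two kernels coincide.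
\<close>

lemma gibbs_horizon_0:
  assumes F: "is_fk_model F" and N: "N \<ge> 1" and z: "\<And>k. z k \<in> space (state F k)"
    and f: "f \<in> borel_measurable (state F 0)" and nn: "\<And>y. y \<in> space (state F 0) \<Longrightarrow> 0 \<le> f y"
    and B: "\<exists>B. \<forall>y\<in>space (state F 0). f y \<le> B"
  shows "(\<integral>x. (\<integral>y. f y \<partial>empirical N (state F 0) (x 0)) \<partial>dual_law F N z 0) = fk_eta (frozen_model F N z) 0 f" (is "?K = _")
proof -
  let ?Fz = "frozen_model F N z"
  have Fz: "is_fk_model ?Fz" by (rule is_fk_model_frozen[OF F z])
  let ?g = "\<lambda>y. ennreal (f y)"
  have g: "?g \<in> borel_measurable (state F 0)" using f by simp
  have m: "(\<lambda>\<xi>. (\<Sum>i<N. ?g (\<xi> i)) * ennreal (1 / N)) \<in> borel_measurable (particle_space N F 0)"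
    using g by measurable
  have m0: "(\<lambda>x. (\<Sum>i<N. ?g (x 0 i)) * ennreal (1 / N)) \<in> borel_measurable (PiM {..0} (particle_space N F))"
    using measurable_compose[OF measurable_component_singleton[of 0 "{..0}" "\<lambda>k. particle_space N F k"] m] by simp
  have "ennreal ?K = (\<integral>\<^sup>+ \<xi>. (\<Sum>i<N. ?g (\<xi> i)) * ennreal (1 / N) \<partial>frozen_product N (state F 0) (init F) (z 0))"
    by (subst ennreal_mean_empirical(1)[OF F N z f nn B]) (simp_all add: nn_integral_dual_law_0[OF F N z m0])
  also have "\<dots> = (\<integral>\<^sup>+ y. ?g y \<partial>frozen_mixture N (state F 0) (init F) (z 0))"
    by (rule nn_integral_frozen_product_mean[OF N z fk_init[OF F] g])
  also have "\<dots> = ennreal (fk_gamma ?Fz 0 f)"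
    using fk_gamma_eq_nn_gamma(1)[OF Fz, of f 0] f nn B nn_gamma_0[OF Fz, of ?g] g by simp
  finally have "?K = fk_gamma ?Fz 0 f"
    using ennreal_mean_empirical(2)[OF F N z f nn B] fk_gamma_eq_nn_gamma(2)[OF Fz, of f 0] f nn B
    by (simp add: ennreal_inj)
  moreover have "fk_gamma ?Fz 0 (\<lambda>_. 1) = 1"
  proof -
    have "prob_space (init ?Fz)" using fk_init[OF Fz] by (simp add: space_prob_algebra)
    then have "ennreal (fk_gamma ?Fz 0 (\<lambda>_. 1)) = 1"
      by (subst fk_gamma_eq_nn_gamma[OF Fz]) (auto simp: nn_gamma_0[OF Fz] prob_space.emeasure_space_1 simp del: frozen_model_sel)
    then show ?thesis by simp
  qed
  ultimately show ?thesis by (simp add: fk_eta_def)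
qed

context dual_particles
begin

lemma gamma1_eq_1: "fk_gamma F n (\<lambda>_. 1) = 1 \<Longrightarrow> \<gamma>1 = 1"
  using fk_gamma_eq_nn_gamma(1)[OF F, of "\<lambda>_. 1" n] gamma1_eq gamma1_pos by (auto simp: ennreal_1[symmetric] simp del: ennreal_1)

lemma frozen_gamma_one_bounds:
  assumes "\<gamma>1 = 1"
  shows "(1 - 1 / N) ^ Suc n \<le> fk_gamma Fz n (\<lambda>_. 1)" and "fk_gamma Fz n (\<lambda>_. 1) \<le> (1 + r / N) ^ Suc n"
proof -
  have e: "ennreal (fk_gamma Fz n (\<lambda>_. 1)) = nn_gamma Fz n (\<lambda>_. 1)" "0 \<le> fk_gamma Fz n (\<lambda>_. 1)"
    using fk_gamma_eq_nn_gamma[OF Fz, of "\<lambda>_. 1" n] by auto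
  have "ennreal ((1 - 1 / N) ^ Suc n) \<le> ennreal (fk_gamma Fz n (\<lambda>_. 1))"
    using gamma_frozen_lower[of "\<lambda>_. 1" n] gamma1_eq assms e(1) by simp
  then show "(1 - 1 / N) ^ Suc n \<le> fk_gamma Fz n (\<lambda>_. 1)" using e(2) by (simp only: ennreal_le_iff)
  have "ennreal (fk_gamma Fz n (\<lambda>_. 1)) \<le> ennreal ((1 + r / N) ^ Suc n)"
    using gamma_frozen_upper assms e(1) by simp
  then show "fk_gamma Fz n (\<lambda>_. 1) \<le> (1 + r / N) ^ Suc n" using r_ge_1 by (subst (asm) ennreal_le_iff) auto
qed

lemma gibbs_bounds:
  assumes \<gamma>1: "\<gamma>1 = 1" and f: "f \<in> borel_measurable (state F n)" and nn: "\<And>y. y \<in> space (state F n) \<Longrightarrow> 0 \<le> f y"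
    and B: "\<exists>B. \<forall>y\<in>space (state F n). f y \<le> B"
  defines "K \<equiv> (\<integral>x. (\<integral>y. f y \<partial>empirical N (state F n) (x n)) \<partial>dual_law F N z n)"
  shows "K \<le> upper_factor ^ Suc n * fk_gamma Fz n f" and "fk_gamma Fz n f \<le> lower_factor ^ Suc n * K" and "0 \<le> K" and "0 \<le> fk_gamma Fz n f"
proof -
  have g: "(\<lambda>y. ennreal (f y)) \<in> borel_measurable (state F n)" using f by simp
  have KU: "ennreal K = mean_ratio n (\<lambda>y. ennreal (f y))"
    unfolding K_def by (rule trans[OF ennreal_mean_empirical(1)[OF F N1 z f nn B]]) (simp_all add: mean_ratio_def particle_ratio_def h_top)
  show K0: "0 \<le> K" unfolding K_def by (rule ennreal_mean_empirical(2)[OF F N1 z f nn B])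
  have e: "ennreal (fk_gamma Fz n f) = nn_gamma Fz n (\<lambda>y. ennreal (f y))" "0 \<le> fk_gamma Fz n f"
    using fk_gamma_eq_nn_gamma[OF Fz, of f n] f nn B by auto
  then show "0 \<le> fk_gamma Fz n f" by simp
  have "ennreal K \<le> ennreal (upper_factor ^ Suc n * fk_gamma Fz n f)"
    using mean_ratio_upper[OF order_refl g] upper_factor_nonneg e(2) by (simp add: KU \<gamma>1 e(1)[symmetric] ennreal_mult)
  then show "K \<le> upper_factor ^ Suc n * fk_gamma Fz n f" using upper_factor_nonneg e(2) by (subst (asm) ennreal_le_iff) auto
  have "ennreal (fk_gamma Fz n f) \<le> ennreal (lower_factor ^ Suc n * K)"
    using mean_ratio_lower[OF order_refl g] lower_factor_pos K0 by (simp add: KU[symmetric] \<gamma>1 e(1)[symmetric] ennreal_mult)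
  then show "fk_gamma Fz n f \<le> lower_factor ^ Suc n * K" using lower_factor_pos K0 by (subst (asm) ennreal_le_iff) auto
qed

lemma gibbs_relative_bounds:
  assumes \<gamma>1: "\<gamma>1 = 1" and f: "f \<in> borel_measurable (state F n)" and nn: "\<And>y. y \<in> space (state F n) \<Longrightarrow> 0 \<le> f y"
    and B: "\<exists>B. \<forall>y\<in>space (state F n). f y \<le> B" and n: "1 \<le> n" and c: "8 * (1 + r) * n \<le> N"
  defines "K \<equiv> (\<integral>x. (\<integral>y. f y \<partial>empirical N (state F n) (x n)) \<partial>dual_law F N z n)"
  shows "(1 - 8 * (1 + r) * n / N) * fk_eta Fz n f \<le> K" and "K \<le> (1 + 8 * (1 + r) * n / N) * fk_eta Fz n f"
proof -
  let ?g = "fk_gamma Fz n f" and ?g1 = "fk_gamma Fz n (\<lambda>_. 1)" and ?b = "(1 - 1 / real N) ^ Suc n" and ?\<epsilon> = "8 * (1 + r) * n / N"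
  note bounds = gibbs_bounds[OF \<gamma>1 f nn B, folded K_def]
  note one = frozen_gamma_one_bounds[OF \<gamma>1]
  have b: "0 < ?b" "?b \<le> 1" using N by (auto intro!: power_le_one zero_less_power simp del: power_Suc)
  have \<epsilon>: "?\<epsilon> \<le> 1" using c N by (simp add: divide_le_eq)
  have g1: "0 < ?g1" using one(1) b by linarith
  have "(1 - ?\<epsilon>) * ?g \<le> (1 - ?\<epsilon>) * (lower_factor ^ Suc n * K)" using \<epsilon> bounds(2) by (intro mult_left_mono) auto
  also have "\<dots> = ((1 - ?\<epsilon>) * lower_factor ^ Suc n) * K" by (simp only: mult.assoc)
  also have "\<dots> \<le> (?b * ?b) * K"
    unfolding lower_factor_def using lower_constant[OF n r_ge_1 c] bounds(3) by (intro mult_right_mono) auto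
  also have "\<dots> \<le> (?g1 * 1) * K" using one(1) b g1 bounds(3) by (intro mult_right_mono mult_mono) auto
  finally show "(1 - ?\<epsilon>) * fk_eta Fz n f \<le> K" using g1 by (simp add: fk_eta_def divide_le_eq mult.commute)
  have "K * ?g1 \<le> (upper_factor ^ Suc n * ?g) * (1 + r / N) ^ Suc n" using bounds(1,3) one(2) g1 upper_factor_nonneg bounds(4) by (intro mult_mono) auto
  also have "\<dots> = (upper_factor ^ Suc n * (1 + r / N) ^ Suc n) * ?g" by (simp only: mult_ac)
  also have "\<dots> \<le> (1 + ?\<epsilon>) * ?g"
    unfolding upper_factor_def using upper_constant[OF n r_ge_1 c] bounds(4) by (intro mult_right_mono) auto
  finally show "K \<le> (1 + ?\<epsilon>) * fk_eta Fz n f" using g1 by (simp add: fk_eta_def le_divide_eq)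
qed

end

text \<open>
  The marginal flow is the path flow tested on functions of the last state. In particular both models have
  the same normalising constants.
\<close>

lemma nn_gamma_path_model:
  assumes F: "is_fk_model F"
  shows "g \<in> borel_measurable (state F k) \<Longrightarrow> nn_gamma (path_model F) k (\<lambda>w. g (w k)) = nn_gamma F k g"
proof (induction k arbitrary: g)
  case 0
  have m: "(\<lambda>w. g (w 0)) \<in> borel_measurable (path_space F 0)"
    by (rule measurable_compose[OF measurable_component_singleton[of 0 "{..0}" "state F"] 0]) simp
  show ?case
    using nn_gamma_0[OF is_fk_model_path[OF F], unfolded path_model_sel, OF m]
      path_init_in_prob_algebra(2)[where S="state F", OF fk_init[OF F] m] nn_gamma_0[OF F 0] by simp
next
  case (Suc k)
  have PM: "is_fk_model (path_model F)" by (rule is_fk_model_path[OF F])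
  have m: "(\<lambda>w. g (w (Suc k))) \<in> borel_measurable (path_space F (Suc k))"
    by (rule measurable_compose[OF measurable_component_singleton[of "Suc k" "{..Suc k}" "state F"] Suc.prems]) simp
  have "nn_gamma (path_model F) (Suc k) (\<lambda>w. g (w (Suc k))) = nn_gamma (path_model F) k (nn_step (path_model F) k (\<lambda>w. g (w (Suc k))))"
    using m by (intro nn_gamma_Suc[OF PM]) simp
  also have "\<dots> = nn_gamma (path_model F) k (\<lambda>w. nn_step F k g (w k))"
    by (intro nn_gamma_cong[OF PM]) (simp add: nn_step_path_model[OF F _ m] nn_step_def[of F])
  also have "\<dots> = nn_gamma F (Suc k) g"
    using Suc.IH[OF measurable_nn_step[OF F Suc.prems]] nn_gamma_Suc[OF F Suc.prems] by simp
  finally show ?case .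
qed

context backward_particles
begin

lemma backward_gibbs_eq:
  assumes f: "f \<in> borel_measurable (path_space F n)" and nn: "\<And>y. y \<in> space (path_space F n) \<Longrightarrow> 0 \<le> f y"
    and B: "\<exists>B. \<forall>y\<in>space (path_space F n). f y \<le> B"
  shows "ennreal (gibbs_backward_kernel F H N n f z) = backward_mean_ratio n (\<lambda>y. ennreal (f y))" and "0 \<le> gibbs_backward_kernel F H N n f z"
proof -
  let ?L = "dual_law F N z n" and ?g = "\<lambda>y. ennreal (f y)"
  let ?bs = "\<lambda>x. backward_sum H N x n ?g"
  interpret prob_space ?L using dual_law_in_prob_algebra[OF F N1 z] by (simp add: space_prob_algebra)
  have s: "sets ?L = sets (PS n)" by (rule sets_dual_law[OF F N1 z])
  have g: "?g \<in> borel_measurable (path_space F n)" using f by simp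
  obtain B where B: "\<And>y. y \<in> space (path_space F n) \<Longrightarrow> f y \<le> B" using B by blast
  have xs: "x j \<in> space (particle_space N F j)" if "x \<in> space ?L" "j \<le> n" for x j
    using dual_component[OF that] .
  have le: "?bs x u \<le> ennreal B" if x: "x \<in> space ?L" and u: "u \<in> space (state F n)" for x u
    using B by (intro backward_sum_le[of n, OF xs[OF x] order_refl u] ennreal_leI) auto
  have fin: "?bs x u < \<infinity>" if "x \<in> space ?L" "u \<in> space (state F n)" for x u
    using le[OF that] by (simp add: order_le_less_trans)
  have inner: "(\<integral>y. f y \<partial>backward_kernel F H n (\<lambda>k. empirical N (state F k) (x k)) u) = enn2real (?bs x u)"
    if x: "x \<in> space ?L" and u: "u \<in> space (state F n)" for x u
  proof -
    let ?BK = "backward_kernel F H n (\<lambda>k. empirical N (state F k) (x k)) u"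
    have sBK: "sets ?BK = sets (path_space F n)"
      unfolding backward_kernel_def sets_density by (rule sets_PiM_cong) (auto simp: empirical_def)
    have "(\<integral>y. f y \<partial>?BK) = enn2real (\<integral>\<^sup>+ y. ?g y \<partial>?BK)"
      using f nn by (intro integral_eq_nn_integral) (auto intro!: AE_I2 simp: measurable_cong_sets[OF sBK refl] sets_eq_imp_space_eq[OF sBK])
    also have "(\<integral>\<^sup>+ y. ?g y \<partial>?BK) = ?bs x u"
      by (rule nn_integral_backward_kernel[of n, OF xs[OF x] order_refl u g]) auto
    finally show ?thesis .
  qed
  let ?\<phi> = "\<lambda>x. (\<Sum>i<N. enn2real (?bs x (x n i))) / N"
  have middle: "(\<integral>u. (\<integral>y. f y \<partial>backward_kernel F H n (\<lambda>k. empirical N (state F k) (x k)) u) \<partial>empirical N (state F n) (x n)) = ?\<phi> x"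
    if x: "x \<in> space ?L" for x
  proof -
    have xn: "x n \<in> space (particle_space N F n)" by (rule xs[OF x order_refl])
    have bm: "?bs x \<in> borel_measurable (state F n)"
      using xs[OF x] by (intro backward_sum_measurable_state[OF g]) auto
    have "(\<lambda>u. enn2real (?bs x u)) \<in> borel_measurable (state F n)" using bm by simp
    moreover have "(\<integral>u. (\<integral>y. f y \<partial>backward_kernel F H n (\<lambda>k. empirical N (state F k) (x k)) u) \<partial>empirical N (state F n) (x n))
      = (\<integral>u. enn2real (?bs x u) \<partial>empirical N (state F n) (x n))"
      by (intro Bochner_Integration.integral_cong refl inner[OF x]) (simp add: empirical_def)
    ultimately show ?thesis using integral_empirical[OF N1 xn] by simp
  qed
  have K: "gibbs_backward_kernel F H N n f z = (\<integral>x. ?\<phi> x \<partial>?L)"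
    unfolding gibbs_backward_kernel_def by (intro Bochner_Integration.integral_cong refl middle)
  note p = particle_in[OF N1 xs[OF _ order_refl]]
  have m: "(\<lambda>x. enn2real (?bs x (x n i))) \<in> borel_measurable ?L" if "i < N" for i
    unfolding measurable_cong_sets[OF s refl]
    by (intro borel_measurable_enn2real measurable_backward_sum_particle[OF g that])
  have up: "enn2real (?bs x (x n i)) \<le> \<bar>B\<bar>" if "i < N" "x \<in> space ?L" for i x
    using le[OF that(2) p[OF that(2,1)]] by (intro enn2real_leI) (auto intro: order_trans ennreal_leI)
  note mean = ennreal_integral_mean[of N "\<lambda>i x. enn2real (?bs x (x n i))" "\<bar>B\<bar>", OF N1 m enn2real_nonneg up]
  show "0 \<le> gibbs_backward_kernel F H N n f z" unfolding K by (rule mean(2))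
  have "ennreal (gibbs_backward_kernel F H N n f z)
    = (\<integral>\<^sup>+ x. (\<Sum>i<N. ennreal (enn2real (?bs x (x n i)))) * ennreal (1 / N) \<partial>?L)"
    unfolding K by (rule mean(1))
  also have "\<dots> = backward_mean_ratio n ?g" unfolding backward_mean_ratio_def
  proof (rule nn_integral_cong)
    fix x assume x: "x \<in> space ?L"
    have "(\<Sum>i<N. ennreal (enn2real (?bs x (x n i)))) = (\<Sum>i<N. ?bs x (x n i))"
      by (intro sum.cong refl ennreal_enn2real) (use fin[OF x p[OF x]] in auto)
    then show "(\<Sum>i<N. ennreal (enn2real (?bs x (x n i)))) * ennreal (1 / N) = particle_ratio N (?bs x) (h n) (x n)"
      by (simp only: particle_ratio_def h_top) simp
  qed
  finally show "ennreal (gibbs_backward_kernel F H N n f z) = backward_mean_ratio n ?g" .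
qed

text \<open>
  Here \<open>g1\<close> stands for \<open>\<gamma>\<^sub>z\<^sub>,\<^sub>n(1)\<close>, which belongs to the particle system of the path model and enters
  through its lower bound alone.
\<close>

lemma backward_gibbs_lower:
  assumes \<gamma>1: "\<gamma>1 = 1" and f: "f \<in> borel_measurable (path_space F n)" and nn: "\<And>y. y \<in> space (path_space F n) \<Longrightarrow> 0 \<le> f y"
    and B: "\<exists>B. \<forall>y\<in>space (path_space F n). f y \<le> B" and n: "1 \<le> n" and c: "8 * (1 + r) * n \<le> N"
    and g1: "(1 - 1 / real N) ^ Suc n \<le> g1"
  shows "(1 - 8 * (1 + r) * n / N) * (fk_gamma (path_model F) n f / g1) \<le> gibbs_backward_kernel F H N n f z"
proof -
  let ?b = "(1 - 1 / real N) ^ Suc n" and ?\<epsilon> = "8 * (1 + r) * n / N" and ?K = "gibbs_backward_kernel F H N n f z"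
  let ?g = "fk_gamma (path_model F) n f"
  have PM: "is_fk_model (path_model F)" by (rule is_fk_model_path[OF F])
  have b: "0 < ?b" using N by (intro zero_less_power) simp
  have \<epsilon>: "?\<epsilon> \<le> 1" using c N by (simp add: divide_le_eq)
  have e: "ennreal ?g = nn_gamma (path_model F) n (\<lambda>y. ennreal (f y))" "0 \<le> ?g"
    using fk_gamma_eq_nn_gamma[OF PM, of f n] f nn B by auto
  note backward_mean_ratio = backward_gibbs_eq[OF f nn B]
  have gm: "(\<lambda>y. ennreal (f y)) \<in> borel_measurable (path_space F n)" using f by simp
  have "ennreal (?b * ?g) \<le> ennreal (lower_factor ^ Suc n * ?K)"
    using backward_mean_ratio_lower[OF order_refl gm] b lower_factor_pos e(2) backward_mean_ratio(2)
    by (simp add: \<gamma>1 e(1)[symmetric] backward_mean_ratio(1)[symmetric] ennreal_mult less_imp_le del: power_Suc)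
  then have le: "?b * ?g \<le> lower_factor ^ Suc n * ?K" using lower_factor_pos backward_mean_ratio(2) by (subst (asm) ennreal_le_iff) (auto intro!: mult_nonneg_nonneg)
  have "(1 - ?\<epsilon>) * (?b * ?g) \<le> (1 - ?\<epsilon>) * (lower_factor ^ Suc n * ?K)" using \<epsilon> le by (intro mult_left_mono) auto
  also have "\<dots> = ((1 - ?\<epsilon>) * lower_factor ^ Suc n) * ?K" by (simp only: mult.assoc)
  also have "\<dots> \<le> (?b * ?b) * ?K"
    unfolding lower_factor_def using lower_constant[OF n r_ge_1 c] backward_mean_ratio(2) by (intro mult_right_mono) auto
  finally have "?b * ((1 - ?\<epsilon>) * ?g) \<le> ?b * (?b * ?K)" by (simp only: mult_ac)
  then have "(1 - ?\<epsilon>) * ?g \<le> ?b * ?K" using b by (simp only: mult_le_cancel_left_pos)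
  also have "\<dots> \<le> g1 * ?K" using g1 backward_mean_ratio(2) by (intro mult_right_mono) auto
  finally show ?thesis using b g1 by (simp add: divide_le_eq mult.commute)
qed

end

text \<open>
  The law of the chain up to time \<open>n\<close> involves the kernels up to time \<open>n\<close>. Thus a frozen path of length \<open>n\<close>
  may be prolonged arbitrarily inside the state spaces.
\<close>

lemma fk_gamma_cong:
  assumes "state F = state F'" "pot F = pot F'" "init F = init F'" "\<And>k x. 1 \<le> k \<Longrightarrow> k \<le> n \<Longrightarrow> mkernel F k x = mkernel F' k x"
  shows "fk_gamma F n f = fk_gamma F' n f"
  unfolding fk_gamma_def using assms chain_law_cong[of n "mkernel F" "mkernel F'"] by simp

lemma dual_law_cong:
  assumes "\<And>k. k \<le> n \<Longrightarrow> z k = z' k"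
  shows "dual_law F N z n = dual_law F N z' n"
proof -
  have "z 0 = z' 0" by (rule assms) simp
  show ?thesis unfolding dual_law_def \<open>z 0 = z' 0\<close> by (rule chain_law_cong) (simp add: assms)
qed

theorem theorem4p2:
  "\<exists>c :: real \<Rightarrow> real. \<forall>F :: 'a fk_model.
     is_fk_model F \<and>
     (\<forall>k. fk_eta (path_model F) k (pot (path_model F) k) = 1) \<and>
     fk_A1 F \<and> fk_A2 F \<longrightarrow>
     (\<forall>(n::nat) (N::nat) f z.
        f \<in> borel_measurable (state (path_model F) n) \<and>
        (\<forall>w\<in>space (state (path_model F) n). 0 \<le> f w) \<and>
        (\<exists>B. \<forall>w\<in>space (state (path_model F) n). f w \<le> B) \<and>
        z \<in> space (state (path_model F) n) \<and>
        1 \<le> N \<and> c (fk_rho F) * real n \<le> real N \<longrightarrow>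
        (1 - c (fk_rho F) * real n / real N) * fk_eta (frozen_path_model F N z) n f
          \<le> gibbs_kernel F N n f z \<and>
        gibbs_kernel F N n f z
          \<le> (1 + c (fk_rho F) * real n / real N) * fk_eta (frozen_path_model F N z) n f \<and>
        (\<forall>H \<nu>. backward_density F H \<nu> \<and> 1 \<le> n \<longrightarrow>
           gibbs_backward_kernel F H N n f z
             \<ge> (1 - c (fk_rho F) * real n / real N) *
                (fk_eta (path_model F) n f / fk_gamma (frozen_path_model F N z) n (\<lambda>_. 1))))"
proof (rule exI[of _ "\<lambda>r. 8 * (1 + r)"], intro allI impI)
  fix F :: "'a fk_model" and n N :: nat and f :: "(nat \<Rightarrow> 'a) \<Rightarrow> real" and z
  assume A: "is_fk_model F \<and> (\<forall>k. fk_eta (path_model F) k (pot (path_model F) k) = 1) \<and> fk_A1 F \<and> fk_A2 F"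
  assume A': "f \<in> borel_measurable (state (path_model F) n) \<and>
        (\<forall>w\<in>space (state (path_model F) n). 0 \<le> f w) \<and>
        (\<exists>B. \<forall>w\<in>space (state (path_model F) n). f w \<le> B) \<and>
        z \<in> space (state (path_model F) n) \<and>
        1 \<le> N \<and> 8 * (1 + fk_rho F) * real n \<le> real N"
  let ?P = "path_model F" and ?r = "fk_rho F"
  have F: "is_fk_model F" and norm: "\<And>k. fk_eta ?P k (pot ?P k) = 1" and A2: "fk_A2 F" using A by auto
  have f: "f \<in> borel_measurable (state ?P n)" and nn: "\<And>w. w \<in> space (state ?P n) \<Longrightarrow> 0 \<le> f w"
    and B: "\<exists>B. \<forall>w\<in>space (state ?P n). f w \<le> B" and zP: "z \<in> space (state ?P n)"
    and N1: "1 \<le> N" and c: "8 * (1 + ?r) * real n \<le> real N"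
    using A' by (elim conjE, assumption | blast)+
  have P: "is_fk_model ?P" by (rule is_fk_model_path[OF F])
  have r: "fk_ratio_bound F n ?r" by (rule ratio_bound_rho[OF F A2])
  have r1: "1 \<le> ?r" by (rule ratio_bound_ge_1[OF F r])
  have rP: "fk_ratio_bound ?P n ?r" by (rule ratio_bound_path_model[OF F r])
  \<comment> \<open>beyond the horizon \<open>z\<close> is undefined, whereas the dual system is set up with a frozen state at every time\<close>
  define z' where "z' k = (if k \<le> n then z k else (SOME y. y \<in> space (state F k)))" for k
  have z': "z' k \<in> space (state F k)" for k
    using zP fk_state_nonempty[OF F, of k] by (auto simp: z'_def space_PiM PiE_iff some_in_eq)
  define Z where "Z k = restrict z' {..k}" for k
  have Z: "Z k \<in> space (state ?P k)" for k using z' by (auto simp: Z_def space_PiM)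
  have zZ: "restrict z {..k} = Z k" if "k \<le> n" for k using that by (auto simp: Z_def z'_def restrict_def fun_eq_iff)
  let ?FZ = "frozen_model ?P N Z"
  have gamma_eq: "fk_gamma (frozen_path_model F N z) n g = fk_gamma ?FZ n g" for g
    unfolding frozen_path_model_def
    using zZ[of 0] by (intro fk_gamma_cong) (simp_all add: zZ)
  have eta_eq: "fk_eta (frozen_path_model F N z) n f = fk_eta ?FZ n f" by (simp add: fk_eta_def gamma_eq)
  have gibbs_eq: "gibbs_kernel F N n f z = (\<integral>x. (\<integral>y. f y \<partial>empirical N (state ?P n) (x n)) \<partial>dual_law ?P N Z n)"
    unfolding gibbs_kernel_def using dual_law_cong[of n "\<lambda>k. restrict z {..k}" Z ?P N] zZ by simp
  have one: "fk_gamma ?P n (\<lambda>_. 1) = 1" by (rule fk_gamma_one[OF P norm])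
  show "(1 - 8 * (1 + ?r) * real n / real N) * fk_eta (frozen_path_model F N z) n f \<le> gibbs_kernel F N n f z \<and>
        gibbs_kernel F N n f z \<le> (1 + 8 * (1 + ?r) * real n / real N) * fk_eta (frozen_path_model F N z) n f \<and>
        (\<forall>H \<nu>. backward_density F H \<nu> \<and> 1 \<le> n \<longrightarrow>
           gibbs_backward_kernel F H N n f z
             \<ge> (1 - 8 * (1 + ?r) * real n / real N) *
                (fk_eta ?P n f / fk_gamma (frozen_path_model F N z) n (\<lambda>_. 1)))"
  proof (cases "n = 0")
    case True
    have "gibbs_kernel F N n f z = fk_eta ?FZ n f"
      unfolding gibbs_eq using gibbs_horizon_0[OF P N1 Z, of f] f nn B True by (simp del: path_model_sel)
    then show ?thesis using True eta_eq by simp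
  next
    case False
    then have n1: "1 \<le> n" by simp
    have "8 * (1 + 1) * 1 \<le> 8 * (1 + ?r) * real n" using n1 r1 by (intro mult_mono) auto
    from order_trans[OF this c] have N2: "2 \<le> N" by simp
    interpret P: dual_particles ?P n ?r N Z
      by unfold_locales (use P rP N2 Z in auto)
    have \<gamma>P: "P.\<gamma>1 = 1" by (rule P.gamma1_eq_1[OF one])
    note bounds = P.gibbs_relative_bounds[OF \<gamma>P f nn B n1 c]
    have flat: "(1 - 8 * (1 + ?r) * real n / real N) * (fk_eta ?P n f / fk_gamma (frozen_path_model F N z) n (\<lambda>_. 1))
      \<le> gibbs_backward_kernel F H N n f z" if H: "backward_density F H \<nu>" for H \<nu>
    proof -
      interpret b: backward_particles F n ?r N z' H \<nu>
        by unfold_locales (use F r N2 z' H in auto)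
      have "nn_gamma F n (\<lambda>_. 1) = nn_gamma ?P n (\<lambda>_. 1)" by (rule nn_gamma_path_model[OF F, symmetric]) simp
      moreover have "ennreal (fk_gamma F n (\<lambda>_. 1)) = nn_gamma F n (\<lambda>_. ennreal 1)"
        by (rule fk_gamma_eq_nn_gamma(1)[OF F]) auto
      moreover have "ennreal (fk_gamma ?P n (\<lambda>_. 1)) = nn_gamma ?P n (\<lambda>_. ennreal 1)"
        by (rule fk_gamma_eq_nn_gamma(1)[OF P]) auto
      ultimately have "fk_gamma F n (\<lambda>_. 1) = 1" using one by simp
      then have \<gamma>: "b.\<gamma>1 = 1" by (rule b.gamma1_eq_1)
      have "(1 - 8 * (1 + ?r) * real n / real N) * (fk_gamma ?P n f / fk_gamma ?FZ n (\<lambda>_. 1)) \<le> gibbs_backward_kernel F H N n f z'"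
        using f nn B by (intro b.backward_gibbs_lower[OF \<gamma> _ _ _ n1 c P.frozen_gamma_one_bounds(1)[OF \<gamma>P]]) auto
      moreover have "gibbs_backward_kernel F H N n f z' = gibbs_backward_kernel F H N n f z"
        unfolding gibbs_backward_kernel_def using dual_law_cong[of n z z' F N] by (simp add: z'_def)
      ultimately show ?thesis using one by (simp add: gamma_eq fk_eta_def)
    qed
    show ?thesis using bounds flat unfolding gibbs_eq eta_eq by blast
  qed
qed

end
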